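(* Let $0<T<\infty$, let $r\ge 16$ be an integer, let $u_0\in H^r$ be real-valued and $2\pi$-periodic, and let $C_0>0$. For each positive integer $N$ let $U=U_N:[0,\infty)\to S_N$ be the real-valued solution of the semi-discrete problem $$(U_t+UU_x+U_{xxx}-U_{xxxxx},\phi)=0\quad\text{for all }\phi\in S_N,\ t\ge0,\qquad U(0)=P_Nu_0.$$ Then there exist constants $C_1>0$ and $C>0$, independent of $N$ and $\Delta t$, such that the following holds. Let $N, M$ be positive integers, $\Delta t=T/M$, $t_m=m\Delta t$, and suppose $$N^5\Delta t\le C_1.$$ Let $U^0,U^1,\dots,U^M\in S_N$ be real-valued and satisfy the leap-frog scheme $$(U^{m+1}-U^{m-1},\phi)+2\Delta t\,(U^mU^m_x+U^m_{xxx}-U^m_{xxxxx},\phi)=0\quad\text{for all }\phi\in S_N,\ 1\le m\le M-1,$$ with $U^0=U(0)$ and with $U^1$ computed so that $\|U^1-U(\Delta t)\|\le C_0\,\Delta t^2$. Then $$\max_{0\le m\le M}\|U^m-U(t_m)\|\le C\,\Delta t^2.$$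
   Context: All functions are $2\pi$-periodic in $x$; function spaces are on $[-\pi,\pi]$. $(f,g)=\int_{-\pi}^{\pi} f\,\overline{g}\,dx$ is the $L^2$ inner product and $\|\cdot\|$ its norm. With $\hat f(k)=\frac1{2\pi}\int_{-\pi}^{\pi}e^{-ikx}f(x)\,dx$, the periodic Sobolev space $H^r$ has norm $\|f\|_r=\left(\sum_{k\in\mathbb Z}(1+k^2)^r|\hat f(k)|^2\right)^{1/2}$. $S_N=\mathrm{span}\{e^{ikx}: k\in\mathbb Z,\ -N\le k\le N\}$ and $P_N$ is the $L^2$-orthogonal projection onto $S_N$. The semi-discrete problem has a unique real-valued solution for all $t\ge0$. Constants may depend on $T$, $r$, $u_0$ and $C_0$. *)

theory Defs
  imports "HOL-Analysis.Analysis"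
begin

text \<open>Functions of \<open>x\<close> are functions \<open>real \<Rightarrow> complex\<close> on the whole line; real-valued ones are
  singled out by \<^const>\<open>Reals\<close>.\<close>

definition real_valued :: "(real \<Rightarrow> complex) \<Rightarrow> bool" where
  "real_valued f \<longleftrightarrow> (\<forall>x. f x \<in> \<real>)"

definition periodic_2pi :: "(real \<Rightarrow> complex) \<Rightarrow> bool" where
  "periodic_2pi f \<longleftrightarrow> (\<forall>x. f (x + 2 * pi) = f x)"

definition l2_inner :: "(real \<Rightarrow> complex) \<Rightarrow> (real \<Rightarrow> complex) \<Rightarrow> complex" where
  "l2_inner f g = (LINT x:{-pi..pi}|lebesgue. f x * cnj (g x))"

definition l2_norm :: "(real \<Rightarrow> complex) \<Rightarrow> real" where
  "l2_norm f = sqrt (Re (l2_inner f f))"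

definition fourier_coeff :: "(real \<Rightarrow> complex) \<Rightarrow> int \<Rightarrow> complex" where
  "fourier_coeff f k =
     1 / (2 * pi) * (LINT x:{-pi..pi}|lebesgue. exp (- \<i> * of_int k * of_real x) * f x)"

text \<open>The members of the periodic Sobolev space are represented by actual functions rather than by
  classes modulo null sets. For \<open>r \<ge> 0\<close> the space consists of the \<open>L\<^sup>2\<close> functions whose
  \<open>H\<^sup>r\<close> norm is finite.\<close>

definition sobolev_space :: "nat \<Rightarrow> (real \<Rightarrow> complex) set" where
  "sobolev_space r = {f. periodic_2pi f \<and> f \<in> borel_measurable lebesgue \<and>
     set_integrable lebesgue {-pi..pi} (\<lambda>x. (cmod (f x))\<^sup>2) \<and>
     (\<lambda>k::int. (1 + (real_of_int k)\<^sup>2) ^ r * (cmod (fourier_coeff f k))\<^sup>2) summable_on UNIV}"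

definition trig_space :: "nat \<Rightarrow> (real \<Rightarrow> complex) set" where
  "trig_space N = {f. \<exists>c :: int \<Rightarrow> complex.
     f = (\<lambda>x. \<Sum>k\<in>{- int N..int N}. c k * exp (\<i> * of_int k * of_real x))}"

definition trig_proj :: "nat \<Rightarrow> (real \<Rightarrow> complex) \<Rightarrow> (real \<Rightarrow> complex)" where
  "trig_proj N f =
     (THE g. g \<in> trig_space N \<and> (\<forall>\<phi>\<in>trig_space N. l2_inner (\<lambda>x. f x - g x) \<phi> = 0))"

definition Dx :: "(real \<Rightarrow> complex) \<Rightarrow> (real \<Rightarrow> complex)" where
  "Dx f = (\<lambda>x. vector_derivative f (at x))"

definition kawahara_op :: "(real \<Rightarrow> complex) \<Rightarrow> (real \<Rightarrow> complex)" where
  "kawahara_op u = (\<lambda>x. u x * Dx u x + (Dx ^^ 3) u x - (Dx ^^ 5) u x)"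

text \<open>The time derivative is taken pointwise in \<open>x\<close> and is one-sided at \<open>t = 0\<close>. Since
  the space of trigonometric polynomials is finite-dimensional, pointwise differentiability in \<open>t\<close>
  is the same as differentiability as a curve in that space. Nothing is required for \<open>t < 0\<close>.\<close>

definition semidiscrete_solution ::
    "nat \<Rightarrow> (real \<Rightarrow> complex) \<Rightarrow> (real \<Rightarrow> real \<Rightarrow> complex) \<Rightarrow> bool" where
  "semidiscrete_solution N u0 U \<longleftrightarrow>
     (\<forall>t\<ge>0. U t \<in> trig_space N \<and> real_valued (U t)) \<and>
     (\<forall>t\<ge>0. \<forall>x. (\<lambda>s. U s x) differentiable (at t within {0..})) \<and>
     (\<forall>t\<ge>0. \<forall>\<phi>\<in>trig_space N.
        l2_inner (\<lambda>x. vector_derivative (\<lambda>s. U s x) (at t within {0..}) + kawahara_op (U t) x) \<phi> = 0) \<and>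
     U 0 = trig_proj N u0"

definition leapfrog ::
    "nat \<Rightarrow> nat \<Rightarrow> real \<Rightarrow> (nat \<Rightarrow> real \<Rightarrow> complex) \<Rightarrow> bool" where
  "leapfrog N M dt V \<longleftrightarrow>
     (\<forall>m\<le>M. V m \<in> trig_space N \<and> real_valued (V m)) \<and>
     (\<forall>m. 1 \<le> m \<and> m \<le> M - 1 \<longrightarrow> (\<forall>\<phi>\<in>trig_space N.
        l2_inner (\<lambda>x. V (m + 1) x - V (m - 1) x) \<phi>
          + 2 * of_real dt * l2_inner (kawahara_op (V m)) \<phi> = 0))"

end

theory Submission
  imports Defs "HOL-Library.Function_Algebras"
begin

text \<open>The truncated equation conserves the \<open>L\<^sup>2\<close> norm and the Hamiltonian, which bounds \<open>U\<close> in \<open>H\<^sup>2\<close>; linear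
  Gronwall arguments then bound it in \<open>H\<^sup>s\<close> on \<open>[0, T]\<close> for \<open>s = 3, \<dots>, 16\<close>, uniformly in \<open>N\<close>. Hence the third
  time derivative is bounded, and the truncation error of the scheme is of order \<open>\<Delta>\<^sup>3\<close>. For the error \<open>e\<close>
  of the scheme, split \<open>D (U * e)\<close> into a skew-symmetric part and \<open>D U * e / 2\<close>, and let \<open>S\<close> be the bilinear
  form of all the skew-symmetric terms. The quantity
  \<open>|e (m + 1)|\<^sup>2 + |e m|\<^sup>2 + 2 * \<Delta> * S (e m, e (m + 1))\<close> is comparable to
  \<open>|e (m + 1)|\<^sup>2 + |e m|\<^sup>2\<close> when \<open>N\<^sup>5 * \<Delta>\<close> is small, and it satisfies a discrete Gronwall inequality as long
  as \<open>N * sup |e|\<close> is at most \<open>1\<close>. Since \<open>|e m|\<close> is of order \<open>\<Delta>\<^sup>2\<close>, the inverse inequality propagates this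
  last condition from step to step.\<close>

section \<open>Real trigonometric polynomials\<close>

text \<open>The leap-frog scheme has no dissipation. Its natural test function, the sum of the
  errors at the two outer time levels, turns the time difference into a difference of squares, but
  it does not annihilate the dispersive terms: they leave a form in neighbouring levels. Estimating
  that form by the inverse inequality costs \<open>2 * \<Delta> * N ^ 5\<close>, which is merely
  bounded and leaves no factor \<Delta> for Gronwall's inequality; hence it is made part of the
  energy instead. Products of members of \<open>real_trig N\<close> leave that space. This does no
  harm to the energy identities: the projection commutes with \<open>D\<close> and is invisible to
  test functions in \<open>real_trig N\<close>, so the identities of the untruncated equation
  survive, and all constants are independent of \<open>N\<close>. The Hamiltonian has to reach the
  second derivative because the energy estimates of higher order need \<open>D u\<close> bounded in
  the supremum norm, which is the price of one derivative more. The estimates concern real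
  functions, where \<open>u * D u\<close> admits integration by parts against \<open>u\<close>; the
  complex setting of the theorem is translated only at the end.\<close>

definition cst :: "real \<Rightarrow> real \<Rightarrow> real" where "cst c = (\<lambda>_. c)"

text \<open>Hartley's basis: unlike sines and cosines, it needs no case distinction on the sign of \<open>k\<close>, all its
  members have the same norm, and differentiation maps \<open>cas k\<close> to \<open>k cas (- k)\<close>.\<close>

definition cas :: "int \<Rightarrow> real \<Rightarrow> real" where
  "cas k = (\<lambda>x. cos (of_int k * x) + sin (of_int k * x))"

definition real_trig :: "nat \<Rightarrow> (real \<Rightarrow> real) set" where
  "real_trig N = {f. \<exists>a. f = (\<Sum>k\<in>{- int N..int N}. cst (a k) * cas k)}"

definition trig_poly :: "(real \<Rightarrow> real) set" where
  "trig_poly = (\<Union>N. real_trig N)"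

definition Itg :: "(real \<Rightarrow> real) \<Rightarrow> real" where
  "Itg f = integral {-pi..pi} f"

definition nrm :: "(real \<Rightarrow> real) \<Rightarrow> real" where
  "nrm f = sqrt (Itg (f * f))"

abbreviation D :: "(real \<Rightarrow> real) \<Rightarrow> real \<Rightarrow> real" where "D \<equiv> deriv"

lemma cst_apply: "cst c x = c"
  by (simp add: cst_def)

lemmas fun_app = plus_fun_apply times_fun_apply zero_fun_apply one_fun_apply numeral_fun_apply
  of_nat_fun_apply minus_apply uminus_apply cst_apply

text \<open>Application of a pointwise operation is unfolded on demand only: identities between trigonometric
  polynomials are proved in the ring of functions, and unfolding would take simplification out of it.\<close>

declare fun_app [simp del]

lemma cst_ring_hom:
  "cst (a + b) = cst a + cst b" "cst (a - b) = cst a - cst b" "cst (a * b) = cst a * cst b"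
  "cst 0 = 0" "cst 1 = 1" "cst (- a) = - cst a"
  by (auto simp: fun_eq_iff fun_app)

lemma cst_numeral: "cst (numeral n) = numeral n"
  by (auto simp: fun_eq_iff fun_app)

lemma sum_fun_apply: "(\<Sum>i\<in>A. F i) x = (\<Sum>i\<in>A. F i x)" for F :: "'b \<Rightarrow> 'c \<Rightarrow> 'd::comm_monoid_add"
  by (induction A rule: infinite_finite_induct) (auto simp: fun_app)

lemma real_trig_zero [simp]: "0 \<in> real_trig N"
  unfolding real_trig_def by (auto intro!: exI[of _ "\<lambda>_. 0"] simp: cst_ring_hom)

lemma real_trig_add: 
  assumes "f \<in> real_trig N" "g \<in> real_trig N" shows "f + g \<in> real_trig N"
proof -
  obtain a b where "f = (\<Sum>k\<in>{- int N..int N}. cst (a k) * cas k)" "g = (\<Sum>k\<in>{- int N..int N}. cst (b k) * cas k)"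
    using assms by (auto simp: real_trig_def)
  then show ?thesis
    unfolding real_trig_def
    by (auto intro!: exI[of _ "\<lambda>k. a k + b k"] simp: cst_ring_hom algebra_simps sum.distrib)
qed

lemma real_trig_scale: 
  assumes "f \<in> real_trig N" shows "cst c * f \<in> real_trig N"
proof -
  obtain a where "f = (\<Sum>k\<in>{- int N..int N}. cst (a k) * cas k)"
    using assms by (auto simp: real_trig_def)
  then show ?thesis
    unfolding real_trig_def
    by (auto intro!: exI[of _ "\<lambda>k. c * a k"] simp: cst_ring_hom sum_distrib_left mult.assoc)
qed

lemma real_trig_uminus: "f \<in> real_trig N \<Longrightarrow> - f \<in> real_trig N"
  using real_trig_scale[of f N "-1"] by (simp add: cst_ring_hom)

lemma real_trig_diff: "f \<in> real_trig N \<Longrightarrow> g \<in> real_trig N \<Longrightarrow> f - g \<in> real_trig N"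
  using real_trig_add[of f N "-g"] real_trig_uminus by simp

lemma real_trig_sum: "(\<And>i. i \<in> A \<Longrightarrow> F i \<in> real_trig N) \<Longrightarrow> (\<Sum>i\<in>A. F i) \<in> real_trig N"
  by (induction A rule: infinite_finite_induct) (auto intro: real_trig_add)

lemma cas_real_trig: 
  assumes "\<bar>k\<bar> \<le> int N" shows "cas k \<in> real_trig N"
proof -
  have "cas k = (\<Sum>j\<in>{- int N..int N}. cst (if j = k then 1 else 0) * cas j)"
    using assms by (subst sum.remove[of _ k]) (auto simp: cst_ring_hom)
  then show ?thesis unfolding real_trig_def by (auto intro!: exI[of _ "\<lambda>j. if j = k then 1 else 0"])
qed

lemma real_trig_mono: 
  assumes "f \<in> real_trig N" "N \<le> M" shows "f \<in> real_trig M"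
proof -
  obtain a where "f = (\<Sum>k\<in>{- int N..int N}. cst (a k) * cas k)"
    using assms by (auto simp: real_trig_def)
  then show ?thesis using assms(2)
    by (auto intro!: real_trig_sum real_trig_scale cas_real_trig)
qed

lemma real_trig_trig_poly: "f \<in> real_trig N \<Longrightarrow> f \<in> trig_poly"
  by (auto simp: trig_poly_def)

lemma trig_poly_common:
  assumes "f \<in> trig_poly" "g \<in> trig_poly"
  obtains N where "f \<in> real_trig N" "g \<in> real_trig N"
proof -
  obtain N M where "f \<in> real_trig N" "g \<in> real_trig M" using assms by (auto simp: trig_poly_def)
  then show ?thesis using that[of "max N M"] real_trig_mono by (meson max.cobounded1 max.cobounded2)
qed

lemma trig_poly_zero [simp]: "0 \<in> trig_poly"
  using real_trig_trig_poly real_trig_zero by blast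

lemma trig_poly_add [simp]: "f \<in> trig_poly \<Longrightarrow> g \<in> trig_poly \<Longrightarrow> f + g \<in> trig_poly"
  by (metis trig_poly_common real_trig_add real_trig_trig_poly)

lemma trig_poly_diff [simp]: "f \<in> trig_poly \<Longrightarrow> g \<in> trig_poly \<Longrightarrow> f - g \<in> trig_poly"
  by (metis trig_poly_common real_trig_diff real_trig_trig_poly)

lemma trig_poly_uminus [simp]: "f \<in> trig_poly \<Longrightarrow> - f \<in> trig_poly"
  by (metis trig_poly_common real_trig_uminus real_trig_trig_poly)

lemma trig_poly_sum [simp]: "(\<And>i. i \<in> A \<Longrightarrow> F i \<in> trig_poly) \<Longrightarrow> (\<Sum>i\<in>A. F i) \<in> trig_poly"
  by (induction A rule: infinite_finite_induct) auto

lemma trig_poly_cas [simp]: "cas k \<in> trig_poly"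
  by (rule real_trig_trig_poly[OF cas_real_trig[of k "nat \<bar>k\<bar>"]]) simp

lemma trig_poly_scale [simp]: "f \<in> trig_poly \<Longrightarrow> cst c * f \<in> trig_poly"
  by (metis trig_poly_common real_trig_scale real_trig_trig_poly)

lemma cas_0: "cas 0 = 1"
  by (auto simp: cas_def fun_eq_iff fun_app)

lemma trig_poly_one [simp]: "1 \<in> trig_poly"
  using trig_poly_cas[of 0] by (simp add: cas_0)

lemma trig_poly_cst [simp]: "cst c \<in> trig_poly"
  using trig_poly_scale[OF trig_poly_one, of c] by simp

lemma trig_poly_numeral [simp]: "numeral n \<in> trig_poly"
  using trig_poly_cst[of "numeral n"] by (simp add: cst_numeral)

lemma trig_poly_of_nat [simp]: "of_nat n \<in> trig_poly"
  by (induction n) auto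

lemma cos_sin_cas:
  "(\<lambda>x. cos (of_int k * x)) = cst (1/2) * (cas k + cas (- k))"
  "(\<lambda>x. sin (of_int k * x)) = cst (1/2) * (cas k - cas (- k))"
  by (auto simp: cas_def fun_eq_iff fun_app)

text \<open>With phases \<open>a\<close> and \<open>b\<close> the product is
  \<open>cos (a - b) + sin (a + b)\<close>, and each term is a half sum or half difference of two
  \<open>cas\<close>. Closure of \<open>trig_poly\<close> under products and orthogonality of the
  basis both come from here.\<close>

lemma cas_mult: 
  "cas k * cas l = cst (1/2) * (cas (k - l) + cas (l - k) + cas (k + l) - cas (- k - l))"
proof
  fix x :: real
  let ?a = "of_int k * x" and ?b = "of_int l * x"
  have "cas k x * cas l x = cos (?a - ?b) + sin (?a + ?b)"
    by (simp add: cas_def cos_diff sin_add algebra_simps)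
  moreover have "cas (k - l) x = cos (?a - ?b) + sin (?a - ?b)" "cas (l - k) x = cos (?a - ?b) - sin (?a - ?b)"
     "cas (k + l) x = cos (?a + ?b) + sin (?a + ?b)" "cas (- k - l) x = cos (?a + ?b) - sin (?a + ?b)"
    by (simp_all add: cas_def cos_diff sin_diff cos_add sin_add algebra_simps)
  ultimately show "(cas k * cas l) x = (cst (1/2) * (cas (k - l) + cas (l - k) + cas (k + l) - cas (- k - l))) x"
    by (simp add: fun_app)
qed

text \<open>Adding one frequency at a time keeps the truncation level out of inductions; a product,
  for instance, has a higher level than its factors.\<close>

lemma trig_poly_induct [consumes 1, case_names zero add]:
  assumes "f \<in> trig_poly" "P 0" "\<And>a k g. g \<in> trig_poly \<Longrightarrow> P g \<Longrightarrow> P (cst a * cas k + g)"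
  shows "P f"
proof -
  obtain N a where f: "f = (\<Sum>k\<in>{- int N..int N}. cst (a k) * cas k)"
    using assms(1) by (auto simp: trig_poly_def real_trig_def)
  have "P (\<Sum>k\<in>A. cst (a k) * cas k)" if "finite A" for A
    using that by induction (auto intro!: assms)
  then show ?thesis by (simp add: f)
qed

lemma trig_poly_mult [simp]:
  assumes "f \<in> trig_poly" "g \<in> trig_poly" shows "f * g \<in> trig_poly"
  using assms(1)
proof (induction rule: trig_poly_induct)
  case (add a k f)
  have "cas k * g \<in> trig_poly" using assms(2)
  proof (induction rule: trig_poly_induct)
    case (add b l h)
    have "cas k * (cst b * cas l + h) = cst b * (cas k * cas l) + cas k * h"
      by (simp add: algebra_simps)
    then show ?case using add by (simp add: cas_mult)
  qed simp
  then show ?case using add trig_poly_scale[of "cas k * g" a] by (simp add: distrib_right mult.assoc)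
qed simp

section \<open>Differentiation in space\<close>

lemma has_deriv_cas: "(cas k has_real_derivative of_int k * cas (- k) x) (at x)"
  unfolding cas_def by (auto intro!: derivative_eq_intros simp: algebra_simps)

lemma trig_poly_has_deriv:
  assumes "f \<in> trig_poly" shows "(f has_real_derivative D f x) (at x)"
proof -
  have "\<exists>d. (f has_real_derivative d) (at x)" using assms
  proof (induction rule: trig_poly_induct)
    case zero
    show ?case by (auto simp: zero_fun_def intro: DERIV_const)
  next
    case (add a k g)
    then obtain d where "(g has_real_derivative d) (at x)" by auto
    then have "((cst a * cas k + g) has_real_derivative (a * (of_int k * cas (- k) x) + d)) (at x)"
      unfolding plus_fun_def times_fun_def cst_def
      by (auto intro!: derivative_eq_intros has_deriv_cas)
    then show ?case by blast
  qed
  then show ?thesis using DERIV_imp_deriv by blast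
qed

lemma D_eqI: "(\<And>x. (f has_real_derivative g x) (at x)) \<Longrightarrow> D f = g"
  by (auto intro: DERIV_imp_deriv)

lemma D_cas: "D (cas k) = cst (of_int k) * cas (- k)"
  using D_eqI[OF has_deriv_cas] by (simp add: times_fun_def cst_def)

lemma D_cst [simp]: "D (cst c) = 0"
  by (rule D_eqI) (auto simp: cst_def zero_fun_def)

lemma D_zero [simp]: "D 0 = 0" and D_one [simp]: "D 1 = 0" and D_numeral [simp]: "D (numeral n) = 0"
  using D_cst[of 0] D_cst[of 1] D_cst[of "numeral n"] by (simp_all add: cst_ring_hom cst_numeral)

lemma D_of_nat [simp]: "D (of_nat n) = 0"
  using D_cst[of "of_nat n"] by (simp add: cst_def of_nat_fun)

lemma D_add [simp]: "f \<in> trig_poly \<Longrightarrow> g \<in> trig_poly \<Longrightarrow> D (f + g) = D f + D g"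
  by (rule D_eqI) (auto intro!: derivative_eq_intros trig_poly_has_deriv simp: plus_fun_def)

lemma D_diff [simp]: "f \<in> trig_poly \<Longrightarrow> g \<in> trig_poly \<Longrightarrow> D (f - g) = D f - D g"
  by (rule D_eqI) (auto intro!: derivative_eq_intros trig_poly_has_deriv simp: fun_diff_def)

lemma D_mult [simp]: "f \<in> trig_poly \<Longrightarrow> g \<in> trig_poly \<Longrightarrow> D (f * g) = D f * g + f * D g"
  by (rule D_eqI) (auto intro!: derivative_eq_intros trig_poly_has_deriv simp: times_fun_def plus_fun_def)

lemma D_scale [simp]: "f \<in> trig_poly \<Longrightarrow> D (cst c * f) = cst c * D f"
  by (simp add: D_mult)

lemma D_uminus [simp]: "f \<in> trig_poly \<Longrightarrow> D (- f) = - D f"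
  using D_scale[of f "-1"] by (simp add: cst_ring_hom)

lemma D_sum: "(\<And>i. i \<in> A \<Longrightarrow> F i \<in> trig_poly) \<Longrightarrow> D (\<Sum>i\<in>A. F i) = (\<Sum>i\<in>A. D (F i))"
  by (induction A rule: infinite_finite_induct) auto

lemma real_trig_D [simp]:
  assumes "f \<in> real_trig N" shows "D f \<in> real_trig N"
proof -
  obtain a where "f = (\<Sum>k\<in>{- int N..int N}. cst (a k) * cas k)"
    using assms by (auto simp: real_trig_def)
  then show ?thesis 
    by (auto simp: D_sum D_cas intro!: real_trig_sum real_trig_scale cas_real_trig)
qed

lemma trig_poly_D [simp]: "f \<in> trig_poly \<Longrightarrow> D f \<in> trig_poly"
  by (metis trig_poly_common real_trig_D real_trig_trig_poly)

lemma trig_poly_Dpow [simp]: "f \<in> trig_poly \<Longrightarrow> (D ^^ s) f \<in> trig_poly"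
  by (induction s) auto

lemma real_trig_Dpow [simp]: "f \<in> real_trig N \<Longrightarrow> (D ^^ s) f \<in> real_trig N"
  by (induction s) auto

lemma Dpow_add: "f \<in> trig_poly \<Longrightarrow> g \<in> trig_poly \<Longrightarrow> (D ^^ s) (f + g) = (D ^^ s) f + (D ^^ s) g"
  by (induction s) auto

lemma Dpow_diff: "f \<in> trig_poly \<Longrightarrow> g \<in> trig_poly \<Longrightarrow> (D ^^ s) (f - g) = (D ^^ s) f - (D ^^ s) g"
  by (induction s) auto

lemma Dpow_uminus: "f \<in> trig_poly \<Longrightarrow> (D ^^ s) (- f) = - (D ^^ s) f"
  by (induction s) auto

lemma Dpow_Dpow: "(D ^^ s) ((D ^^ t) f) = (D ^^ (s + t)) f"
  by (simp add: funpow_add)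

lemma Leibniz:
  assumes "f \<in> trig_poly" "g \<in> trig_poly"
  shows "(D ^^ s) (f * g) = (\<Sum>j\<le>s. of_nat (s choose j) * ((D ^^ j) f * (D ^^ (s - j)) g))"
proof (induction s)
  case (Suc s)
  let ?F = "\<lambda>j i. (D ^^ j) f * (D ^^ i) g"
  have "(D ^^ Suc s) (f * g) = (\<Sum>j\<le>s. D (of_nat (s choose j) * ?F j (s - j)))"
    using assms by (simp add: Suc.IH D_sum)
  also have "\<dots> = (\<Sum>j\<le>s. of_nat (s choose j) * ?F (Suc j) (s - j)) + (\<Sum>j\<le>s. of_nat (s choose j) * ?F j (Suc s - j))"
    using assms by (simp add: algebra_simps sum.distrib[symmetric] Suc_diff_le)
  also have "(\<Sum>j\<le>s. of_nat (s choose j) * ?F (Suc j) (s - j)) = (\<Sum>j\<in>{1..Suc s}. of_nat (s choose (j - 1)) * ?F j (Suc s - j))"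
    by (rule sum.reindex_bij_witness[of _ "\<lambda>j. j - 1" Suc]) auto
  also have "\<dots> = (\<Sum>j\<le>Suc s. (if j = 0 then 0 else of_nat (s choose (j - 1))) * ?F j (Suc s - j))"
    by (rule sum.mono_neutral_cong_left) auto
  also have "(\<Sum>j\<le>s. of_nat (s choose j) * ?F j (Suc s - j)) = (\<Sum>j\<le>Suc s. of_nat (s choose j) * ?F j (Suc s - j))"
    by (simp add: binomial_eq_0)
  also have "(\<Sum>j\<le>Suc s. (if j = 0 then 0 else of_nat (s choose (j - 1))) * ?F j (Suc s - j)) + \<dots>
     = (\<Sum>j\<le>Suc s. of_nat (Suc s choose j) * ?F j (Suc s - j))"
    unfolding sum.distrib[symmetric]
  proof (rule sum.cong[OF refl])
    fix j
    show "(if j = 0 then 0 else of_nat (s choose (j - 1))) * ?F j (Suc s - j) + of_nat (s choose j) * ?F j (Suc s - j)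
      = of_nat (Suc s choose j) * ?F j (Suc s - j)"
      by (cases j) (auto simp: algebra_simps)
  qed
  finally show ?case .
qed simp

section \<open>Integration over a period and the \<open>L\<^sup>2\<close> norm\<close>

lemma trig_poly_continuous: "f \<in> trig_poly \<Longrightarrow> continuous_on S f"
  by (meson DERIV_continuous continuous_at_imp_continuous_on trig_poly_has_deriv)

lemma trig_poly_integrable: "f \<in> trig_poly \<Longrightarrow> f integrable_on {a..b}"
  by (simp add: integrable_continuous_interval trig_poly_continuous)

lemma trig_poly_periodic: 
  assumes "f \<in> trig_poly" shows "f pi = f (- pi)"
  using assms
proof (induction rule: trig_poly_induct)
  case (add a k g)
  have "sin (of_int k * pi) = 0" using sin_zero_iff_int2 by blast
  then show ?case using add by (simp add: cas_def fun_app)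
qed (simp add: fun_app)

lemma Itg_add [simp]: "f \<in> trig_poly \<Longrightarrow> g \<in> trig_poly \<Longrightarrow> Itg (f + g) = Itg f + Itg g"
  by (simp add: Itg_def plus_fun_def integral_add trig_poly_integrable)

lemma Itg_diff [simp]: "f \<in> trig_poly \<Longrightarrow> g \<in> trig_poly \<Longrightarrow> Itg (f - g) = Itg f - Itg g"
  by (simp add: Itg_def fun_diff_def integral_diff trig_poly_integrable)

lemma Itg_scale [simp]: "Itg (cst c * f) = c * Itg f"
  by (simp add: Itg_def times_fun_def cst_def)

lemma Itg_zero [simp]: "Itg 0 = 0"
  using Itg_scale[of 0 0] by simp

lemma Itg_uminus [simp]: "Itg (- f) = - Itg f"
  using Itg_scale[of "-1" f] by (simp add: cst_ring_hom)

lemma Itg_numeral [simp]: "Itg (numeral n * f) = numeral n * Itg f"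
  using Itg_scale[of "numeral n" f] by (simp add: cst_numeral)

lemma Itg_of_nat [simp]: "Itg (of_nat n * f) = of_nat n * Itg f"
  using Itg_scale[of "of_nat n" f] by (simp add: cst_def of_nat_fun)

lemma Itg_sum: "(\<And>i. i \<in> A \<Longrightarrow> F i \<in> trig_poly) \<Longrightarrow> Itg (\<Sum>i\<in>A. F i) = (\<Sum>i\<in>A. Itg (F i))"
  by (induction A rule: infinite_finite_induct) auto

lemma Itg_mono:
  assumes "f \<in> trig_poly" "g \<in> trig_poly" "\<And>x. x \<in> {-pi..pi} \<Longrightarrow> f x \<le> g x" shows "Itg f \<le> Itg g"
  unfolding Itg_def using assms by (intro integral_le trig_poly_integrable) auto

lemma Itg_one: "Itg 1 = 2 * pi"
  by (simp add: Itg_def one_fun_def)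

lemma Itg_cst: "Itg (cst c) = 2 * pi * c"
  using Itg_scale[of c 1] by (simp add: Itg_one)

lemma Itg_D [simp]: 
  assumes "f \<in> trig_poly" shows "Itg (D f) = 0"
proof -
  have "(D f has_integral (f pi - f (- pi))) {-pi..pi}"
    using assms
    by (intro fundamental_theorem_of_calculus)
       (auto simp: has_real_derivative_iff_has_vector_derivative[symmetric] intro: has_field_derivative_at_within trig_poly_has_deriv)
  then show ?thesis using trig_poly_periodic[OF assms] by (simp add: Itg_def integral_unique)
qed

lemma Itg_by_parts: "f \<in> trig_poly \<Longrightarrow> g \<in> trig_poly \<Longrightarrow> Itg (D f * g) = - Itg (f * D g)"
  using Itg_D[of "f * g"] by simp

lemma Itg_by_parts_pow:
  assumes "f \<in> trig_poly" "g \<in> trig_poly" shows "Itg ((D ^^ s) f * g) = (- 1) ^ s * Itg (f * (D ^^ s) g)"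
  using assms(2)
proof (induction s arbitrary: g)
  case (Suc s)
  have "Itg ((D ^^ Suc s) f * g) = - Itg ((D ^^ s) f * D g)"
    using Suc.prems assms by (simp add: Itg_by_parts)
  then show ?case using Suc by (simp add: funpow_swap1)
qed simp

lemma Itg_cas: "Itg (cas k) = (if k = 0 then 2 * pi else 0)"
proof (cases "k = 0")
  case False
  have "D (cst (- 1 / of_int k) * cas (- k)) = cas k" using False
    by (simp add: D_cas mult.assoc[symmetric] cst_ring_hom(3)[symmetric] cst_ring_hom)
  then show ?thesis using False Itg_D[of "cst (- 1 / of_int k) * cas (- k)"] by simp
qed (simp add: cas_0 Itg_one)

lemma Itg_cas_cas: "Itg (cas k * cas l) = (if k = l then 2 * pi else 0)"
  by (simp add: cas_mult Itg_cas)

lemma Itg_square_nonneg [simp]: "f \<in> trig_poly \<Longrightarrow> 0 \<le> Itg (f * f)"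
  using Itg_mono[of 0 "f * f"] by (simp add: fun_app)

lemma nrm_nonneg [simp]: "f \<in> trig_poly \<Longrightarrow> 0 \<le> nrm f"
  by (simp add: nrm_def)

lemma nrm_square: "f \<in> trig_poly \<Longrightarrow> (nrm f)\<^sup>2 = Itg (f * f)"
  by (simp add: nrm_def)

lemma Itg_quadratic_nonneg:
  assumes [simp]: "f \<in> trig_poly" "g \<in> trig_poly"
  shows "0 \<le> Itg (f * f) - 2 * t * Itg (f * g) + t\<^sup>2 * Itg (g * g)"
proof -
  have "(f - cst t * g) * (f - cst t * g) = f * f - cst (2 * t) * (f * g) + cst (t\<^sup>2) * (g * g)"
    by (simp add: fun_eq_iff fun_app power2_eq_square algebra_simps)
  then have "Itg ((f - cst t * g) * (f - cst t * g)) = Itg (f * f) - 2 * t * Itg (f * g) + t\<^sup>2 * Itg (g * g)"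
    by simp
  then show ?thesis using Itg_square_nonneg[of "f - cst t * g"] by simp
qed

lemma Cauchy_Schwarz:
  assumes [simp]: "f \<in> trig_poly" "g \<in> trig_poly"
  shows "\<bar>Itg (f * g)\<bar> \<le> nrm f * nrm g"
proof -
  let ?a = "Itg (f * f)" and ?b = "Itg (f * g)" and ?c = "Itg (g * g)"
  have "?b\<^sup>2 \<le> ?a * ?c"
  proof (cases "?c = 0")
    case True
    have "?b = 0"
    proof (rule ccontr)
      assume b: "?b \<noteq> 0"
      \<comment> \<open>For \<open>?c = 0\<close> the quadratic is affine in its parameter, and this
        parameter makes it \<open>-1\<close>.\<close>
      have "0 \<le> ?a - 2 * ((?a + 1) / (2 * ?b)) * ?b" 
        using Itg_quadratic_nonneg[of f g "(?a + 1) / (2 * ?b)"] True by simp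
      then show False using b by simp
    qed
    then show ?thesis using True by simp
  next
    case False
    then have c: "?c > 0" using Itg_square_nonneg[OF assms(2)] by linarith
    have "0 \<le> ?a - 2 * (?b / ?c) * ?b + (?b / ?c)\<^sup>2 * ?c"
      by (rule Itg_quadratic_nonneg) auto
    also have "\<dots> = ?a - ?b\<^sup>2 / ?c" using c by (simp add: field_simps power2_eq_square)
    finally show ?thesis using c by (simp add: field_simps)
  qed
  then have "sqrt (?b\<^sup>2) \<le> sqrt (?a * ?c)" by (rule real_sqrt_le_mono)
  then show ?thesis by (simp add: nrm_def real_sqrt_mult)
qed

lemma nrm_le_iff: "f \<in> trig_poly \<Longrightarrow> 0 \<le> c \<Longrightarrow> nrm f \<le> c \<longleftrightarrow> Itg (f * f) \<le> c\<^sup>2"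
  using nrm_nonneg[of f] nrm_square[of f] by (metis power2_le_imp_le power_mono)

lemma nrm_triangle:
  assumes [simp]: "f \<in> trig_poly" "g \<in> trig_poly" shows "nrm (f + g) \<le> nrm f + nrm g"
proof -
  have "Itg ((f + g) * (f + g)) = Itg (f * f) + Itg (g * g) + 2 * Itg (f * g)"
    by (simp add: distrib_left distrib_right mult.commute[of g f])
  also have "\<dots> \<le> (nrm f + nrm g)\<^sup>2"
    using Cauchy_Schwarz[of f g] by (simp add: power2_sum nrm_square)
  finally show ?thesis by (simp add: nrm_le_iff)
qed

lemma nrm_scale: "nrm (cst c * f) = \<bar>c\<bar> * nrm f"
proof -
  have "cst c * f * (cst c * f) = cst (c\<^sup>2) * (f * f)" 
    by (simp add: fun_eq_iff fun_app power2_eq_square)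
  then show ?thesis by (simp add: nrm_def real_sqrt_mult)
qed

lemma nrm_of_nat: "nrm (of_nat n * f) = of_nat n * nrm f"
  using nrm_scale[of "of_nat n" f] by (simp add: cst_def of_nat_fun)

lemma nrm_uminus [simp]: "nrm (- f) = nrm f"
  by (simp add: nrm_def)

lemma nrm_zero [simp]: "nrm 0 = 0"
  by (simp add: nrm_def)

lemma nrm_sum:
  "(\<And>i. i \<in> A \<Longrightarrow> F i \<in> trig_poly) \<Longrightarrow> nrm (\<Sum>i\<in>A. F i) \<le> (\<Sum>i\<in>A. nrm (F i))"
  by (induction A rule: infinite_finite_induct) (auto intro: order_trans[OF nrm_triangle])

lemma nrm_mult_le:
  assumes [simp]: "f \<in> trig_poly" "g \<in> trig_poly" and b: "\<And>x. x \<in> {-pi..pi} \<Longrightarrow> \<bar>f x\<bar> \<le> S"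
  shows "nrm (f * g) \<le> S * nrm g"
proof -
  have S: "0 \<le> S" using b[of 0] by (smt (verit) atLeastAtMost_iff pi_ge_zero)
  have "Itg (f * g * (f * g)) \<le> Itg (cst (S\<^sup>2) * (g * g))"
  proof (rule Itg_mono)
    fix x :: real assume "x \<in> {-pi..pi}"
    then have "(f x)\<^sup>2 \<le> S\<^sup>2" using b[of x] S by (simp add: abs_le_square_iff[symmetric])
    then have "(f x)\<^sup>2 * (g x)\<^sup>2 \<le> S\<^sup>2 * (g x)\<^sup>2" by (simp add: mult_right_mono)
    then show "(f * g * (f * g)) x \<le> (cst (S\<^sup>2) * (g * g)) x"
      by (simp add: fun_app power2_eq_square algebra_simps)
  qed auto
  then show ?thesis using S by (simp add: nrm_le_iff power_mult_distrib nrm_square)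
qed

text \<open>The \<open>3\<close> is a bound for \<open>nrm 1\<close>, the square root of
  \<open>2 * pi\<close>.\<close>

lemma nrm_bounded_le:
  assumes [simp]: "f \<in> trig_poly" and b: "\<And>x. x \<in> {-pi..pi} \<Longrightarrow> \<bar>f x\<bar> \<le> S"
  shows "nrm f \<le> 3 * S"
proof -
  have S: "0 \<le> S" using b[of 0] by (smt (verit) atLeastAtMost_iff pi_ge_zero)
  have "nrm f \<le> S * nrm 1" using nrm_mult_le[OF assms(1) trig_poly_one b] by simp
  also have "nrm 1 \<le> 3" using pi_less_4 by (simp add: nrm_def Itg_one real_le_lsqrt)
  finally show ?thesis using S by (simp add: mult_left_mono mult.commute[of 3])
qed

section \<open>Galerkin projection, Sobolev inequality and differentiation in time\<close>

definition hcoeff :: "(real \<Rightarrow> real) \<Rightarrow> int \<Rightarrow> real" where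
  "hcoeff f k = Itg (f * cas k) / (2 * pi)"

definition proj :: "nat \<Rightarrow> (real \<Rightarrow> real) \<Rightarrow> (real \<Rightarrow> real)" where
  "proj N f = (\<Sum>k\<in>{- int N..int N}. cst (hcoeff f k) * cas k)"

lemma proj_real_trig [simp]: "proj N f \<in> real_trig N"
  by (auto simp: proj_def real_trig_def)

lemma proj_trig_poly [simp]: "proj N f \<in> trig_poly"
  using proj_real_trig real_trig_trig_poly by blast

lemma Itg_cas_sum:
  assumes "\<bar>l\<bar> \<le> int N"
  shows "Itg ((\<Sum>k\<in>{- int N..int N}. cst (a k) * cas k) * cas l) = 2 * pi * a l"
proof -
  have "Itg ((\<Sum>k\<in>{- int N..int N}. cst (a k) * cas k) * cas l)
      = (\<Sum>k\<in>{- int N..int N}. a k * (if k = l then 2 * pi else 0))"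
    by (simp add: sum_distrib_right Itg_sum mult.assoc Itg_cas_cas)
  also have "\<dots> = (\<Sum>k\<in>{- int N..int N}. if k = l then 2 * pi * a k else 0)"
    by (rule sum.cong) auto
  also have "\<dots> = 2 * pi * a l"
    using assms by (auto simp: abs_le_iff)
  finally show ?thesis .
qed

lemma proj_ident: 
  assumes "f \<in> real_trig N" shows "proj N f = f"
proof -
  obtain a where f: "f = (\<Sum>k\<in>{- int N..int N}. cst (a k) * cas k)"
    using assms by (auto simp: real_trig_def)
  have "hcoeff f k = a k" if "k \<in> {- int N..int N}" for k
    using that unfolding hcoeff_def f by (subst Itg_cas_sum) auto
  then show ?thesis by (simp add: proj_def f)
qed

lemma hcoeff_proj: "\<bar>k\<bar> \<le> int N \<Longrightarrow> hcoeff (proj N f) k = hcoeff f k"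
  using Itg_cas_sum[of k N "hcoeff f"] by (simp add: hcoeff_def proj_def)

lemma real_trig_eqI:
  assumes "f \<in> real_trig N" "g \<in> real_trig N" "\<And>k. \<bar>k\<bar> \<le> int N \<Longrightarrow> hcoeff f k = hcoeff g k"
  shows "f = g"
proof -
  have "proj N f = proj N g" unfolding proj_def by (rule sum.cong) (use assms(3) in auto)
  then show ?thesis using assms by (simp add: proj_ident)
qed

lemma Itg_expand:
  assumes "f \<in> real_trig N" "g \<in> trig_poly"
  shows "Itg (f * g) = 2 * pi * (\<Sum>k\<in>{- int N..int N}. hcoeff f k * hcoeff g k)"
proof -
  have "Itg (f * g) = Itg (proj N f * g)" using assms by (simp add: proj_ident)
  also have "\<dots> = (\<Sum>k\<in>{- int N..int N}. hcoeff f k * Itg (g * cas k))"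
    using assms by (simp add: proj_def sum_distrib_right Itg_sum mult.assoc mult.commute[of "cas _"])
  also have "\<dots> = 2 * pi * (\<Sum>k\<in>{- int N..int N}. hcoeff f k * hcoeff g k)"
    by (simp add: hcoeff_def sum_distrib_left)
  finally show ?thesis .
qed

lemma Itg_proj:
  assumes "f \<in> trig_poly" "g \<in> real_trig N"
  shows "Itg (proj N f * g) = Itg (f * g)"
proof -
  have g: "g \<in> trig_poly" using assms real_trig_trig_poly by blast
  have "Itg (g * proj N f) = Itg (g * f)"
    using assms g by (auto simp: Itg_expand[OF assms(2)] hcoeff_proj intro!: sum.cong)
  then show ?thesis by (simp add: mult.commute)
qed

lemma hcoeff_D: "f \<in> trig_poly \<Longrightarrow> hcoeff (D f) k = - of_int k * hcoeff f (- k)"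
  by (simp add: hcoeff_def Itg_by_parts D_cas mult.left_commute[of f "cst _"])

text \<open>Differentiation exchanges the coefficients at \<open>k\<close> and \<open>- k\<close>,
  and the range of frequencies is symmetric.\<close>

lemma D_proj:
  assumes "f \<in> trig_poly" shows "D (proj N f) = proj N (D f)"
  using assms by (intro real_trig_eqI[of _ N]) (auto simp: hcoeff_D hcoeff_proj)

lemma Dpow_proj: "f \<in> trig_poly \<Longrightarrow> (D ^^ s) (proj N f) = proj N ((D ^^ s) f)"
  by (induction s) (auto simp: D_proj)

lemma nrm_proj: 
  assumes [simp]: "f \<in> trig_poly" shows "nrm (proj N f) \<le> nrm f"
proof -
  have "(nrm (proj N f))\<^sup>2 = Itg (f * proj N f)"
    by (simp add: nrm_square Itg_proj)
  also have "\<dots> \<le> nrm f * nrm (proj N f)"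
    using Cauchy_Schwarz[of f "proj N f"] by simp
  finally have "nrm (proj N f) * nrm (proj N f) \<le> nrm f * nrm (proj N f)"
    by (simp add: power2_eq_square)
  then show ?thesis 
    using nrm_nonneg[of "proj N f"] nrm_nonneg[OF assms]
    by (cases "nrm (proj N f) = 0") (auto simp: mult_le_cancel_right)
qed

text \<open>Parseval's identity with the multiplier of \<open>D ^^ s\<close>. It yields the inverse
  inequality and, later, the comparison with the Sobolev norm of the initial datum.\<close>

lemma nrm_Dpow_expand:
  assumes "f \<in> real_trig N"
  shows "(nrm ((D ^^ s) f))\<^sup>2 = 2 * pi * (\<Sum>k\<in>{- int N..int N}. (of_int k) ^ (2 * s) * (hcoeff f k)\<^sup>2)"
  using assms
proof (induction s arbitrary: f)
  case 0
  then show ?case using Itg_expand[OF 0 real_trig_trig_poly[OF 0]] by (simp add: nrm_square[OF real_trig_trig_poly[OF 0]] power2_eq_square[symmetric])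
next
  case (Suc s)
  have f: "f \<in> trig_poly" using Suc.prems real_trig_trig_poly by blast
  have "(nrm ((D ^^ Suc s) f))\<^sup>2 = (nrm ((D ^^ s) (D f)))\<^sup>2" by (simp add: funpow_swap1)
  also have "\<dots> = 2 * pi * (\<Sum>k\<in>{- int N..int N}. of_int k ^ (2 * s) * (hcoeff (D f) k)\<^sup>2)"
    using Suc.IH[OF real_trig_D[OF Suc.prems]] .
  also have "(\<Sum>k\<in>{- int N..int N}. of_int k ^ (2 * s) * (hcoeff (D f) k)\<^sup>2)
     = (\<Sum>k\<in>{- int N..int N}. real_of_int (- k) ^ (2 * Suc s) * (hcoeff f (- k))\<^sup>2)"
    by (rule sum.cong) (simp_all add: hcoeff_D[OF f] power_mult_distrib power2_eq_square)
  also have "\<dots> = (\<Sum>k\<in>{- int N..int N}. real_of_int k ^ (2 * Suc s) * (hcoeff f k)\<^sup>2)"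
    by (rule sum.reindex_bij_witness[of _ uminus uminus]) auto
  finally show ?case .
qed

text \<open>The inverse inequality, source of the powers of \<open>N\<close> in the stability
  analysis.\<close>

lemma nrm_D_le:
  assumes "f \<in> real_trig N" shows "nrm (D f) \<le> real N * nrm f"
proof -
  have f [simp]: "f \<in> trig_poly" using assms real_trig_trig_poly by blast
  have "(nrm (D f))\<^sup>2 = 2 * pi * (\<Sum>k\<in>{- int N..int N}. (of_int k)\<^sup>2 * (hcoeff f k)\<^sup>2)"
    using nrm_Dpow_expand[OF assms, of 1] by simp
  also have "\<dots> \<le> 2 * pi * (\<Sum>k\<in>{- int N..int N}. (real N)\<^sup>2 * (hcoeff f k)\<^sup>2)"
  proof (intro mult_left_mono sum_mono mult_right_mono)
    fix k assume "k \<in> {- int N..int N}"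
    then have "\<bar>real_of_int k\<bar> \<le> \<bar>real N\<bar>" by auto
    then show "(real_of_int k)\<^sup>2 \<le> (real N)\<^sup>2" using abs_le_square_iff by blast
  qed auto
  also have "\<dots> = (real N * nrm f)\<^sup>2"
    using nrm_Dpow_expand[OF assms, of 0] by (simp add: power_mult_distrib sum_distrib_left mult.left_commute)
  finally show ?thesis by (rule power2_le_imp_le) simp
qed

lemma nrm_Dpow_le:
  assumes "f \<in> real_trig N" shows "nrm ((D ^^ s) f) \<le> real N ^ s * nrm f"
proof (induction s)
  case (Suc s)
  have "nrm ((D ^^ Suc s) f) \<le> real N * nrm ((D ^^ s) f)"
    using nrm_D_le[of "(D ^^ s) f" N] assms by simp
  also have "\<dots> \<le> real N * (real N ^ s * nrm f)" using Suc by (intro mult_left_mono) auto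
  finally show ?case by (simp add: mult.assoc)
qed simp

text \<open>The derivative of \<open>f * f\<close> is \<open>2 * f * D f\<close>, which is at most
  \<open>f * f + D f * D f\<close> in absolute value; integrate from \<open>y\<close> to
  \<open>x\<close>. The auxiliary claim is one-sided, so \<open>- (f * f)\<close> serves when
  \<open>x\<close> lies to the left of \<open>y\<close>.\<close>

lemma Sobolev_aux:
  assumes [simp]: "f \<in> trig_poly" and xy: "x \<in> {-pi..pi}" "y \<in> {-pi..pi}"
  shows "(f x)\<^sup>2 \<le> (f y)\<^sup>2 + ((nrm f)\<^sup>2 + (nrm (D f))\<^sup>2)"
proof -
  define g where "g = f * f + D f * D f"
  have g [simp]: "g \<in> trig_poly" by (simp add: g_def)
  have gI: "Itg g = (nrm f)\<^sup>2 + (nrm (D f))\<^sup>2" by (simp add: g_def nrm_square)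
  have g0: "g z \<ge> 0" for z by (simp add: g_def fun_app)
  have *: "h b - h a \<le> Itg g"
    if [simp]: "h \<in> trig_poly" and ab: "-pi \<le> a" "a \<le> b" "b \<le> pi" and h: "\<And>z. D h z \<le> g z" for h a b
  proof -
    have "(D h has_integral (h b - h a)) {a..b}"
      using ab by (intro fundamental_theorem_of_calculus)
       (auto simp: has_real_derivative_iff_has_vector_derivative[symmetric]
         intro: has_field_derivative_at_within[OF trig_poly_has_deriv[OF that(1)]])
    then have "h b - h a = integral {a..b} (D h)" by (simp add: integral_unique)
    also have "\<dots> \<le> integral {a..b} g"
      by (intro integral_le trig_poly_integrable h) auto
    also have "\<dots> \<le> integral {-pi..pi} g"
      using ab g0 by (intro integral_subset_le trig_poly_integrable) auto
    finally show ?thesis by (simp add: Itg_def)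
  qed
  have sq: "2 * (f z * D f z) \<le> g z" "- (2 * (f z * D f z)) \<le> g z" for z
    using sum_squares_bound[of "f z" "D f z"] sum_squares_bound[of "f z" "- D f z"]
    by (simp_all add: g_def fun_app power2_eq_square)
  show ?thesis
  proof (cases "y \<le> x")
    case True
    have "(f * f) x - (f * f) y \<le> Itg g"
      by (rule *[of "f * f" y x]) (use True xy sq in \<open>auto simp: fun_app algebra_simps\<close>)
    then show ?thesis by (simp add: gI fun_app power2_eq_square)
  next
    case False
    have "(- (f * f)) y - (- (f * f)) x \<le> Itg g"
      by (rule *[of "- (f * f)" x y]) (use False xy sq in \<open>auto simp: fun_app algebra_simps\<close>)
    then show ?thesis by (simp add: gI fun_app power2_eq_square)
  qed
qed

text \<open>\<open>Sobolev_aux\<close> averaged over \<open>y\<close>. The constant is not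
  sharp.\<close>

lemma Sobolev:
  assumes [simp]: "f \<in> trig_poly" and x: "x \<in> {-pi..pi}"
  shows "\<bar>f x\<bar> \<le> 2 * (nrm f + nrm (D f))"
proof -
  let ?A = "(nrm f)\<^sup>2 + (nrm (D f))\<^sup>2"
  have "Itg (cst ((f x)\<^sup>2)) \<le> Itg (f * f + cst ?A)"
  proof (rule Itg_mono)
    fix y assume "y \<in> {-pi..pi}"
    with Sobolev_aux[OF assms(1) x this] show "cst ((f x)\<^sup>2) y \<le> (f * f + cst ?A) y"
      by (simp add: fun_app power2_eq_square)
  qed auto
  then have "2 * pi * (f x)\<^sup>2 \<le> (nrm f)\<^sup>2 + 2 * pi * ?A"
    by (simp add: Itg_cst nrm_square)
  moreover have "1 * (nrm f)\<^sup>2 \<le> 2 * pi * ?A" using pi_gt3 by (intro mult_mono) auto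
  ultimately have "2 * pi * (f x)\<^sup>2 \<le> 2 * pi * (2 * ?A)" by linarith
  then have "(f x)\<^sup>2 \<le> 2 * ?A" using pi_gt_zero by (meson mult_le_cancel_left_pos mult_pos_pos zero_less_numeral)
  also have "\<dots> \<le> (2 * (nrm f + nrm (D f)))\<^sup>2"
    using nrm_nonneg[of f] nrm_nonneg[of "D f"] by (simp add: power2_sum power_mult_distrib)
  finally show ?thesis
    using nrm_nonneg[of f] nrm_nonneg[of "D f"] by (simp add: abs_le_square_iff[symmetric])
qed

text \<open>The extra derivative is charged to the first factor, so the factor of higher order goes
  second.\<close>

lemma nrm_mult_Sobolev:
  assumes "f \<in> trig_poly" "g \<in> trig_poly"
  shows "nrm (f * g) \<le> 2 * (nrm f + nrm (D f)) * nrm g"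
  by (rule nrm_mult_le) (use assms Sobolev in auto)

text \<open>Differentiability in time of curves of trigonometric polynomials. Separating the variables makes
  differentiation under the integral sign a matter of linearity.\<close>

inductive time_deriv :: "(real \<Rightarrow> real \<Rightarrow> real) \<Rightarrow> (real \<Rightarrow> real \<Rightarrow> real) \<Rightarrow> bool" where
  separated: "(\<And>t. 0 \<le> t \<Longrightarrow> (a has_real_derivative a' t) (at t within {0..})) \<Longrightarrow> \<phi> \<in> trig_poly \<Longrightarrow>
    time_deriv (\<lambda>t. cst (a t) * \<phi>) (\<lambda>t. cst (a' t) * \<phi>)"
| add: "time_deriv f f' \<Longrightarrow> time_deriv g g' \<Longrightarrow> time_deriv (\<lambda>t. f t + g t) (\<lambda>t. f' t + g' t)"

lemma time_deriv_trig_poly: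
  "time_deriv f f' \<Longrightarrow> f t \<in> trig_poly" "time_deriv f f' \<Longrightarrow> f' t \<in> trig_poly"
  by (induction rule: time_deriv.induct) auto

lemma time_deriv_const: "\<phi> \<in> trig_poly \<Longrightarrow> time_deriv (\<lambda>_. \<phi>) (\<lambda>_. 0)"
  using separated[of "\<lambda>_. 1" "\<lambda>_. 0" \<phi>] by (simp add: cst_ring_hom)

text \<open>The product rule takes an induction on each factor; this is the inner one.\<close>

lemma time_deriv_mult_separated:
  assumes a: "\<And>t. 0 \<le> t \<Longrightarrow> (a has_real_derivative a' t) (at t within {0..})" and \<phi>: "\<phi> \<in> trig_poly"
    and g: "time_deriv g g'"
  shows "time_deriv (\<lambda>t. cst (a t) * \<phi> * g t) (\<lambda>t. cst (a' t) * \<phi> * g t + cst (a t) * \<phi> * g' t)"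
  using g
proof (induction rule: time_deriv.induct)
  case (separated b b' \<psi>)
  have "time_deriv (\<lambda>t. cst (a t * b t) * (\<phi> * \<psi>)) (\<lambda>t. cst (a' t * b t + b' t * a t) * (\<phi> * \<psi>))"
    using separated \<phi> a by (intro time_deriv.separated DERIV_mult) auto
  then show ?case by (simp add: cst_ring_hom algebra_simps)
next
  case (add f f' g g')
  from time_deriv.add[OF add.IH] show ?case by (simp add: algebra_simps)
qed

lemma time_deriv_mult:
  assumes "time_deriv f f'" "time_deriv g g'"
  shows "time_deriv (\<lambda>t. f t * g t) (\<lambda>t. f' t * g t + f t * g' t)"
  using assms(1)
proof (induction rule: time_deriv.induct)
  case (separated a a' \<phi>)
  then show ?case using time_deriv_mult_separated assms(2) by blast
next
  case (add f f' h h')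
  from time_deriv.add[OF add.IH] show ?case by (simp add: algebra_simps)
qed

lemma time_deriv_scale: "time_deriv f f' \<Longrightarrow> time_deriv (\<lambda>t. cst c * f t) (\<lambda>t. cst c * f' t)"
  using time_deriv_mult[OF time_deriv_const[of "cst c"], of f f'] by simp

lemma time_deriv_uminus: "time_deriv f f' \<Longrightarrow> time_deriv (\<lambda>t. - f t) (\<lambda>t. - f' t)"
  using time_deriv_scale[of f f' "-1"] by (simp add: cst_ring_hom)

lemma time_deriv_diff:
  "time_deriv f f' \<Longrightarrow> time_deriv g g' \<Longrightarrow> time_deriv (\<lambda>t. f t - g t) (\<lambda>t. f' t - g' t)"
  using add[OF _ time_deriv_uminus, of f f' g g'] by simp

lemma time_deriv_sum:
  "(\<And>i. i \<in> A \<Longrightarrow> time_deriv (F i) (F' i)) \<Longrightarrow> time_deriv (\<lambda>t. \<Sum>i\<in>A. F i t) (\<lambda>t. \<Sum>i\<in>A. F' i t)"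
  by (induction A rule: infinite_finite_induct) (auto intro: time_deriv_const add)

lemma time_deriv_D:
  assumes "time_deriv f f'" shows "time_deriv (\<lambda>t. D (f t)) (\<lambda>t. D (f' t))"
  using assms
proof (induction rule: time_deriv.induct)
  case (separated a a' \<phi>)
  then show ?case using time_deriv.separated[of a a' "D \<phi>"] by simp
next
  case (add f f' g g')
  from time_deriv.add[OF add.IH] show ?case
    using add.hyps by (simp add: time_deriv_trig_poly[OF add.hyps(1)] time_deriv_trig_poly[OF add.hyps(2)])
qed

lemma time_deriv_Dpow: "time_deriv f f' \<Longrightarrow> time_deriv (\<lambda>t. (D ^^ s) (f t)) (\<lambda>t. (D ^^ s) (f' t))"
  by (induction s) (auto intro: time_deriv_D)

lemma time_deriv_apply:
  assumes "time_deriv f f'" "0 \<le> t"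
  shows "((\<lambda>t. f t x) has_real_derivative f' t x) (at t within {0..})"
  using assms
proof (induction rule: time_deriv.induct)
  case (separated a a' \<phi>)
  then show ?case by (auto simp: fun_app intro!: derivative_eq_intros)
next
  case (add f f' g g')
  then show ?case by (auto simp: fun_app intro!: derivative_eq_intros)
qed

lemma time_deriv_Itg:
  assumes "time_deriv f f'" "0 \<le> t"
  shows "((\<lambda>t. Itg (f t)) has_real_derivative Itg (f' t)) (at t within {0..})"
  using assms
proof (induction rule: time_deriv.induct)
  case (separated a a' \<phi>)
  then show ?case by (auto intro!: derivative_eq_intros)
next
  case (add f f' g g')
  then show ?case 
    by (auto simp: time_deriv_trig_poly[OF add.hyps(1)] time_deriv_trig_poly[OF add.hyps(2)] intro!: derivative_eq_intros)
qed

lemma time_deriv_proj: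
  assumes "time_deriv f f'" shows "time_deriv (\<lambda>t. proj N (f t)) (\<lambda>t. proj N (f' t))"
  unfolding proj_def
proof (intro time_deriv_sum separated)
  fix k and t :: real assume "0 \<le> t"
  have "time_deriv (\<lambda>t. f t * cas k) (\<lambda>t. f' t * cas k)"
    using time_deriv_mult[OF assms time_deriv_const[of "cas k"]] by simp
  then show "((\<lambda>t. hcoeff (f t) k) has_real_derivative hcoeff (f' t) k) (at t within {0..})"
    unfolding hcoeff_def using \<open>0 \<le> t\<close> by (intro DERIV_cdivide time_deriv_Itg)
qed auto

section \<open>A priori bounds for the semi-discrete problem\<close>

definition kawahara :: "(real \<Rightarrow> real) \<Rightarrow> (real \<Rightarrow> real)" where
  "kawahara u = u * D u + (D ^^ 3) u - (D ^^ 5) u"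

text \<open>The weak form solved for the time derivative. Negative times carry no information:
  \<open>time_deriv\<close> constrains the coefficients on the half-line only, so the formula for
  the derivative can be stated for all \<open>t\<close>.\<close>

definition galerkin :: "nat \<Rightarrow> (real \<Rightarrow> real \<Rightarrow> real) \<Rightarrow> bool" where
  "galerkin N u \<longleftrightarrow> (\<forall>t. u t \<in> real_trig N) \<and> time_deriv u (\<lambda>t. - proj N (kawahara (u t)))"

lemma kawahara_trig_poly [simp]: "u \<in> trig_poly \<Longrightarrow> kawahara u \<in> trig_poly"
  by (simp add: kawahara_def)

lemma Itg_odd_derivative: "f \<in> trig_poly \<Longrightarrow> odd s \<Longrightarrow> Itg ((D ^^ s) f * f) = 0"
  using Itg_by_parts_pow[of f f s] by (simp add: mult.commute)

text \<open>The integral of \<open>D (u * (w * w))\<close> vanishes, so a derivative on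
  \<open>w\<close> can be traded for one on \<open>u\<close>.\<close>

lemma Itg_commutator:
  assumes [simp]: "u \<in> trig_poly" "w \<in> trig_poly"
  shows "Itg (u * D w * w) = - Itg (D u * w * w) / 2"
proof -
  have *: "D (u * (w * w)) = D u * w * w + (u * D w * w + u * D w * w)"
    by (simp add: algebra_simps)
  have "Itg (D (u * (w * w))) = 0" by (rule Itg_D) simp
  then have "Itg (D u * w * w) + (Itg (u * D w * w) + Itg (u * D w * w)) = 0"
    unfolding * by (simp only: Itg_add trig_poly_mult trig_poly_add trig_poly_D assms)
  then show ?thesis by linarith
qed

lemma galerkinD:
  assumes "galerkin N u"
  shows "u t \<in> real_trig N" "u t \<in> trig_poly" "time_deriv u (\<lambda>t. - proj N (kawahara (u t)))"
  using assms real_trig_trig_poly by (auto simp: galerkin_def)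

text \<open>Testing inside \<open>real_trig N\<close> removes the projection; through this the
  energy identities survive truncation.\<close>

lemma galerkin_test:
  assumes "galerkin N u" "\<phi> \<in> real_trig N"
  shows "Itg (- proj N (kawahara (u t)) * \<phi>) = - Itg (kawahara (u t) * \<phi>)"
  using assms by (simp add: galerkinD Itg_proj)

lemma deriv_zero_constant:
  fixes f :: "real \<Rightarrow> real"
  assumes "\<And>t. 0 \<le> t \<Longrightarrow> (f has_real_derivative 0) (at t within {0..})" "0 \<le> t"
  shows "f t = f 0"
proof -
  obtain c where "\<forall>x\<in>{0..}. f x = c" 
    using has_field_derivative_zero_constant[of "{0::real..}" f] assms(1) by auto
  then show ?thesis using assms(2) by simp
qed

text \<open>Test with \<open>(D ^^ s) ((D ^^ s) u)\<close>: moving \<open>s\<close> derivatives over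
  and back cancels the signs, and the dispersive terms vanish because their order is odd. Only the
  nonlinearity is left.\<close>

lemma galerkin_energy_deriv:
  assumes g: "galerkin N u" and t: "0 \<le> t"
  shows "((\<lambda>t. Itg ((D ^^ s) (u t) * (D ^^ s) (u t))) has_real_derivative
           - 2 * Itg ((D ^^ s) (u t * D (u t)) * (D ^^ s) (u t))) (at t within {0..})"
proof -
  note [simp] = galerkinD(1,2)[OF g]
  let ?u = "u t" and ?v = "- proj N (kawahara (u t))"
  have "((\<lambda>t. Itg ((D ^^ s) (u t) * (D ^^ s) (u t))) has_real_derivative
           Itg ((D ^^ s) ?v * (D ^^ s) ?u + (D ^^ s) ?u * (D ^^ s) ?v)) (at t within {0..})"
    using time_deriv_Itg[OF time_deriv_mult[OF time_deriv_Dpow[OF galerkinD(3)[OF g]] time_deriv_Dpow[OF galerkinD(3)[OF g]]] t] .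
  moreover have "Itg ((D ^^ s) ?v * (D ^^ s) ?u + (D ^^ s) ?u * (D ^^ s) ?v) = 2 * Itg ((D ^^ s) ?v * (D ^^ s) ?u)"
    by (simp add: mult.commute)
  moreover have "Itg ((D ^^ s) ?v * (D ^^ s) ?u) = - Itg ((D ^^ s) (kawahara ?u) * (D ^^ s) ?u)"
    using galerkin_test[OF g, of "(D ^^ s) ((D ^^ s) ?u)" t] by (simp add: Itg_by_parts_pow)
  moreover have "Itg ((D ^^ s) (kawahara ?u) * (D ^^ s) ?u) = Itg ((D ^^ s) (?u * D ?u) * (D ^^ s) ?u)"
  proof -
    have c: "(D ^^ s) ((D ^^ n) ?u) = (D ^^ n) ((D ^^ s) ?u)" for n
      by (simp add: Dpow_Dpow add.commute)
    show ?thesis unfolding kawahara_def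
      by (simp add: Dpow_add Dpow_diff c distrib_right left_diff_distrib Itg_odd_derivative del: funpow.simps)
  qed
  ultimately show ?thesis by simp
qed

text \<open>With \<open>w = u\<close>, \<open>Itg_commutator\<close> says that the nonlinear
  contribution equals minus half of itself.\<close>

lemma galerkin_L2_conserved:
  assumes g: "galerkin N u" and t: "0 \<le> t"
  shows "nrm (u t) = nrm (u 0)"
proof -
  have "Itg (u t * D (u t) * u t) = 0" for t
    using Itg_commutator[of "u t" "u t"] galerkinD(2)[OF g] by (simp add: mult.commute mult.left_commute)
  then have "((\<lambda>t. Itg (u t * u t)) has_real_derivative 0) (at t within {0..})" if "0 \<le> t" for t
    using galerkin_energy_deriv[OF g that, of 0] by simp
  then have "Itg (u t * u t) = Itg (u 0 * u 0)"
    using deriv_zero_constant[of "\<lambda>t. Itg (u t * u t)"] t by blast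
  then show ?thesis by (simp add: nrm_def)
qed

text \<open>Both quadratic terms have the same sign, so a conserved value bounds
  \<open>D (D u)\<close> as soon as the cubic term is under control.\<close>

definition hamiltonian :: "(real \<Rightarrow> real) \<Rightarrow> real" where
  "hamiltonian u = Itg (u * u * u) / 6 - Itg (D u * D u) / 2 - Itg (D (D u) * D (D u)) / 2"

text \<open>The truncated equation is still Hamiltonian: \<open>u\<^sub>t = - D (proj N w)\<close>, where \<open>w\<close> is the
  variational derivative of the Hamiltonian.\<close>

lemma galerkin_hamiltonian_conserved:
  assumes g: "galerkin N u" and t: "0 \<le> t"
  shows "hamiltonian (u t) = hamiltonian (u 0)"
proof -
  note [simp] = galerkinD(1,2)[OF g]
  note td = galerkinD(3)[OF g]
  have "((\<lambda>t. hamiltonian (u t)) has_real_derivative 0) (at t within {0..})" if t: "0 \<le> t" for t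
  proof -
    let ?u = "u t" and ?v = "- proj N (kawahara (u t))"
    let ?w = "cst (1/2) * (?u * ?u) + (D ^^ 2) ?u - (D ^^ 4) ?u"
    have H: "((\<lambda>t. hamiltonian (u t)) has_real_derivative
        (Itg ((?v * ?u + ?u * ?v) * ?u + ?u * ?u * ?v) / 6 - Itg (D ?v * D ?u + D ?u * D ?v) / 2
          - Itg (D (D ?v) * D (D ?u) + D (D ?u) * D (D ?v)) / 2)) (at t within {0..})"
      unfolding hamiltonian_def
      by (intro DERIV_diff DERIV_cdivide time_deriv_Itg time_deriv_mult time_deriv_D td t)
    have E1: "Itg ((?v * ?u + ?u * ?v) * ?u + ?u * ?u * ?v) / 6 = Itg (?w * ?v) - Itg ((D ^^ 2) ?u * ?v) + Itg ((D ^^ 4) ?u * ?v)"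
    proof -
      have "(v * ?u + ?u * v) * ?u + ?u * ?u * v = 3 * (?u * ?u * v)" for v
        by (simp add: algebra_simps)
      moreover have "Itg (?w * v) = Itg (?u * ?u * v) / 2 + Itg ((D ^^ 2) ?u * v) - Itg ((D ^^ 4) ?u * v)" if [simp]: "v \<in> trig_poly" for v
        by (simp add: distrib_right left_diff_distrib mult.assoc del: funpow.simps)
      ultimately show ?thesis by (simp add: mult.assoc del: funpow.simps)
    qed
    have E2: "Itg (D ?v * D ?u + D ?u * D ?v) / 2 = - Itg ((D ^^ 2) ?u * ?v)"
      using Itg_by_parts[of "D ?u" ?v] by (simp add: mult.commute numeral_eq_Suc)
    have E3: "Itg (D (D ?v) * D (D ?u) + D (D ?u) * D (D ?v)) / 2 = Itg ((D ^^ 4) ?u * ?v)"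
      using Itg_by_parts_pow[of "(D ^^ 2) ?u" ?v 2] by (simp add: mult.commute numeral_eq_Suc)
    \<comment> \<open>Since \<open>?v\<close> lies in \<open>real_trig N\<close>, \<open>?w\<close>
      can be replaced by its projection; integrating by parts and projecting the other factor leaves
      \<open>proj N ?w\<close> times its own derivative.\<close>
    have E4: "Itg (?w * ?v) = 0"
    proof -
      have Dw: "D ?w = kawahara ?u"
      proof -
        have "D (cst (1/2) * (?u * ?u)) = cst (1/2 + 1/2) * (?u * D ?u)"
          by (simp only: cst_ring_hom) (simp add: algebra_simps)
        then show ?thesis by (simp add: kawahara_def cst_ring_hom numeral_eq_Suc)
      qed
      have "Itg (?w * ?v) = Itg (?v * ?w)" by (simp add: mult.commute)
      also have "\<dots> = Itg (?v * proj N ?w)"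
        using Itg_proj[of ?w ?v N] by (simp add: mult.commute real_trig_uminus)
      also have "\<dots> = - Itg (D ?w * proj N ?w)"
        using galerkin_test[OF g, of "proj N ?w" t] by (simp add: Dw)
      also have "Itg (D ?w * proj N ?w) = - Itg (?w * D (proj N ?w))"
        by (rule Itg_by_parts) auto
      also have "- (- Itg (?w * D (proj N ?w))) = Itg (?w * D (proj N ?w))"
        by simp
      also have "\<dots> = Itg (proj N ?w * D (proj N ?w))"
        by (simp add: Itg_proj)
      also have "\<dots> = 0"
        using Itg_odd_derivative[of "proj N ?w" 1] by (simp add: mult.commute)
      finally show ?thesis .
    qed
    show ?thesis using H unfolding E1 E2 E3 E4 by (simp del: funpow.simps)
  qed
  then show ?thesis using deriv_zero_constant[of "\<lambda>t. hamiltonian (u t)"] t by blast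
qed

text \<open>Only the first power of \<open>nrm (D u)\<close> occurs, so the quadratic part of the
  Hamiltonian can absorb the cubic one.\<close>

lemma Itg_cube_le:
  assumes [simp]: "u \<in> trig_poly"
  shows "\<bar>Itg (u * u * u)\<bar> \<le> 2 * (nrm u + nrm (D u)) * (nrm u)\<^sup>2"
proof -
  have "\<bar>Itg (u * u * u)\<bar> \<le> nrm (u * u) * nrm u" by (rule Cauchy_Schwarz) auto
  also have "\<dots> \<le> 2 * (nrm u + nrm (D u)) * nrm u * nrm u"
    by (intro mult_right_mono nrm_mult_Sobolev) auto
  finally show ?thesis by (simp add: power2_eq_square)
qed

lemma galerkin_H2_bound:
  assumes g: "galerkin N u" and t: "0 \<le> t" and B: "\<And>j. j \<le> 2 \<Longrightarrow> nrm ((D ^^ j) (u 0)) \<le> B" and j: "j \<le> 2"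
  shows "nrm ((D ^^ j) (u t)) \<le> 2 * B + 2 * B\<^sup>2"
proof -
  note [simp] = galerkinD(2)[OF g]
  have m0: "nrm (u 0) \<le> B" and y0: "nrm (D (u 0)) \<le> B" and z0: "nrm (D (D (u 0))) \<le> B"
    using B[of 0] B[of 1] B[of 2] by (auto simp: numeral_eq_Suc)
  have m: "nrm (u t) \<le> B" using galerkin_L2_conserved[OF g t] m0 by simp
  have B0: "0 \<le> B" by (rule order_trans[OF nrm_nonneg m0]) simp
  define y z where "y = nrm (D (u t))" and "z = nrm (D (D (u t)))"
  have y_nonneg: "0 \<le> y" and z_nonneg: "0 \<le> z" by (auto simp: y_def z_def)
  have "\<bar>Itg (u t * u t * u t)\<bar> \<le> 2 * (B + y) * B\<^sup>2"
    using m nrm_nonneg[of "u t"] B0 y_nonneg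
    by (intro order_trans[OF Itg_cube_le] mult_mono power_mono) (auto simp: y_def)
  moreover have "\<bar>Itg (u 0 * u 0 * u 0)\<bar> \<le> 2 * (B + B) * B\<^sup>2"
    using m0 y0 B0 by (intro order_trans[OF Itg_cube_le] mult_mono power_mono) auto
  moreover have "(nrm (D (u 0)))\<^sup>2 \<le> B\<^sup>2" "(nrm (D (D (u 0))))\<^sup>2 \<le> B\<^sup>2"
    using y0 z0 by (auto intro!: power_mono)
  moreover have "Itg (u t * u t * u t) / 6 - y\<^sup>2 / 2 - z\<^sup>2 / 2
     = Itg (u 0 * u 0 * u 0) / 6 - (nrm (D (u 0)))\<^sup>2 / 2 - (nrm (D (D (u 0))))\<^sup>2 / 2"
    using galerkin_hamiltonian_conserved[OF g t] by (simp add: hamiltonian_def y_def z_def nrm_square)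
  ultimately have "y\<^sup>2 + z\<^sup>2 \<le> 2 * B\<^sup>2 + ((2 * (B + B) * B\<^sup>2) / 3 + (2 * (B + y) * B\<^sup>2) / 3)"
    by linarith
  also have "(2 * (B + B) * B\<^sup>2) / 3 + (2 * (B + y) * B\<^sup>2) / 3 = 2 * B ^ 3 + 2 / 3 * (y * B\<^sup>2)"
    by (simp add: field_simps power3_eq_cube power2_eq_square)
  finally have "y\<^sup>2 + z\<^sup>2 \<le> 2 * B\<^sup>2 + (2 * B ^ 3 + 2 / 3 * (y * B\<^sup>2))" .
  \<comment> \<open>Young's inequality; half of \<open>y\<^sup>2\<close> will then be absorbed on
    the left.\<close>
  moreover have "2 / 3 * (y * B\<^sup>2) \<le> (y\<^sup>2 + B ^ 4) / 3"
    using sum_squares_bound[of y "B\<^sup>2"] by simp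
  moreover have "(y\<^sup>2 + B ^ 4) / 3 \<le> (y\<^sup>2 + B ^ 4) / 2"
    using B0 by (intro divide_left_mono) auto
  ultimately have *: "y\<^sup>2 + z\<^sup>2 \<le> 2 * B\<^sup>2 + 2 * B ^ 3 + (y\<^sup>2 / 2 + B ^ 4 / 2)"
    unfolding add_divide_distrib by linarith
  \<comment> \<open>Twice the preceding inequality bounds \<open>y\<^sup>2\<close> by
    \<open>4 * B\<^sup>2 + 4 * B ^ 3 + B ^ 4\<close>; the constant is chosen so that its square
    dominates this term by term.\<close>
  have C2: "(2 * B + 2 * B\<^sup>2)\<^sup>2 = 4 * B\<^sup>2 + 8 * B ^ 3 + 4 * B ^ 4"
    by (simp add: power2_eq_square power3_eq_cube power4_eq_xxxx algebra_simps)
  have p: "0 \<le> B ^ 2" "0 \<le> B ^ 3" "0 \<le> B ^ 4" using B0 by auto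
  have C0: "0 \<le> 2 * B + 2 * B\<^sup>2" using B0 by simp
  have "y\<^sup>2 \<le> (2 * B + 2 * B\<^sup>2)\<^sup>2" 
    unfolding C2 using * p zero_le_power2[of y] zero_le_power2[of z] by linarith
  moreover have "z\<^sup>2 \<le> (2 * B + 2 * B\<^sup>2)\<^sup>2"
    unfolding C2 using * p zero_le_power2[of y] zero_le_power2[of z] by linarith
  ultimately have "y \<le> 2 * B + 2 * B\<^sup>2" "z \<le> 2 * B + 2 * B\<^sup>2"
    using C0 power2_le_imp_le by blast+
  moreover have "nrm (u t) \<le> 2 * B + 2 * B\<^sup>2" using m B0 p by linarith
  moreover have "j = 0 \<or> j = 1 \<or> j = 2" using j by auto
  ultimately show ?thesis by (auto simp: y_def z_def numeral_eq_Suc)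
qed

text \<open>In the Leibniz expansion only the term with all derivatives on \<open>D u\<close> loses a derivative, which is
  recovered by integration by parts; every other term is at most linear in the top-order norm, also for
  \<open>s = 3\<close>, where the middle term is quadratic in the second derivative.\<close>

lemma energy_estimate:
  assumes [simp]: "u \<in> trig_poly" and s: "3 \<le> s"
    and C: "\<And>j. j < s \<Longrightarrow> nrm ((D ^^ j) u) \<le> C"
  shows "\<bar>Itg ((D ^^ s) (u * D u) * (D ^^ s) u)\<bar>
     \<le> (2 * C + 2 ^ s * (4 * C * (C\<^sup>2 + 2))) * (1 + Itg ((D ^^ s) u * (D ^^ s) u))"
proof -
  define w where "w = (D ^^ s) u"
  have [simp]: "w \<in> trig_poly" by (simp add: w_def)
  define y where "y = nrm w"
  have y0: "0 \<le> y" by (simp add: y_def)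
  have C0: "0 \<le> C" using C[of 0] s order_trans[OF nrm_nonneg[of u]] by auto
  define F where "F j = (D ^^ j) u * (D ^^ (Suc s - j)) u" for j
  have [simp]: "F j \<in> trig_poly" for j by (simp add: F_def)
  have expand: "(D ^^ s) (u * D u) = (\<Sum>j\<le>s. of_nat (s choose j) * F j)"
    by (simp add: Leibniz F_def Suc_diff_le funpow_swap1)
  have F0: "\<bar>Itg (F 0 * w)\<bar> \<le> 2 * C * y\<^sup>2"
  proof -
    have "F 0 * w = u * D w * w" by (simp add: F_def w_def)
    then have "\<bar>Itg (F 0 * w)\<bar> = \<bar>Itg (D u * w * w)\<bar> / 2" by (simp add: Itg_commutator)
    also have "\<bar>Itg (D u * w * w)\<bar> \<le> nrm (D u * w) * y"
      unfolding y_def by (rule Cauchy_Schwarz) auto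
    also have "\<dots> \<le> (2 * (nrm (D u) + nrm (D (D u))) * y) * y"
      unfolding y_def by (intro mult_right_mono nrm_mult_Sobolev) auto
    also have "\<dots> \<le> (2 * (C + C) * y) * y"
      using C[of 1] C[of 2] s y0 by (intro mult_right_mono mult_left_mono add_mono) (auto simp: numeral_eq_Suc)
    finally show ?thesis by (simp add: power2_eq_square)
  qed
  \<comment> \<open>For \<open>i \<le> s - 2\<close> one more derivative on the first factor is
    still below the top order, and only \<open>i = 1\<close> puts \<open>s\<close> derivatives on
    the second factor.\<close>
  have b: "nrm ((D ^^ i) u * (D ^^ (Suc s - i)) u) \<le> 4 * C * (C + y)" if i: "1 \<le> i" "i \<le> s - 2 \<or> i = 2 \<and> s = 3" for i
  proof (cases "i \<le> s - 2")
    case True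
    have "nrm ((D ^^ i) u * (D ^^ (Suc s - i)) u) \<le> 2 * (nrm ((D ^^ i) u) + nrm (D ((D ^^ i) u))) * nrm ((D ^^ (Suc s - i)) u)"
      by (rule nrm_mult_Sobolev) auto
    also have "\<dots> \<le> 2 * (C + C) * (C + y)"
    proof (intro mult_mono add_mono)
      show "nrm (D ((D ^^ i) u)) \<le> C" using C[of "Suc i"] True s by simp
      show "nrm ((D ^^ (Suc s - i)) u) \<le> C + y"
      proof (cases "i = 1")
        case False
        then have "nrm ((D ^^ (Suc s - i)) u) \<le> C" using i s by (intro C) auto
        then show ?thesis using y0 by simp
      qed (use C0 in \<open>simp add: y_def w_def\<close>)
    qed (use True s C C0 y0 in auto)
    finally show ?thesis by simp
  next
    case False
    then have i2: "i = 2" and s3: "s = 3" using i by auto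
    have "nrm ((D ^^ i) u * (D ^^ (Suc s - i)) u) \<le> 2 * (nrm ((D ^^ 2) u) + nrm (D ((D ^^ 2) u))) * nrm ((D ^^ 2) u)"
      unfolding i2 s3 using nrm_mult_Sobolev[of "(D ^^ 2) u" "(D ^^ 2) u"] by (simp del: funpow.simps)
    also have "\<dots> \<le> 2 * (C + y) * C"
    proof (intro mult_mono add_mono)
      show "nrm (D ((D ^^ 2) u)) \<le> y" by (simp add: y_def w_def s3 numeral_eq_Suc)
    qed (use s3 C C0 y0 in auto)
    also have "\<dots> \<le> 4 * C * (C + y)" using C0 y0 by (simp add: algebra_simps)
    finally show ?thesis .
  qed
  have F: "nrm (F j) \<le> 4 * C * (C + y)" if j: "1 \<le> j" "j \<le> s" for j
  proof (cases "j \<le> s - 2 \<or> j = 2 \<and> s = 3")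
    case True
    then show ?thesis using b j by (simp add: F_def)
  next
    case False
    \<comment> \<open>The two factors exchange under \<open>j \<mapsto> Suc s - j\<close>, which
      takes the remaining indices \<open>s - 1\<close> and \<open>s\<close> to \<open>2\<close> and
      \<open>1\<close>.\<close>
    have "nrm (F j) = nrm ((D ^^ (Suc s - j)) u * (D ^^ (Suc s - (Suc s - j))) u)"
      using j by (simp add: F_def mult.commute)
    also have "\<dots> \<le> 4 * C * (C + y)" using False j s by (intro b) auto
    finally show ?thesis .
  qed
  have Fw: "\<bar>Itg (F j * w)\<bar> \<le> 4 * C * (C\<^sup>2 + 2) * (1 + y\<^sup>2)" if j: "1 \<le> j" "j \<le> s" for j
  proof -
    have "\<bar>Itg (F j * w)\<bar> \<le> nrm (F j) * y" unfolding y_def by (rule Cauchy_Schwarz) auto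
    also have "\<dots> \<le> 4 * C * (C + y) * y" using F[OF j] y0 by (intro mult_right_mono) auto
    also have "\<dots> = 4 * C * (C * y + y\<^sup>2)" by (simp add: power2_eq_square algebra_simps)
    \<comment> \<open>A crude bound, aimed at a multiple of \<open>1 + y\<^sup>2\<close>, the form
      that the affine Gronwall inequality takes.\<close>
    also have "\<dots> \<le> 4 * C * ((C\<^sup>2 + 2) * (1 + y\<^sup>2))"
    proof (intro mult_left_mono)
      have "2 * (C * y) \<le> C\<^sup>2 + y\<^sup>2" using sum_squares_bound[of C y] by simp
      moreover have "0 \<le> C\<^sup>2 * y\<^sup>2" by simp
      ultimately have "C * y + y\<^sup>2 \<le> C\<^sup>2 + 2 * y\<^sup>2 + 2 + C\<^sup>2 * y\<^sup>2"
        using zero_le_power2[of C] zero_le_power2[of y] by linarith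
      then show "C * y + y\<^sup>2 \<le> (C\<^sup>2 + 2) * (1 + y\<^sup>2)" by (simp add: algebra_simps)
    qed (use C0 in auto)
    finally show ?thesis by (simp add: mult.assoc)
  qed
  define E where "E = 4 * C * (C\<^sup>2 + 2) * (1 + y\<^sup>2)"
  have E0: "0 \<le> E" using C0 by (simp add: E_def)
  have "Itg ((D ^^ s) (u * D u) * w) = (\<Sum>j\<le>s. real (s choose j) * Itg (F j * w))"
    by (simp add: expand sum_distrib_right Itg_sum mult.assoc)
  also have "\<dots> = Itg (F 0 * w) + (\<Sum>j\<in>{..s} - {0}. real (s choose j) * Itg (F j * w))"
    by (subst sum.remove[of _ 0]) auto
  finally have "\<bar>Itg ((D ^^ s) (u * D u) * w)\<bar> \<le> \<bar>Itg (F 0 * w)\<bar> + \<bar>\<Sum>j\<in>{..s} - {0}. real (s choose j) * Itg (F j * w)\<bar>"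
    by (simp only: abs_triangle_ineq)
  also have "\<bar>\<Sum>j\<in>{..s} - {0}. real (s choose j) * Itg (F j * w)\<bar> \<le> (\<Sum>j\<in>{..s} - {0}. \<bar>real (s choose j) * Itg (F j * w)\<bar>)"
    by (rule sum_abs)
  also have "(\<Sum>j\<in>{..s} - {0}. \<bar>real (s choose j) * Itg (F j * w)\<bar>) \<le> (\<Sum>j\<in>{..s} - {0}. real (s choose j) * E)"
    unfolding abs_mult E_def by (intro sum_mono mult_mono Fw) auto
  also have "\<dots> \<le> (\<Sum>j\<le>s. real (s choose j) * E)"
    by (intro sum_mono2) (use E0 in auto)
  also have "\<dots> = 2 ^ s * E"
    using choose_row_sum[of s] by (simp add: sum_distrib_right[symmetric] of_nat_sum[symmetric] del: of_nat_sum)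
  also have "\<bar>Itg (F 0 * w)\<bar> \<le> 2 * C * (1 + y\<^sup>2)"
    using F0 C0 by (simp add: algebra_simps)
  finally have "\<bar>Itg ((D ^^ s) (u * D u) * w)\<bar> \<le> 2 * C * (1 + y\<^sup>2) + 2 ^ s * E" by simp
  also have "\<dots> = (2 * C + 2 ^ s * (4 * C * (C\<^sup>2 + 2))) * (1 + y\<^sup>2)"
    by (simp add: E_def algebra_simps)
  finally show ?thesis by (simp add: y_def nrm_square w_def)
qed

text \<open>The integrating factor makes \<open>(1 + f t) * exp (- A * t)\<close> nonincreasing. The
  endpoint \<open>0\<close>, where the derivative is one-sided, enters through continuity
  only.\<close>

lemma Gronwall_affine:
  fixes f f' :: "real \<Rightarrow> real"
  assumes d: "\<And>t. 0 \<le> t \<Longrightarrow> (f has_real_derivative f' t) (at t within {0..})"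
    and le: "\<And>t. 0 \<le> t \<Longrightarrow> t \<le> T \<Longrightarrow> f' t \<le> A * (1 + f t)"
    and A: "0 \<le> A" and f0: "0 \<le> f 0" and t: "0 \<le> t" "t \<le> T"
  shows "f t \<le> (1 + f 0) * exp (A * T)"
proof -
  define g where "g t = (1 + f t) * exp (- A * t)" for t
  have dg: "(g has_real_derivative (f' t - A * (1 + f t)) * exp (- A * t)) (at t within {0..})" if "0 \<le> t" for t
    unfolding g_def using d[OF that]
    by (auto intro!: derivative_eq_intros simp: algebra_simps)
  have "g t \<le> g 0"
  proof (rule DERIV_nonpos_imp_decreasing_open[of 0 t g])
    fix x assume x: "0 < x" "x < t"
    have "(g has_real_derivative (f' x - A * (1 + f x)) * exp (- A * x)) (at x)"
      using dg[of x] x at_within_interior[of x "{0..}"] by simp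
    moreover have "(f' x - A * (1 + f x)) * exp (- A * x) \<le> 0"
      using le[of x] x t by (simp add: mult_nonpos_nonneg)
    ultimately show "\<exists>y. (g has_real_derivative y) (at x) \<and> y \<le> 0" by blast
  next
    show "continuous_on {0..t} g"
      using dg by (meson DERIV_continuous atLeastAtMost_iff atLeast_iff continuous_on_eq_continuous_within continuous_on_subset subsetI)
  qed (use t in auto)
  then have "(1 + f t) * exp (- A * t) \<le> 1 + f 0" by (simp add: g_def)
  then have "1 + f t \<le> (1 + f 0) * exp (A * t)"
    by (simp add: exp_minus field_simps)
  also have "\<dots> \<le> (1 + f 0) * exp (A * T)"
    using A t f0 by (intro mult_left_mono) (auto intro: mult_left_mono)
  finally show ?thesis by simp
qed

text \<open>The bound is quantified before \<open>N\<close> and \<open>u\<close>, which makes it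
  uniform in the truncation level. The conserved quantities start the induction; each further order
  is an affine differential inequality whose coefficient comes from the orders below.\<close>

lemma galerkin_Sobolev_bound:
  assumes "0 \<le> T" "2 \<le> s"
  shows "\<exists>C. \<forall>N u. galerkin N u \<longrightarrow> (\<forall>j\<le>s. nrm ((D ^^ j) (u 0)) \<le> B) \<longrightarrow>
    (\<forall>t\<in>{0..T}. \<forall>j\<le>s. nrm ((D ^^ j) (u t)) \<le> C)"
  using assms(2)
proof (induction s rule: dec_induct)
  case base
  show ?case using galerkin_H2_bound by (intro exI[of _ "2 * B + 2 * B\<^sup>2"]) auto
next
  case (step s)
  then obtain C where C: "\<And>N u t j. galerkin N u \<Longrightarrow> (\<forall>j\<le>s. nrm ((D ^^ j) (u 0)) \<le> B) \<Longrightarrow> t \<in> {0..T} \<Longrightarrow> j \<le> s \<Longrightarrow>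
     nrm ((D ^^ j) (u t)) \<le> C" by blast
  \<comment> \<open>The induction hypothesis may hold vacuously with a negative \<open>C\<close>,
    whereas Gronwall's inequality needs \<open>0 \<le> A\<close>.\<close>
  define C' where "C' = \<bar>C\<bar>"
  define A where "A = 2 * (2 * C' + 2 ^ Suc s * (4 * C' * (C'\<^sup>2 + 2)))"
  have A0: "0 \<le> A" by (simp add: A_def C'_def)
  define E where "E = sqrt ((1 + B\<^sup>2) * exp (A * T))"
  show ?case
  proof (intro exI[of _ "max C E"] allI impI ballI)
    fix N u t j
    assume g: "galerkin N u" and B: "\<forall>j\<le>Suc s. nrm ((D ^^ j) (u 0)) \<le> B" and t: "t \<in> {0..T}" and j: "j \<le> Suc s"
    note [simp] = galerkinD(2)[OF g]
    show "nrm ((D ^^ j) (u t)) \<le> max C E"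
    proof (cases "j = Suc s")
      case False
      then show ?thesis using C[OF g _ t, of j] B j by auto
    next
      case True
      let ?f = "\<lambda>t. Itg ((D ^^ Suc s) (u t) * (D ^^ Suc s) (u t))"
      have "?f t \<le> (1 + ?f 0) * exp (A * T)"
      proof (rule Gronwall_affine)
        fix t :: real assume t: "0 \<le> t" "t \<le> T"
        have "\<bar>Itg ((D ^^ Suc s) (u t * D (u t)) * (D ^^ Suc s) (u t))\<bar> \<le> A / 2 * (1 + ?f t)"
        proof -
          have "nrm ((D ^^ j) (u t)) \<le> C'" if "j < Suc s" for j
          proof -
            have "nrm ((D ^^ j) (u t)) \<le> C" using that B t by (intro C[OF g]) auto
            then show ?thesis by (simp add: C'_def)
          qed
          note lower = this
          have half: "A / 2 = 2 * C' + 2 ^ Suc s * (4 * C' * (C'\<^sup>2 + 2))" by (simp add: A_def)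
          show ?thesis unfolding half by (rule energy_estimate) (use lower step.hyps in auto)
        qed
        then show "- 2 * Itg ((D ^^ Suc s) (u t * D (u t)) * (D ^^ Suc s) (u t)) \<le> A * (1 + ?f t)"
          by (simp del: funpow.simps)
      next
        show "0 \<le> t" "t \<le> T" using t by auto
        show "0 \<le> ?f 0" by (rule Itg_square_nonneg) simp
      qed (rule galerkin_energy_deriv[OF g], assumption, rule A0)
      also have "\<dots> \<le> (1 + B\<^sup>2) * exp (A * T)"
      proof -
        have "?f 0 = (nrm ((D ^^ Suc s) (u 0)))\<^sup>2" by (rule nrm_square[symmetric]) (simp del: funpow.simps)
        also have "\<dots> \<le> B\<^sup>2" using B by (intro power_mono) (auto simp del: funpow.simps)
        finally show ?thesis by simp
      qed
      finally have "nrm ((D ^^ Suc s) (u t)) \<le> E" unfolding E_def nrm_def by (rule real_sqrt_le_mono)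
      then show ?thesis using True by simp
    qed
  qed
qed

section \<open>Regularity in time\<close>

text \<open>Uniform boundedness in \<open>H\<^sup>s\<close>, used with pairs of truncation level and
  time as indices. The bound is existential so that closure properties compose without explicit
  constants.\<close>

definition bdd_family :: "'i set \<Rightarrow> nat \<Rightarrow> ('i \<Rightarrow> real \<Rightarrow> real) \<Rightarrow> bool" where
  "bdd_family A s f \<longleftrightarrow> (\<forall>i\<in>A. f i \<in> trig_poly) \<and> (\<exists>B. \<forall>i\<in>A. \<forall>j\<le>s. nrm ((D ^^ j) (f i)) \<le> B)"

lemma bdd_familyI: 
  "(\<And>i. i \<in> A \<Longrightarrow> f i \<in> trig_poly) \<Longrightarrow> (\<And>i j. i \<in> A \<Longrightarrow> j \<le> s \<Longrightarrow> nrm ((D ^^ j) (f i)) \<le> B) \<Longrightarrow> bdd_family A s f"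
  by (auto simp: bdd_family_def)

lemma bdd_familyE:
  assumes "bdd_family A s f"
  obtains B where "0 \<le> B" "\<And>i. i \<in> A \<Longrightarrow> f i \<in> trig_poly" "\<And>i j. i \<in> A \<Longrightarrow> j \<le> s \<Longrightarrow> nrm ((D ^^ j) (f i)) \<le> B"
proof -
  obtain B where "\<And>i. i \<in> A \<Longrightarrow> f i \<in> trig_poly" "\<And>i j. i \<in> A \<Longrightarrow> j \<le> s \<Longrightarrow> nrm ((D ^^ j) (f i)) \<le> B"
    using assms by (auto simp: bdd_family_def)
  moreover from this(2) have "\<And>i j. i \<in> A \<Longrightarrow> j \<le> s \<Longrightarrow> nrm ((D ^^ j) (f i)) \<le> \<bar>B\<bar>"
    by (meson abs_ge_self order_trans)
  ultimately show ?thesis using that[of "\<bar>B\<bar>"] by auto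
qed

lemma bdd_family_mono: "bdd_family A s f \<Longrightarrow> r \<le> s \<Longrightarrow> bdd_family A r f"
  unfolding bdd_family_def by (meson order_trans)

lemma bdd_family_add: 
  assumes "bdd_family A s f" "bdd_family A s g" shows "bdd_family A s (\<lambda>i. f i + g i)"
proof -
  from assms(1) obtain B where B: "\<And>i. i \<in> A \<Longrightarrow> f i \<in> trig_poly" "\<And>i j. i \<in> A \<Longrightarrow> j \<le> s \<Longrightarrow> nrm ((D ^^ j) (f i)) \<le> B"
    by (rule bdd_familyE) blast
  from assms(2) obtain C where C: "\<And>i. i \<in> A \<Longrightarrow> g i \<in> trig_poly" "\<And>i j. i \<in> A \<Longrightarrow> j \<le> s \<Longrightarrow> nrm ((D ^^ j) (g i)) \<le> C"
    by (rule bdd_familyE) blast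
  show ?thesis
  proof (rule bdd_familyI[of _ _ _ "B + C"])
    fix i j assume i: "i \<in> A" and j: "j \<le> s"
    have "nrm ((D ^^ j) (f i + g i)) \<le> nrm ((D ^^ j) (f i)) + nrm ((D ^^ j) (g i))"
      using i B C by (simp add: Dpow_add nrm_triangle)
    then show "nrm ((D ^^ j) (f i + g i)) \<le> B + C" using B(2)[OF i j] C(2)[OF i j] by linarith
  qed (use B C in auto)
qed

lemma bdd_family_uminus: "bdd_family A s f \<Longrightarrow> bdd_family A s (\<lambda>i. - f i)"
  by (auto simp: bdd_family_def Dpow_uminus)

lemma bdd_family_diff: 
  "bdd_family A s f \<Longrightarrow> bdd_family A s g \<Longrightarrow> bdd_family A s (\<lambda>i. f i - g i)"
  using bdd_family_add[OF _ bdd_family_uminus, of A s f g] by simp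

lemma bdd_family_proj: 
  assumes "bdd_family A s f" shows "bdd_family A s (\<lambda>i. proj (n i) (f i))"
proof -
  from assms(1) obtain B where B: "\<And>i. i \<in> A \<Longrightarrow> f i \<in> trig_poly" "\<And>i j. i \<in> A \<Longrightarrow> j \<le> s \<Longrightarrow> nrm ((D ^^ j) (f i)) \<le> B"
    by (rule bdd_familyE) blast
  show ?thesis
  proof (rule bdd_familyI[of _ _ _ "B"])
    fix i j assume i: "i \<in> A" and j: "j \<le> s"
    have "nrm ((D ^^ j) (proj (n i) (f i))) \<le> nrm ((D ^^ j) (f i))"
      using B i by (simp add: Dpow_proj nrm_proj)
    also have "\<dots> \<le> B" using B i j by simp
    finally show "nrm ((D ^^ j) (proj (n i) (f i))) \<le> B" .
  qed auto
qed

lemma bdd_family_Dpow: 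
  assumes "bdd_family A (s + k) f" shows "bdd_family A s (\<lambda>i. (D ^^ k) (f i))"
proof -
  from assms(1) obtain B where B: "\<And>i. i \<in> A \<Longrightarrow> f i \<in> trig_poly" "\<And>i j. i \<in> A \<Longrightarrow> j \<le> s + k \<Longrightarrow> nrm ((D ^^ j) (f i)) \<le> B"
    by (rule bdd_familyE) blast
  then show ?thesis by (intro bdd_familyI[of _ _ _ "B"]) (auto simp: Dpow_Dpow)
qed

lemma bdd_family_D: "bdd_family A (Suc s) f \<Longrightarrow> bdd_family A s (\<lambda>i. D (f i))"
  using bdd_family_Dpow[of A s 1 f] by simp

text \<open>The first factor is asked for one order more because the Sobolev inequality is applied
  to its derivatives in the Leibniz expansion.\<close>

lemma bdd_family_mult:
  assumes "bdd_family A (Suc s) f" "bdd_family A s g" shows "bdd_family A s (\<lambda>i. f i * g i)"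
proof -
  from assms(1) obtain B where B: "0 \<le> B" "\<And>i. i \<in> A \<Longrightarrow> f i \<in> trig_poly" "\<And>i j. i \<in> A \<Longrightarrow> j \<le> Suc s \<Longrightarrow> nrm ((D ^^ j) (f i)) \<le> B"
    by (rule bdd_familyE) blast
  from assms(2) obtain C where C: "0 \<le> C" "\<And>i. i \<in> A \<Longrightarrow> g i \<in> trig_poly" "\<And>i j. i \<in> A \<Longrightarrow> j \<le> s \<Longrightarrow> nrm ((D ^^ j) (g i)) \<le> C"
    by (rule bdd_familyE) blast
  show ?thesis
  proof (rule bdd_familyI[of _ _ _ "2 ^ s * (2 * (B + B) * C)"])
    fix i j assume i: "i \<in> A" and j: "j \<le> s"
    have [simp]: "f i \<in> trig_poly" "g i \<in> trig_poly" using i B C by auto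
    have "nrm ((D ^^ j) (f i * g i)) \<le> (\<Sum>l\<le>j. nrm (of_nat (j choose l) * ((D ^^ l) (f i) * (D ^^ (j - l)) (g i))))"
      unfolding Leibniz[OF \<open>f i \<in> trig_poly\<close> \<open>g i \<in> trig_poly\<close>] by (rule nrm_sum) simp
    also have "\<dots> \<le> (\<Sum>l\<le>j. real (j choose l) * (2 * (B + B) * C))"
      unfolding nrm_of_nat
    proof (intro sum_mono mult_left_mono)
      fix l assume l: "l \<in> {..j}"
      have "nrm ((D ^^ l) (f i) * (D ^^ (j - l)) (g i)) \<le> 2 * (nrm ((D ^^ l) (f i)) + nrm ((D ^^ Suc l) (f i))) * nrm ((D ^^ (j - l)) (g i))"
        using nrm_mult_Sobolev[of "(D ^^ l) (f i)" "(D ^^ (j - l)) (g i)"] by simp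
      also have "\<dots> \<le> 2 * (B + B) * C"
        using i j l B C by (intro mult_mono add_mono B C) (auto simp del: funpow.simps)
      finally show "nrm ((D ^^ l) (f i) * (D ^^ (j - l)) (g i)) \<le> 2 * (B + B) * C" .
    qed auto
    also have "\<dots> = 2 ^ j * (2 * (B + B) * C)"
      using choose_row_sum[of j] by (simp add: sum_distrib_right[symmetric] of_nat_sum[symmetric] del: of_nat_sum)
    also have "\<dots> \<le> 2 ^ s * (2 * (B + B) * C)"
      using B(1) C(1) j by (intro mult_right_mono power_increasing) auto
    finally show "nrm ((D ^^ j) (f i * g i)) \<le> 2 ^ s * (2 * (B + B) * C)" .
  qed (use B C in auto)
qed

lemma bdd_family_sup:
  assumes "bdd_family A 1 f"
  obtains S where "0 \<le> S" "\<And>i x. i \<in> A \<Longrightarrow> x \<in> {-pi..pi} \<Longrightarrow> \<bar>f i x\<bar> \<le> S"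
proof -
  from assms obtain B where B: "0 \<le> B" "\<And>i. i \<in> A \<Longrightarrow> f i \<in> trig_poly" "\<And>i j. i \<in> A \<Longrightarrow> j \<le> 1 \<Longrightarrow> nrm ((D ^^ j) (f i)) \<le> B"
    by (rule bdd_familyE) blast
  have "\<bar>f i x\<bar> \<le> 2 * (B + B)" if "i \<in> A" "x \<in> {-pi..pi}" for i x
  proof -
    have "\<bar>f i x\<bar> \<le> 2 * (nrm (f i) + nrm (D (f i)))" using that B by (intro Sobolev) auto
    also have "\<dots> \<le> 2 * (B + B)" using B(3)[of i 0] B(3)[of i 1] that by (intro mult_left_mono add_mono) auto
    finally show ?thesis .
  qed
  then show ?thesis using that[of "2 * (B + B)"] B(1) by auto
qed

definition dkawahara :: "(real \<Rightarrow> real) \<Rightarrow> (real \<Rightarrow> real) \<Rightarrow> (real \<Rightarrow> real)" where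
  "dkawahara u v = v * D u + u * D v + (D ^^ 3) v - (D ^^ 5) v"

text \<open>The second time derivative of \<open>kawahara u\<close> when \<open>v\<close> and
  \<open>w\<close> are the first two time derivatives of \<open>u\<close>. The two copies of
  \<open>v * D v\<close> stay separate to match what the product rule produces.\<close>

definition ddkawahara :: "(real \<Rightarrow> real) \<Rightarrow> (real \<Rightarrow> real) \<Rightarrow> (real \<Rightarrow> real) \<Rightarrow> (real \<Rightarrow> real)" where
  "ddkawahara u v w = w * D u + v * D v + (v * D v + u * D w) + (D ^^ 3) w - (D ^^ 5) w"

lemma time_deriv_kawahara:
  assumes "time_deriv u v" shows "time_deriv (\<lambda>t. kawahara (u t)) (\<lambda>t. dkawahara (u t) (v t))"
  unfolding kawahara_def dkawahara_def
  by (intro time_deriv_diff time_deriv.add time_deriv_mult time_deriv_D time_deriv_Dpow assms)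

lemma time_deriv_dkawahara:
  assumes "time_deriv u v" "time_deriv v w"
  shows "time_deriv (\<lambda>t. dkawahara (u t) (v t)) (\<lambda>t. ddkawahara (u t) (v t) (w t))"
  unfolding dkawahara_def ddkawahara_def
  by (intro time_deriv_diff time_deriv.add time_deriv_mult time_deriv_D time_deriv_Dpow assms)

lemma bdd_family_kawahara:
  assumes "bdd_family A (s + 5) u" shows "bdd_family A s (\<lambda>i. kawahara (u i))"
  unfolding kawahara_def
  by (intro bdd_family_diff bdd_family_add bdd_family_mult bdd_family_D bdd_family_Dpow bdd_family_mono[OF assms]) auto

lemma bdd_family_dkawahara:
  assumes "bdd_family A (s + 5) u" "bdd_family A (s + 5) v" shows "bdd_family A s (\<lambda>i. dkawahara (u i) (v i))"
  unfolding dkawahara_def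
  by (intro bdd_family_diff bdd_family_add bdd_family_mult bdd_family_D bdd_family_Dpow;
      (rule bdd_family_mono[OF assms(1)] bdd_family_mono[OF assms(2)]); simp)

lemma bdd_family_ddkawahara:
  assumes u: "bdd_family A (s + 5) u" and v: "bdd_family A (s + 5) v" and w: "bdd_family A (s + 5) w"
  shows "bdd_family A s (\<lambda>i. ddkawahara (u i) (v i) (w i))"
  unfolding ddkawahara_def
  by (intro bdd_family_diff bdd_family_add bdd_family_mult bdd_family_D bdd_family_Dpow;
      (rule bdd_family_mono[OF u] bdd_family_mono[OF v] bdd_family_mono[OF w]); simp)

text \<open>Each time derivative costs five space derivatives, and the supremum bound one more:
  this is where \<open>16 = 3 \<cdot> 5 + 1\<close> comes from.\<close>

lemma galerkin_regularity:
  assumes g: "\<And>N. 1 \<le> N \<Longrightarrow> galerkin N (u N)" and T: "0 \<le> T"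
    and B: "\<And>N j. 1 \<le> N \<Longrightarrow> j \<le> 16 \<Longrightarrow> nrm ((D ^^ j) (u N 0)) \<le> B"
  obtains G v w z where "0 \<le> G"
    "\<And>N. 1 \<le> N \<Longrightarrow> v N = (\<lambda>t. - proj N (kawahara (u N t)))"
    "\<And>N. 1 \<le> N \<Longrightarrow> time_deriv (u N) (v N)" "\<And>N. 1 \<le> N \<Longrightarrow> time_deriv (v N) (w N)"
    "\<And>N. 1 \<le> N \<Longrightarrow> time_deriv (w N) (z N)"
    "\<And>N t x. 1 \<le> N \<Longrightarrow> t \<in> {0..T} \<Longrightarrow> x \<in> {-pi..pi} \<Longrightarrow>
       \<bar>u N t x\<bar> \<le> G \<and> \<bar>D (u N t) x\<bar> \<le> G \<and> \<bar>v N t x\<bar> \<le> G \<and> \<bar>z N t x\<bar> \<le> G"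
proof -
  define v where "v = (\<lambda>N t. - proj N (kawahara (u N t)))"
  define w where "w = (\<lambda>N t. - proj N (dkawahara (u N t) (v N t)))"
  define z where "z = (\<lambda>N t. - proj N (ddkawahara (u N t) (v N t) (w N t)))"
  have uv: "time_deriv (u N) (v N)" if "1 \<le> N" for N
    using galerkinD(3)[OF g[OF that]] by (simp add: v_def)
  have vw: "time_deriv (v N) (w N)" if "1 \<le> N" for N
    using time_deriv_uminus[OF time_deriv_proj[OF time_deriv_kawahara[OF uv[OF that]]]]
    by (simp add: v_def w_def)
  have wz: "time_deriv (w N) (z N)" if "1 \<le> N" for N
    using time_deriv_uminus[OF time_deriv_proj[OF time_deriv_dkawahara[OF uv[OF that] vw[OF that]]]]
    by (simp add: w_def z_def)
  define A where "A = {p :: nat \<times> real. 1 \<le> fst p \<and> snd p \<in> {0..T}}"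
  have "\<exists>C. \<forall>N u. galerkin N u \<longrightarrow> (\<forall>j\<le>16. nrm ((D ^^ j) (u 0)) \<le> B) \<longrightarrow>
      (\<forall>t\<in>{0..T}. \<forall>j\<le>16. nrm ((D ^^ j) (u t)) \<le> C)"
    using T by (rule galerkin_Sobolev_bound) simp
  then obtain C where "\<forall>N u. galerkin N u \<longrightarrow> (\<forall>j\<le>16. nrm ((D ^^ j) (u 0)) \<le> B) \<longrightarrow>
      (\<forall>t\<in>{0..T}. \<forall>j\<le>16. nrm ((D ^^ j) (u t)) \<le> C)" ..
  then have C: "nrm ((D ^^ j) (u N t)) \<le> C" if "1 \<le> N" "t \<in> {0..T}" "j \<le> 16" for N t j
    using that g[OF that(1)] B[OF that(1)] by blast
  have bu: "bdd_family A 16 (\<lambda>p. u (fst p) (snd p))"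
    using C g by (intro bdd_familyI[of _ _ _ C]) (auto simp: A_def intro: galerkinD(2)[OF g])
  have bv: "bdd_family A 11 (\<lambda>p. v (fst p) (snd p))"
    unfolding v_def by (intro bdd_family_uminus bdd_family_proj bdd_family_kawahara bdd_family_mono[OF bu]) simp
  have bw: "bdd_family A 6 (\<lambda>p. w (fst p) (snd p))"
    unfolding w_def by (intro bdd_family_uminus bdd_family_proj bdd_family_dkawahara bdd_family_mono[OF bu] bdd_family_mono[OF bv]) simp_all
  have bz: "bdd_family A 1 (\<lambda>p. z (fst p) (snd p))"
    unfolding z_def by (intro bdd_family_uminus bdd_family_proj bdd_family_ddkawahara bdd_family_mono[OF bu] bdd_family_mono[OF bv] bdd_family_mono[OF bw]) simp_all
  have b: "bdd_family A 1 (\<lambda>p. u (fst p) (snd p))" "bdd_family A 1 (\<lambda>p. D (u (fst p) (snd p)))" "bdd_family A 1 (\<lambda>p. v (fst p) (snd p))"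
    by (intro bdd_family_D bdd_family_mono[OF bu] bdd_family_mono[OF bv]; simp)+
  obtain S1 where S1: "0 \<le> S1" "\<And>p x. p \<in> A \<Longrightarrow> x \<in> {-pi..pi} \<Longrightarrow> \<bar>u (fst p) (snd p) x\<bar> \<le> S1"
    by (rule bdd_family_sup[OF b(1)]) blast
  obtain S2 where S2: "0 \<le> S2" "\<And>p x. p \<in> A \<Longrightarrow> x \<in> {-pi..pi} \<Longrightarrow> \<bar>D (u (fst p) (snd p)) x\<bar> \<le> S2"
    by (rule bdd_family_sup[OF b(2)]) blast
  obtain S3 where S3: "0 \<le> S3" "\<And>p x. p \<in> A \<Longrightarrow> x \<in> {-pi..pi} \<Longrightarrow> \<bar>v (fst p) (snd p) x\<bar> \<le> S3"
    by (rule bdd_family_sup[OF b(3)]) blast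
  obtain S4 where S4: "0 \<le> S4" "\<And>p x. p \<in> A \<Longrightarrow> x \<in> {-pi..pi} \<Longrightarrow> \<bar>z (fst p) (snd p) x\<bar> \<le> S4"
    by (rule bdd_family_sup[OF bz]) blast
  show ?thesis
  proof (rule that[of "S1 + S2 + S3 + S4" v w z])
    fix N :: nat and t x assume "1 \<le> N" "t \<in> {0..T}" and x: "x \<in> {-pi..pi}"
    then have "(N, t) \<in> A" by (simp add: A_def)
    from S1(2)[OF this x] S2(2)[OF this x] S3(2)[OF this x] S4(2)[OF this x]
    show "\<bar>u N t x\<bar> \<le> S1 + S2 + S3 + S4 \<and> \<bar>D (u N t) x\<bar> \<le> S1 + S2 + S3 + S4 \<and> \<bar>v N t x\<bar> \<le> S1 + S2 + S3 + S4 \<and> \<bar>z N t x\<bar> \<le> S1 + S2 + S3 + S4"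
      using S1(1) S2(1) S3(1) S4(1) by simp
  qed (use S1(1) S2(1) S3(1) S4(1) uv vw wz in \<open>auto simp: v_def\<close>)
qed

section \<open>Mean value estimates in time\<close>

lemma half_line_mean_value:
  fixes g :: "real \<Rightarrow> real"
  assumes g: "\<And>t. 0 \<le> t \<Longrightarrow> (g has_real_derivative g' t) (at t within {0..})"
    and G: "\<And>t. t \<in> {0..T} \<Longrightarrow> \<bar>g' t\<bar> \<le> G" and s: "s \<in> {0..T}" "t \<in> {0..T}"
  shows "\<bar>g t - g s\<bar> \<le> G * \<bar>t - s\<bar>"
proof -
  have "norm (g t - g s) \<le> G * norm (t - s)"
    by (rule field_differentiable_bound[of "{0..T}" g g'])
       (use G s in \<open>auto intro: has_field_derivative_subset[OF g]\<close>)
  then show ?thesis by simp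
qed

text \<open>As a function of the step the difference vanishes at \<open>0\<close> together with its
  first derivative, and its second derivative is \<open>g2 (t + s) - g2 (t - s)\<close>. The mean
  value inequality, used three times, gives the order without the sharp constant.\<close>

lemma central_difference:
  fixes g :: "real \<Rightarrow> real"
  assumes g: "\<And>t. 0 \<le> t \<Longrightarrow> (g has_real_derivative g1 t) (at t within {0..})"
    "\<And>t. 0 \<le> t \<Longrightarrow> (g1 has_real_derivative g2 t) (at t within {0..})"
    "\<And>t. 0 \<le> t \<Longrightarrow> (g2 has_real_derivative g3 t) (at t within {0..})"
    and G: "\<And>t. t \<in> {0..T} \<Longrightarrow> \<bar>g3 t\<bar> \<le> G" and d: "0 \<le> d" "d \<le> t" "t + d \<le> T"
  shows "\<bar>g (t + d) - g (t - d) - 2 * d * g1 t\<bar> \<le> 2 * d ^ 3 * G"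
proof -
  \<comment> \<open>Derivatives are taken within \<open>{0..d}\<close> because \<open>t - d\<close>
    may be \<open>0\<close>, where only the one-sided derivative is available.\<close>
  have shift: "((\<lambda>s. f (t + s)) has_real_derivative f' (t + s)) (at s within {0..d})"
      "((\<lambda>s. f (t - s)) has_real_derivative - f' (t - s)) (at s within {0..d})"
    if f: "\<And>t. 0 \<le> t \<Longrightarrow> (f has_real_derivative f' t) (at t within {0..})" and s: "s \<in> {0..d}" for f f' s
  proof -
    have "((f \<circ> (\<lambda>s. t + s)) has_real_derivative f' (t + s) * 1) (at s within {0..d})"
      by (rule DERIV_image_chain) (use s d in \<open>auto intro!: has_field_derivative_subset[OF f] derivative_eq_intros\<close>)
    then show "((\<lambda>s. f (t + s)) has_real_derivative f' (t + s)) (at s within {0..d})"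
      by (simp add: o_def)
    have "((f \<circ> (\<lambda>s. t - s)) has_real_derivative f' (t - s) * (- 1)) (at s within {0..d})"
      by (rule DERIV_image_chain) (use s d in \<open>auto intro!: has_field_derivative_subset[OF f] derivative_eq_intros\<close>)
    then show "((\<lambda>s. f (t - s)) has_real_derivative - f' (t - s)) (at s within {0..d})"
      by (simp add: o_def)
  qed
  define h where "h s = g (t + s) - g (t - s) - 2 * s * g1 t" for s
  define h1 where "h1 s = g1 (t + s) + g1 (t - s) - 2 * g1 t" for s
  define h2 where "h2 s = g2 (t + s) - g2 (t - s)" for s
  have h: "(h has_real_derivative h1 s) (at s within {0..d})" if "s \<in> {0..d}" for s
    unfolding h_def h1_def using shift[OF g(1) that] by (auto intro!: derivative_eq_intros)
  have h1: "(h1 has_real_derivative h2 s) (at s within {0..d})" if "s \<in> {0..d}" for s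
    unfolding h1_def h2_def using shift[OF g(2) that] by (auto intro!: derivative_eq_intros)
  have G0: "0 \<le> G" using G[of t] d by auto
  have "norm (h2 s) \<le> 2 * d * G" if "s \<in> {0..d}" for s
  proof -
    have "\<bar>h2 s\<bar> \<le> G * \<bar>(t + s) - (t - s)\<bar>"
      unfolding h2_def by (rule half_line_mean_value[OF g(3) G]) (use that d in auto)
    also have "\<dots> \<le> G * (2 * d)" using that G0 by (intro mult_left_mono) auto
    finally show ?thesis by (simp add: mult.commute)
  qed
  then have h1_le: "norm (h1 s - h1 0) \<le> 2 * d * G * norm (s - 0)" if "s \<in> {0..d}" for s
    by (intro field_differentiable_bound[of "{0..d}" h1 h2] h1) (use that d in auto)
  have "norm (h1 s) \<le> 2 * d * G * d" if "s \<in> {0..d}" for s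
  proof -
    have "norm (h1 s) \<le> 2 * d * G * s" using h1_le[OF that] that by (simp add: h1_def)
    also have "\<dots> \<le> 2 * d * G * d" using that G0 d by (intro mult_left_mono) auto
    finally show ?thesis .
  qed
  then have "norm (h d - h 0) \<le> 2 * d * G * d * norm (d - 0)"
    by (intro field_differentiable_bound[of "{0..d}" h h1] h) (use d in auto)
  then show ?thesis using d by (simp add: h_def power3_eq_cube mult_ac)
qed

section \<open>Stability of the leap-frog scheme\<close>

text \<open>The skew-symmetric part of \<open>D (u * f)\<close>; the remainder \<open>D u * f / 2\<close> does not differentiate \<open>f\<close>.\<close>

definition transport :: "(real \<Rightarrow> real) \<Rightarrow> (real \<Rightarrow> real) \<Rightarrow> (real \<Rightarrow> real) \<Rightarrow> real" where
  "transport u f g = (Itg (D (u * f) * g) + Itg (u * D f * g)) / 2"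

definition skew_form :: "(real \<Rightarrow> real) \<Rightarrow> (real \<Rightarrow> real) \<Rightarrow> (real \<Rightarrow> real) \<Rightarrow> real" where
  "skew_form u f g = Itg ((D ^^ 3) f * g) - Itg ((D ^^ 5) f * g) + transport u f g"

text \<open>Integration by parts takes each half to minus the other half with \<open>f\<close> and
  \<open>g\<close> exchanged.\<close>

lemma transport_skew:
  assumes [simp]: "u \<in> trig_poly" "f \<in> trig_poly" "g \<in> trig_poly"
  shows "transport u f g = - transport u g f"
proof -
  have "Itg (D (u * f) * g) = - Itg (u * D g * f)" if [simp]: "f \<in> trig_poly" "g \<in> trig_poly" for f g
    using Itg_by_parts[of "u * f" g] by (simp only: trig_poly_mult assms that) (simp add: mult_ac)
  from this[of f g] this[of g f] show ?thesis unfolding transport_def add_divide_distrib by (simp del: D_mult)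
qed

lemma skew_form_skew:
  assumes [simp]: "u \<in> trig_poly" "f \<in> trig_poly" "g \<in> trig_poly"
  shows "skew_form u f g = - skew_form u g f"
  unfolding skew_form_def
  using transport_skew[OF assms] Itg_by_parts_pow[of f g 3] Itg_by_parts_pow[of f g 5]
  by (simp add: mult.commute del: funpow.simps)

text \<open>In the first half the derivative is moved onto \<open>g\<close>, so that only the
  supremum of \<open>u\<close> is needed and not that of \<open>D u\<close>.\<close>

lemma transport_bound:
  assumes u: "u \<in> trig_poly" and f: "f \<in> real_trig N" and g: "g \<in> real_trig N"
    and S: "\<And>x. x \<in> {-pi..pi} \<Longrightarrow> \<bar>u x\<bar> \<le> S"
  shows "\<bar>transport u f g\<bar> \<le> S * real N * nrm f * nrm g"
proof -
  have [simp]: "f \<in> trig_poly" "g \<in> trig_poly" "u \<in> trig_poly" using f g u real_trig_trig_poly by auto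
  have S0: "0 \<le> S" using S[of 0] by (smt (verit) atLeastAtMost_iff pi_ge_zero)
  have "\<bar>Itg (D (u * f) * g)\<bar> = \<bar>Itg (u * f * D g)\<bar>"
    by (subst Itg_by_parts) auto
  also have "\<dots> \<le> nrm (u * f) * nrm (D g)" by (rule Cauchy_Schwarz) auto
  also have "\<dots> \<le> (S * nrm f) * (real N * nrm g)"
    using S0 by (intro mult_mono nrm_mult_le S nrm_D_le g) auto
  finally have 1: "\<bar>Itg (D (u * f) * g)\<bar> \<le> S * real N * nrm f * nrm g" by (simp add: mult_ac)
  have "\<bar>Itg (u * D f * g)\<bar> \<le> nrm (u * D f) * nrm g" by (rule Cauchy_Schwarz) auto
  also have "\<dots> \<le> (S * nrm (D f)) * nrm g"
    by (intro mult_right_mono nrm_mult_le S) auto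
  also have "\<dots> \<le> (S * (real N * nrm f)) * nrm g"
    using S0 by (intro mult_right_mono mult_left_mono nrm_D_le f) auto
  finally have 2: "\<bar>Itg (u * D f * g)\<bar> \<le> S * real N * nrm f * nrm g" by (simp add: mult_ac)
  show ?thesis unfolding transport_def add_divide_distrib using 1 2 by linarith
qed

text \<open>The fifth derivative dominates because \<open>N \<ge> 1\<close>; its
  \<open>N ^ 5\<close> is the origin of the step-size condition.\<close>

lemma skew_form_bound:
  assumes u: "u \<in> trig_poly" and f: "f \<in> real_trig N" and g: "g \<in> real_trig N" and N: "1 \<le> N"
    and S: "\<And>x. x \<in> {-pi..pi} \<Longrightarrow> \<bar>u x\<bar> \<le> S"
  shows "\<bar>skew_form u f g\<bar> \<le> (2 + S) * real N ^ 5 * nrm f * nrm g"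
proof -
  have [simp]: "f \<in> trig_poly" "g \<in> trig_poly" "u \<in> trig_poly" using f g u real_trig_trig_poly by auto
  have S0: "0 \<le> S" using S[of 0] by (smt (verit) atLeastAtMost_iff pi_ge_zero)
  have *: "\<bar>Itg ((D ^^ s) f * g)\<bar> \<le> real N ^ 5 * nrm f * nrm g" if "s \<le> 5" for s
  proof -
    have "\<bar>Itg ((D ^^ s) f * g)\<bar> \<le> nrm ((D ^^ s) f) * nrm g" by (rule Cauchy_Schwarz) auto
    also have "\<dots> \<le> (real N ^ s * nrm f) * nrm g" by (intro mult_right_mono nrm_Dpow_le f) auto
    also have "\<dots> \<le> (real N ^ 5 * nrm f) * nrm g"
      using N that by (intro mult_right_mono power_increasing) auto
    finally show ?thesis .
  qed
  have "\<bar>transport u f g\<bar> \<le> S * real N * nrm f * nrm g" by (rule transport_bound[OF u f g S])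
  also have "\<dots> \<le> S * real N ^ 5 * nrm f * nrm g"
    using N S0 self_le_power[of "real N" 5] by (intro mult_right_mono mult_left_mono) auto
  finally have "\<bar>skew_form u f g\<bar> \<le> real N ^ 5 * nrm f * nrm g + real N ^ 5 * nrm f * nrm g + S * real N ^ 5 * nrm f * nrm g"
    unfolding skew_form_def using *[of 3] *[of 5] by linarith
  then show ?thesis by (simp add: algebra_simps)
qed

text \<open>The dispersive terms do not involve \<open>u\<close> and cancel, so changing the
  coefficient \<open>u\<close> costs one derivative and not five.\<close>

lemma skew_form_diff:
  assumes [simp]: "u \<in> trig_poly" "u' \<in> trig_poly" "f \<in> trig_poly" "g \<in> trig_poly"
  shows "skew_form u f g - skew_form u' f g = transport (u - u') f g"
  unfolding skew_form_def transport_def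
  by (simp add: left_diff_distrib add_divide_distrib diff_divide_distrib del: D_mult funpow.simps)

text \<open>The linear part \<open>u * D e + D u * e\<close> is half the sum of
  \<open>D (u * e)\<close> and \<open>u * D e\<close>, plus \<open>D u * e / 2\<close>.\<close>

lemma kawahara_increment:
  assumes [simp]: "u \<in> trig_poly" "e \<in> trig_poly" "\<phi> \<in> trig_poly"
  shows "Itg ((kawahara (u + e) - kawahara u) * \<phi>)
    = skew_form u e \<phi> + Itg (D u * e * \<phi>) / 2 + Itg (e * D e * \<phi>)"
proof -
  have "(kawahara (u + e) - kawahara u) * \<phi>
     = (D ^^ 3) e * \<phi> - (D ^^ 5) e * \<phi> + u * D e * \<phi> + D u * e * \<phi> + e * D e * \<phi>"
    by (simp add: kawahara_def Dpow_add algebra_simps del: funpow.simps)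
  moreover have "D (u * e) * \<phi> = D u * e * \<phi> + u * D e * \<phi>"
    by (simp add: distrib_right)
  ultimately show ?thesis
    unfolding skew_form_def transport_def by (simp add: add_divide_distrib del: funpow.simps D_mult)
qed

text \<open>Skew-symmetry turns \<open>skew_form u b a\<close> into \<open>- skew_form u a b\<close>, so the stiff terms telescope up to the
  change of \<open>u\<close> over one step. That change gains a factor \<open>\<Delta>\<close>, which pays for the one derivative in
  \<open>transport\<close> because \<open>N * \<Delta> \<le> 1\<close>.\<close>

lemma leapfrog_energy_step:
  fixes a b c u u' \<tau> :: "real \<Rightarrow> real" and \<Delta> :: real
  defines "\<phi> \<equiv> c + a"
  assumes N: "1 \<le> N" and abc: "a \<in> real_trig N" "b \<in> real_trig N" "c \<in> real_trig N"
    and u: "u \<in> trig_poly" "u' \<in> trig_poly" "\<tau> \<in> trig_poly" and \<Delta>: "0 < \<Delta>" "real N * \<Delta> \<le> 1"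
    and eq: "Itg ((c - a) * \<phi>) + 2 * \<Delta> * Itg ((kawahara (u + b) - kawahara u) * \<phi>) + Itg (\<tau> * \<phi>) = 0"
    and Du: "\<And>x. x \<in> {-pi..pi} \<Longrightarrow> \<bar>D u x\<bar> \<le> G"
    and uu': "\<And>x. x \<in> {-pi..pi} \<Longrightarrow> \<bar>(u - u') x\<bar> \<le> G * \<Delta>"
    and b: "\<And>x. x \<in> {-pi..pi} \<Longrightarrow> \<bar>b x\<bar> \<le> 1 / real N"
    and \<tau>: "nrm \<tau> \<le> R * \<Delta> ^ 3"
  shows "((nrm c)\<^sup>2 + (nrm b)\<^sup>2 + 2 * \<Delta> * skew_form u b c) - ((nrm b)\<^sup>2 + (nrm a)\<^sup>2 + 2 * \<Delta> * skew_form u' a b)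
    \<le> (3 * G + 3) * \<Delta> * ((nrm a)\<^sup>2 + (nrm b)\<^sup>2 + (nrm c)\<^sup>2) + R\<^sup>2 * \<Delta> ^ 5"
proof -
  have [simp]: "a \<in> trig_poly" "b \<in> trig_poly" "c \<in> trig_poly" "u \<in> trig_poly" "u' \<in> trig_poly" "\<tau> \<in> trig_poly"
    using abc u real_trig_trig_poly by auto
  have [simp]: "\<phi> \<in> trig_poly" by (simp add: \<phi>_def)
  have G0: "0 \<le> G" using Du[of 0] by (smt (verit) atLeastAtMost_iff pi_ge_zero)
  define x y z where "x = nrm a" and "y = nrm b" and "z = nrm c"
  have pos: "0 \<le> x" "0 \<le> y" "0 \<le> z" by (auto simp: x_def y_def z_def)
  have \<phi>_le: "nrm \<phi> \<le> x + z"
    using nrm_triangle[of c a] by (simp add: \<phi>_def x_def z_def)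
  \<comment> \<open>The test function \<open>c + a\<close> gives a difference of squares;
    \<open>y\<^sup>2\<close> is later added at both levels to complete the energies.\<close>
  have e1: "Itg ((c - a) * \<phi>) = z\<^sup>2 - x\<^sup>2"
    by (simp add: \<phi>_def x_def z_def nrm_square left_diff_distrib distrib_left mult.commute[of a c])
  have e2: "skew_form u b \<phi> = skew_form u b c - skew_form u a b"
    using skew_form_skew[of u b a]
    by (simp add: \<phi>_def skew_form_def transport_def distrib_left add_divide_distrib del: D_mult funpow.simps)
  have e3: "skew_form u a b - skew_form u' a b = transport (u - u') a b"
    by (rule skew_form_diff) auto
  define r where "r = Itg (D u * b * \<phi>) / 2 + Itg (b * D b * \<phi>)"
  have "z\<^sup>2 - x\<^sup>2 + 2 * \<Delta> * (skew_form u b c - skew_form u a b + r) + Itg (\<tau> * \<phi>) = 0"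
    using eq unfolding e1 e2[symmetric] r_def by (simp add: kawahara_increment add.assoc)
  then have key: "(z\<^sup>2 + y\<^sup>2 + 2 * \<Delta> * skew_form u b c) - (y\<^sup>2 + x\<^sup>2 + 2 * \<Delta> * skew_form u' a b)
     = 2 * \<Delta> * transport (u - u') a b - 2 * \<Delta> * r - Itg (\<tau> * \<phi>)"
    unfolding e3[symmetric] by (simp add: algebra_simps)
  have t1: "2 * \<Delta> * transport (u - u') a b \<le> \<Delta> * (G * (x\<^sup>2 + y\<^sup>2))"
  proof -
    have "transport (u - u') a b \<le> G * \<Delta> * real N * x * y"
      unfolding x_def y_def using transport_bound[OF _ abc(1,2) uu'] by (simp add: abs_le_iff)
    also have "\<dots> = (real N * \<Delta>) * (G * (x * y))" by (simp add: mult_ac)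
    also have "\<dots> \<le> 1 * (G * (x * y))" using \<Delta>(2) G0 pos by (intro mult_right_mono) auto
    finally have "2 * transport (u - u') a b \<le> G * (2 * x * y)" by simp
    also have "\<dots> \<le> G * (x\<^sup>2 + y\<^sup>2)" using G0 sum_squares_bound[of x y] by (intro mult_left_mono) auto
    finally show ?thesis using \<Delta>(1) by (simp add: mult.left_commute mult.assoc)
  qed
  have t2: "- (2 * \<Delta> * r) \<le> \<Delta> * ((G + 1) * (2 * y\<^sup>2 + x\<^sup>2 + z\<^sup>2))"
  proof -
    have "\<bar>Itg (D u * b * \<phi>)\<bar> \<le> nrm (D u * b) * nrm \<phi>" by (rule Cauchy_Schwarz) auto
    also have "\<dots> \<le> (G * y) * (x + z)" unfolding y_def
      by (intro mult_mono nrm_mult_le Du \<phi>_le) (use G0 pos in \<open>auto simp: x_def z_def\<close>)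
    finally have r1: "\<bar>Itg (D u * b * \<phi>)\<bar> \<le> G * (y * (x + z))" by (simp add: mult.assoc)
    \<comment> \<open>The bound \<open>1 / N\<close> for \<open>b\<close> pays exactly for the
      inverse inequality on \<open>D b\<close>: the quadratic term now acts like a bounded linear
      one.\<close>
    have nb: "nrm (b * D b) \<le> y"
    proof -
      have "nrm (b * D b) \<le> 1 / real N * nrm (D b)" by (intro nrm_mult_le b) auto
      also have "\<dots> \<le> 1 / real N * (real N * nrm b)" using abc N by (intro mult_left_mono nrm_D_le) auto
      finally show ?thesis using N by (simp add: y_def)
    qed
    have "\<bar>Itg (b * D b * \<phi>)\<bar> \<le> nrm (b * D b) * nrm \<phi>" by (rule Cauchy_Schwarz) auto
    also have "\<dots> \<le> y * (x + z)" by (intro mult_mono nb \<phi>_le) (use pos in auto)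
    finally have r2: "\<bar>Itg (b * D b * \<phi>)\<bar> \<le> y * (x + z)" .
    have "- r \<le> G * (y * (x + z)) + y * (x + z)"
      unfolding r_def using r1 r2 G0 pos by (simp add: abs_le_iff)
    also have "\<dots> = (G + 1) * (y * x + y * z)" by (simp add: algebra_simps)
    finally have "2 * (- r) \<le> (G + 1) * (2 * y * x + 2 * y * z)" by (simp add: algebra_simps)
    also have "\<dots> \<le> (G + 1) * (2 * y\<^sup>2 + x\<^sup>2 + z\<^sup>2)"
      using G0 sum_squares_bound[of y x] sum_squares_bound[of y z] by (intro mult_left_mono) auto
    finally have "\<Delta> * (2 * (- r)) \<le> \<Delta> * ((G + 1) * (2 * y\<^sup>2 + x\<^sup>2 + z\<^sup>2))"
      using \<Delta>(1) by (intro mult_left_mono) auto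
    then show ?thesis by (simp add: mult_ac)
  qed
  have t3: "- Itg (\<tau> * \<phi>) \<le> \<Delta> * (x\<^sup>2 + z\<^sup>2) + R\<^sup>2 * \<Delta> ^ 5"
  proof -
    have R0: "0 \<le> R * \<Delta> ^ 3" by (rule order_trans[OF nrm_nonneg \<tau>]) simp
    have "- Itg (\<tau> * \<phi>) \<le> nrm \<tau> * nrm \<phi>" using Cauchy_Schwarz[of \<tau> \<phi>] by simp
    also have "\<dots> \<le> (R * \<Delta> ^ 3) * (x + z)" by (intro mult_mono \<tau> \<phi>_le) (use R0 in auto)
    \<comment> \<open>One factor \<Delta> is set aside for Gronwall's inequality before the rest is
      split by Young's inequality.\<close>
    also have "\<dots> = \<Delta> * (R * \<Delta>\<^sup>2 * x + R * \<Delta>\<^sup>2 * z)" by (simp add: power2_eq_square power3_eq_cube algebra_simps)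
    also have "\<dots> \<le> \<Delta> * (x\<^sup>2 + z\<^sup>2 + (R * \<Delta>\<^sup>2)\<^sup>2)"
    proof (intro mult_left_mono)
      show "R * \<Delta>\<^sup>2 * x + R * \<Delta>\<^sup>2 * z \<le> x\<^sup>2 + z\<^sup>2 + (R * \<Delta>\<^sup>2)\<^sup>2"
        using sum_squares_bound[of "R * \<Delta>\<^sup>2" x] sum_squares_bound[of "R * \<Delta>\<^sup>2" z] zero_le_power2[of x] zero_le_power2[of z]
        by linarith
    qed (use \<Delta> in auto)
    also have "\<dots> = \<Delta> * (x\<^sup>2 + z\<^sup>2) + R\<^sup>2 * \<Delta> ^ 5" by (simp add: algebra_simps power_mult_distrib eval_nat_numeral)
    finally show ?thesis .
  qed
  have "\<Delta> * (G * (x\<^sup>2 + y\<^sup>2)) + \<Delta> * ((G + 1) * (2 * y\<^sup>2 + x\<^sup>2 + z\<^sup>2)) + \<Delta> * (x\<^sup>2 + z\<^sup>2)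
     = \<Delta> * (G * (x\<^sup>2 + y\<^sup>2) + (G + 1) * (2 * y\<^sup>2 + x\<^sup>2 + z\<^sup>2) + (x\<^sup>2 + z\<^sup>2))"
    by (simp add: algebra_simps)
  \<comment> \<open>The coefficients of \<open>x\<^sup>2\<close>, \<open>y\<^sup>2\<close>,
    \<open>z\<^sup>2\<close> are \<open>2 * G + 2\<close>, \<open>3 * G + 2\<close> and
    \<open>G + 2\<close>.\<close>
  also have "\<dots> \<le> \<Delta> * ((3 * G + 3) * (x\<^sup>2 + y\<^sup>2 + z\<^sup>2))"
  proof (intro mult_left_mono)
    have "0 \<le> G * x\<^sup>2" "0 \<le> G * y\<^sup>2" "0 \<le> G * z\<^sup>2" using G0 by auto
    then show "G * (x\<^sup>2 + y\<^sup>2) + (G + 1) * (2 * y\<^sup>2 + x\<^sup>2 + z\<^sup>2) + (x\<^sup>2 + z\<^sup>2) \<le> (3 * G + 3) * (x\<^sup>2 + y\<^sup>2 + z\<^sup>2)"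
      using zero_le_power2[of x] zero_le_power2[of y] zero_le_power2[of z]
      unfolding distrib_left distrib_right mult.assoc mult_1 mult_2[symmetric] by linarith
  qed (use \<Delta> in auto)
  finally show ?thesis
    using key t1 t2 t3 unfolding x_def y_def z_def by (simp add: mult_ac)
qed

text \<open>About \<open>u\<close> only bounds are assumed; its equation enters through
  \<open>eq\<close>. \<open>K\<close> depends on \<open>G\<close>, \<open>R\<close>,
  \<open>T\<close> and \<open>c0\<close> alone, since the recursion for \<open>Q\<close> uses just
  the fixed threshold \<open>1 / N\<close> for the error; \<open>c\<close> is taken small in terms
  of \<open>K\<close> afterwards, so the argument is not circular.\<close>

lemma leapfrog_stability:
  fixes e u \<tau> :: "nat \<Rightarrow> real \<Rightarrow> real" and \<Delta> G R K c c0 T :: real and N M :: nat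
  defines "A \<equiv> 3 * G + 3"
  assumes N: "1 \<le> N" and \<Delta>: "0 < \<Delta>" "real M * \<Delta> \<le> T" and M: "1 \<le> M"
    and e: "\<And>m. m \<le> M \<Longrightarrow> e m \<in> real_trig N"
    and u: "\<And>m. m \<le> M \<Longrightarrow> u m \<in> trig_poly" "\<And>m. m \<le> M \<Longrightarrow> \<tau> m \<in> trig_poly"
    and G: "0 \<le> G" "\<And>m x. m \<le> M \<Longrightarrow> x \<in> {-pi..pi} \<Longrightarrow> \<bar>u m x\<bar> \<le> G"
      "\<And>m x. m \<le> M \<Longrightarrow> x \<in> {-pi..pi} \<Longrightarrow> \<bar>D (u m) x\<bar> \<le> G"
      "\<And>m x. Suc m \<le> M \<Longrightarrow> x \<in> {-pi..pi} \<Longrightarrow> \<bar>(u (Suc m) - u m) x\<bar> \<le> G * \<Delta>"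
    and eq: "\<And>m \<phi>. Suc (Suc m) \<le> M \<Longrightarrow> \<phi> \<in> real_trig N \<Longrightarrow>
      Itg ((e (Suc (Suc m)) - e m) * \<phi>) + 2 * \<Delta> * Itg ((kawahara (u (Suc m) + e (Suc m)) - kawahara (u (Suc m))) * \<phi>)
        + Itg (\<tau> (Suc m) * \<phi>) = 0"
    and \<tau>: "\<And>m. Suc (Suc m) \<le> M \<Longrightarrow> nrm (\<tau> (Suc m)) \<le> R * \<Delta> ^ 3"
    and e0: "e 0 = 0" and e1: "nrm (e 1) \<le> c0 * \<Delta>\<^sup>2"
    and K: "0 \<le> K" "K\<^sup>2 = exp (8 * A * T) * (4 * c0\<^sup>2 + 4 * T * R\<^sup>2)"
    and c: "real N ^ 5 * \<Delta> \<le> c" "c \<le> 1" "2 * (2 + G) * c \<le> 1" "4 * A * c \<le> 1" "4 * K * c \<le> 1"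
    and m: "m \<le> M"
  shows "nrm (e m) \<le> K * \<Delta>\<^sup>2"
proof -
  have A0: "0 \<le> A" using G by (simp add: A_def)
  have etp: "e m \<in> trig_poly" if "m \<le> M" for m using e[OF that] real_trig_trig_poly by blast
  have Npow: "real N ^ k \<le> real N ^ 5" if "k \<le> 5" for k using N that by (intro power_increasing) auto
  have Nk: "real N ^ k * \<Delta> \<le> c" if "k \<le> 5" for k
    using mult_right_mono[OF Npow[OF that], of \<Delta>] c(1) \<Delta>(1) by linarith
  have \<Delta>c: "\<Delta> \<le> c" "real N * \<Delta> \<le> c"
    using Nk[of 0] Nk[of 1] by auto
  define Q where "Q m = (nrm (e (Suc m)))\<^sup>2 + (nrm (e m))\<^sup>2 + 2 * \<Delta> * skew_form (u m) (e m) (e (Suc m))" for m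
  \<comment> \<open>The condition \<open>2 * (2 + G) * c \<le> 1\<close> keeps the cross term below
    half of the squares, whence \<open>Q\<close> is comparable to them.\<close>
  have Qb: "\<bar>2 * \<Delta> * skew_form (u m) (e m) (e (Suc m))\<bar> \<le> ((nrm (e (Suc m)))\<^sup>2 + (nrm (e m))\<^sup>2) / 2" if m: "Suc m \<le> M" for m
  proof -
    let ?x = "nrm (e m)" and ?y = "nrm (e (Suc m))"
    have xy: "0 \<le> ?x * ?y" using etp m by simp
    have "\<bar>2 * \<Delta> * skew_form (u m) (e m) (e (Suc m))\<bar> \<le> 2 * \<Delta> * ((2 + G) * real N ^ 5 * ?x * ?y)"
      unfolding abs_mult using \<Delta>(1) m
      by (intro mult_mono skew_form_bound e u N G) auto
    also have "\<dots> = 2 * (2 + G) * (real N ^ 5 * \<Delta>) * (?x * ?y)" by (simp add: mult_ac)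
    also have "\<dots> \<le> 2 * (2 + G) * c * (?x * ?y)"
      using c(1) G(1) xy by (intro mult_right_mono mult_left_mono) auto
    also have "\<dots> \<le> 1 * (?x * ?y)" using c(3) xy by (rule mult_right_mono)
    also have "\<dots> \<le> (?y\<^sup>2 + ?x\<^sup>2) / 2" using sum_squares_bound[of ?x ?y] by simp
    finally show ?thesis .
  qed
  have Qlow: "(nrm (e (Suc m)))\<^sup>2 + (nrm (e m))\<^sup>2 \<le> 2 * Q m" if m: "Suc m \<le> M" for m
    using Qb[OF m] unfolding Q_def by (simp add: abs_le_iff)
  have Qpos: "0 \<le> Q m" if m: "Suc m \<le> M" for m
    using Qlow[OF m] zero_le_power2[of "nrm (e m)"] zero_le_power2[of "nrm (e (Suc m))"] by linarith
  have Q0: "Q 0 \<le> 2 * c0\<^sup>2 * \<Delta> ^ 4"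
  proof -
    have "Q 0 \<le> 2 * (nrm (e 1))\<^sup>2"
      using Qb[of 0] M zero_le_power2[of "nrm (e 1)"] unfolding Q_def by (simp add: e0 abs_le_iff)
    also have "\<dots> \<le> 2 * (c0 * \<Delta>\<^sup>2)\<^sup>2"
      using e1 etp[of 1] M by (intro mult_left_mono power_mono) auto
    finally show ?thesis by (simp add: power_mult_distrib)
  qed
  define \<epsilon> where "\<epsilon> = R\<^sup>2 * \<Delta> ^ 5"
  have \<epsilon>0: "0 \<le> \<epsilon>" using \<Delta>(1) by (simp add: \<epsilon>_def)
  \<comment> \<open>The energy step gives
    \<open>(1 - y / 4) * Q (Suc m) \<le> (1 + y / 4) * Q m + \<epsilon>\<close>, and for
    \<open>y \<le> 2\<close> the quotient of the two factors is at most
    \<open>1 + y\<close>.\<close>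
  define y where "y = 8 * A * \<Delta>"
  have y0: "0 \<le> y" using A0 \<Delta>(1) by (simp add: y_def)
  have small: "nrm (e (Suc m)) \<le> K * \<Delta>\<^sup>2" if m: "Suc m \<le> M" and Qm: "Q m \<le> exp (y * real m) * (Q 0 + 2 * real m * \<epsilon>)" for m
  proof -
    have mT: "real m * \<Delta> \<le> T"
    proof -
      have "real m * \<Delta> \<le> real M * \<Delta>" using m \<Delta>(1) by (intro mult_right_mono) auto
      then show ?thesis using \<Delta>(2) by linarith
    qed
    have "(nrm (e (Suc m)))\<^sup>2 \<le> 2 * Q m" using Qlow[OF m] zero_le_power2[of "nrm (e m)"] by linarith
    also have "\<dots> \<le> 2 * (exp (y * real m) * (Q 0 + 2 * real m * \<epsilon>))" using Qm by simp
    also have "\<dots> \<le> 2 * (exp (8 * A * T) * (2 * c0\<^sup>2 * \<Delta> ^ 4 + 2 * (T * R\<^sup>2 * \<Delta> ^ 4)))"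
    proof (rule mult_left_mono[OF mult_mono[OF _ add_mono]])
      have "y * real m = 8 * A * (real m * \<Delta>)" by (simp add: y_def mult_ac)
      also have "\<dots> \<le> 8 * A * T" using mT A0 by (intro mult_left_mono) auto
      finally show "exp (y * real m) \<le> exp (8 * A * T)" by simp
      \<comment> \<open>One of the five factors \<Delta> in \<epsilon> pays for the number of steps;
        the four that remain match the square of \<open>\<Delta>\<^sup>2\<close>.\<close>
      have "real m * \<epsilon> = (real m * \<Delta>) * (R\<^sup>2 * \<Delta> ^ 4)" by (simp add: \<epsilon>_def eval_nat_numeral)
      also have "\<dots> \<le> T * (R\<^sup>2 * \<Delta> ^ 4)" using mT by (intro mult_right_mono) auto
      finally show "2 * real m * \<epsilon> \<le> 2 * (T * R\<^sup>2 * \<Delta> ^ 4)" by (simp add: mult.assoc)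
      show "0 \<le> Q 0 + 2 * real m * \<epsilon>" 
        using Qpos[of 0] M \<epsilon>0 by simp
    qed (use Q0 in auto)
    also have "\<dots> = K\<^sup>2 * \<Delta> ^ 4" by (simp add: K algebra_simps)
    also have "\<dots> = (K * \<Delta>\<^sup>2)\<^sup>2" by (simp add: power_mult_distrib)
    finally show ?thesis by (rule power2_le_imp_le) (use K in simp)
  qed
  have Qm: "Q m \<le> exp (y * real m) * (Q 0 + 2 * real m * \<epsilon>)" if "Suc m \<le> M" for m
    using that
  proof (induction m)
    case (Suc m)
    then have IH: "Q m \<le> exp (y * real m) * (Q 0 + 2 * real m * \<epsilon>)" and m: "Suc m \<le> M" by auto
    have b: "nrm (e (Suc m)) \<le> K * \<Delta>\<^sup>2" by (rule small[OF m IH])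
    let ?b = "e (Suc m)"
    \<comment> \<open>The Sobolev and inverse inequalities give
      \<open>N * |b| \<le> 4 * K * (N * \<Delta>)\<^sup>2\<close>. One factor
      \<open>N * \<Delta>\<close> is bounded by \<open>c\<close>, the other by \<open>1\<close>, and
      \<open>4 * K * c \<le> 1\<close>.\<close>
    have bsup: "\<bar>?b x\<bar> \<le> 1 / real N" if x: "x \<in> {-pi..pi}" for x
    proof -
      have "\<bar>?b x\<bar> \<le> 2 * (nrm ?b + nrm (D ?b))" using etp m x by (intro Sobolev) auto
      also have "\<dots> \<le> 2 * (real N * nrm ?b + real N * nrm ?b)"
        using N etp[OF m] mult_right_mono[of 1 "real N" "nrm ?b"] by (intro mult_left_mono add_mono nrm_D_le e m) auto
      also have "\<dots> = 4 * real N * nrm ?b" by simp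
      also have "\<dots> \<le> 4 * real N * (K * \<Delta>\<^sup>2)" using b by (intro mult_left_mono) auto
      finally have "real N * \<bar>?b x\<bar> \<le> real N * (4 * real N * (K * \<Delta>\<^sup>2))" by (intro mult_left_mono) auto
      also have "\<dots> = 4 * K * ((real N * \<Delta>) * (real N * \<Delta>))" by (simp add: power2_eq_square mult_ac)
      also have "\<dots> \<le> 4 * K * (c * 1)"
        using \<Delta>c c(2) K(1) \<Delta>(1) by (intro mult_left_mono mult_mono) auto
      also have "\<dots> \<le> 1" using c(5) by simp
      finally show ?thesis using N by (simp add: field_simps)
    qed
    have "Q (Suc m) - Q m \<le> A * \<Delta> * ((nrm (e m))\<^sup>2 + (nrm ?b)\<^sup>2 + (nrm (e (Suc (Suc m))))\<^sup>2) + \<epsilon>"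
      unfolding Q_def A_def \<epsilon>_def
    proof (rule leapfrog_energy_step[where \<tau> = "\<tau> (Suc m)"])
      show "real N * \<Delta> \<le> 1" using \<Delta>c c by simp
      show "Itg ((e (Suc (Suc m)) - e m) * (e (Suc (Suc m)) + e m)) +
        2 * \<Delta> * Itg ((kawahara (u (Suc m) + e (Suc m)) - kawahara (u (Suc m))) * (e (Suc (Suc m)) + e m)) +
        Itg (\<tau> (Suc m) * (e (Suc (Suc m)) + e m)) = 0"
        using Suc.prems by (intro eq real_trig_add e) auto
    qed (use Suc.prems N e u \<Delta> G \<tau> bsup in auto)
    also have "\<dots> \<le> A * \<Delta> * (2 * Q m + 2 * Q (Suc m)) + \<epsilon>"
    proof (intro add_right_mono mult_left_mono)
      show "(nrm (e m))\<^sup>2 + (nrm ?b)\<^sup>2 + (nrm (e (Suc (Suc m))))\<^sup>2 \<le> 2 * Q m + 2 * Q (Suc m)"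
        using Qlow[OF m] Qlow[OF Suc.prems] zero_le_power2[of "nrm ?b"] by linarith
    qed (use A0 \<Delta>(1) in auto)
    finally have rec: "(1 - y / 4) * Q (Suc m) \<le> (1 + y / 4) * Q m + \<epsilon>"
      by (simp add: y_def algebra_simps)
    have Qm0: "0 \<le> Q m" "0 \<le> Q (Suc m)"
      using Qpos[OF m] Qpos[OF Suc.prems] .
    have y2: "y \<le> 2"
    proof -
      have "4 * A * \<Delta> \<le> 4 * A * c" using \<Delta>c A0 by (intro mult_left_mono) auto
      then show ?thesis using c by (simp add: y_def)
    qed
    \<comment> \<open>Multiplication by \<open>1 + y / 2\<close> replaces division by
      \<open>1 - y / 4\<close>.\<close>
    have "1 * Q (Suc m) \<le> ((1 + y / 2) * (1 - y / 4)) * Q (Suc m)"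
    proof (rule mult_right_mono)
      have "y * y \<le> 2 * y" using y2 y0 by (rule mult_right_mono)
      then show "1 \<le> (1 + y / 2) * (1 - y / 4)" by (simp add: algebra_simps)
    qed (rule Qm0)
    also have "\<dots> = (1 + y / 2) * ((1 - y / 4) * Q (Suc m))" by (simp only: mult.assoc)
    also have "\<dots> \<le> (1 + y / 2) * ((1 + y / 4) * Q m + \<epsilon>)"
      using rec y0 by (intro mult_left_mono) auto
    also have "\<dots> = ((1 + y / 2) * (1 + y / 4)) * Q m + (1 + y / 2) * \<epsilon>"
      by (simp only: distrib_left[of "1 + y / 2" _ \<epsilon>] mult.assoc)
    also have "\<dots> \<le> (1 + y) * Q m + 2 * \<epsilon>"
    proof (intro add_mono mult_right_mono)
      have "y * y \<le> 2 * y" using y2 y0 by (rule mult_right_mono)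
      then show "(1 + y / 2) * (1 + y / 4) \<le> 1 + y" by (simp add: algebra_simps)
    qed (use y2 Qm0 \<epsilon>0 in auto)
    also have "\<dots> \<le> exp y * (exp (y * real m) * (Q 0 + 2 * real m * \<epsilon>)) + exp (y * real (Suc m)) * (2 * \<epsilon>)"
    proof (rule add_mono[OF mult_mono[OF _ IH]])
      have "1 * (2 * \<epsilon>) \<le> exp (y * real (Suc m)) * (2 * \<epsilon>)" using y0 \<epsilon>0 by (intro mult_right_mono) auto
      then show "2 * \<epsilon> \<le> exp (y * real (Suc m)) * (2 * \<epsilon>)" by simp
    qed (use Qm0 y0 in auto)
    also have "\<dots> = exp (y * real (Suc m)) * (Q 0 + 2 * real (Suc m) * \<epsilon>)"
      by (simp add: algebra_simps exp_add)
    finally show ?case by simp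
  qed simp
  show ?thesis
  proof (cases m)
    case 0
    then show ?thesis using e0 K by simp
  next
    case (Suc k)
    then show ?thesis using small[OF _ Qm, of k] m by simp
  qed
qed

section \<open>Passing between complex and real trigonometric polynomials\<close>

definition fexp :: "int \<Rightarrow> real \<Rightarrow> complex" where
  "fexp k x = exp (\<i> * of_int k * of_real x)"

lemma fexp_cis: "fexp k x = cis (of_int k * x)"
  by (simp add: fexp_def cis_conv_exp mult.assoc)

lemma trig_space_iff:
  "f \<in> trig_space N \<longleftrightarrow> (\<exists>c. f = (\<lambda>x. \<Sum>k\<in>{- int N..int N}. c k * fexp k x))"
  by (simp add: trig_space_def fexp_def)

lemma continuous_on_fexp [continuous_intros]: "continuous_on S (fexp k)"
  unfolding fexp_def by (intro continuous_intros)

lemma fexp_mult_cnj: "fexp k x * cnj (fexp l x) = fexp (k - l) x"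
  unfolding fexp_cis by (simp add: cis_mult cis_cnj left_diff_distrib)

lemma continuous_imp_set_integrable:
  fixes f :: "real \<Rightarrow> 'a::euclidean_space"
  assumes "continuous_on {a..b} f" shows "set_integrable lebesgue {a..b} f"
  using absolutely_integrable_continuous[of a b f] assms by simp

lemma set_integral_trig_poly:
  assumes "f \<in> trig_poly" shows "(LINT x:{-pi..pi}|lebesgue. of_real (f x)) = complex_of_real (Itg f)"
proof -
  have "set_integrable lebesgue {-pi..pi} f"
    using assms by (intro continuous_imp_set_integrable trig_poly_continuous)
  then show ?thesis
    by (simp add: set_integral_complex_of_real set_lebesgue_integral_eq_integral Itg_def)
qed

lemma l2_inner_of_real:
  assumes "f \<in> trig_poly" "g \<in> trig_poly"
  shows "l2_inner (\<lambda>x. of_real (f x)) (\<lambda>x. of_real (g x)) = of_real (Itg (f * g))"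
  using set_integral_trig_poly[of "f * g"] assms by (simp add: l2_inner_def fun_app)

lemma l2_norm_of_real: "f \<in> trig_poly \<Longrightarrow> l2_norm (\<lambda>x. of_real (f x)) = nrm f"
  by (simp add: l2_norm_def l2_inner_of_real nrm_def)

lemma set_integral_fexp: "(LINT x:{-pi..pi}|lebesgue. fexp k x) = (if k = 0 then 2 * of_real pi else 0)"
proof -
  let ?c = "cst (1/2) * (cas k + cas (- k))" and ?s = "cst (1/2) * (cas k - cas (- k))"
  have *: "fexp k x = of_real (?c x) + \<i> * of_real (?s x)" for x
    unfolding fexp_cis using fun_cong[OF cos_sin_cas(1)[of k], of x] fun_cong[OF cos_sin_cas(2)[of k], of x]
    by (simp add: cis.ctr complex_eq_iff)
  have "(LINT x:{-pi..pi}|lebesgue. of_real (?c x) + \<i> * of_real (?s x))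
     = complex_of_real (Itg ?c) + \<i> * of_real (Itg ?s)"
    by (subst set_integral_add)
       (auto intro!: continuous_imp_set_integrable continuous_intros trig_poly_continuous set_integrable_mult_right simp: set_integral_trig_poly)
  then show ?thesis unfolding * by (simp add: Itg_cas)
qed

lemma set_integral_sum:
  fixes F :: "'i \<Rightarrow> real \<Rightarrow> complex"
  assumes "\<And>i. i \<in> A \<Longrightarrow> set_integrable M S (F i)"
  shows "(LINT x:S|M. (\<Sum>i\<in>A. F i x)) = (\<Sum>i\<in>A. LINT x:S|M. F i x)"
  using assms unfolding set_lebesgue_integral_def set_integrable_def
  by (simp add: scaleR_sum_right Bochner_Integration.integral_sum)

lemma l2_inner_trig_right:
  assumes "\<And>k. set_integrable lebesgue {-pi..pi} (\<lambda>x. f x * cnj (fexp k x))"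
  shows "l2_inner f (\<lambda>x. \<Sum>k\<in>A. c k * fexp k x) = (\<Sum>k\<in>A. cnj (c k) * l2_inner f (fexp k))"
proof -
  have "(\<lambda>x. f x * cnj (\<Sum>k\<in>A. c k * fexp k x)) = (\<lambda>x. \<Sum>k\<in>A. cnj (c k) * (f x * cnj (fexp k x)))"
    by (simp add: sum_distrib_left mult_ac)
  then show ?thesis
    unfolding l2_inner_def using assms by (simp only:) (subst set_integral_sum; simp)
qed

lemma l2_inner_trig_fexp:
  fixes c :: "int \<Rightarrow> complex"
  assumes "\<bar>l\<bar> \<le> int N"
  shows "l2_inner (\<lambda>x. \<Sum>k\<in>{- int N..int N}. c k * fexp k x) (fexp l) = 2 * pi * c l"
proof -
  have "(\<lambda>x. (\<Sum>k\<in>{- int N..int N}. c k * fexp k x) * cnj (fexp l x)) = (\<lambda>x. \<Sum>k\<in>{- int N..int N}. c k * fexp (k - l) x)"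
    by (simp only: sum_distrib_right mult.assoc fexp_mult_cnj)
  then have "l2_inner (\<lambda>x. \<Sum>k\<in>{- int N..int N}. c k * fexp k x) (fexp l)
     = (\<Sum>k\<in>{- int N..int N}. c k * (LINT x:{-pi..pi}|lebesgue. fexp (k - l) x))"
    unfolding l2_inner_def
    by (simp only:) (subst set_integral_sum; auto intro!: continuous_imp_set_integrable continuous_intros)
  also have "\<dots> = (\<Sum>k\<in>{- int N..int N}. if k = l then 2 * pi * c l else 0)"
    unfolding set_integral_fexp by (rule sum.cong) auto
  also have "\<dots> = 2 * pi * c l" using assms by (auto simp: abs_le_iff)
  finally show ?thesis .
qed

text \<open>The real part of \<open>c k * fexp k\<close> contributes
  \<open>(Re (c k) - Im (c k)) / 2\<close> to \<open>cas k\<close> and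
  \<open>(Re (c k) + Im (c k)) / 2\<close> to \<open>cas (- k)\<close>; the contributions of
  \<open>k\<close> and \<open>- k\<close> are collected here.\<close>

definition hartley :: "(int \<Rightarrow> complex) \<Rightarrow> int \<Rightarrow> real" where
  "hartley c k = (Re (c k) - Im (c k) + Re (c (- k)) + Im (c (- k))) / 2"

lemma Re_trig_hartley:
  "Re (\<Sum>k\<in>{- int N..int N}. c k * fexp k x) = (\<Sum>k\<in>{- int N..int N}. cst (hartley c k) * cas k) x"
proof -
  have "Re (\<Sum>k\<in>{- int N..int N}. c k * fexp k x)
     = (\<Sum>k\<in>{- int N..int N}. (Re (c k) - Im (c k)) / 2 * cas k x) + (\<Sum>k\<in>{- int N..int N}. (Re (c k) + Im (c k)) / 2 * cas (- k) x)"
    unfolding sum.distrib[symmetric] Re_sum fexp_cis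
    by (rule sum.cong) (auto simp: cas_def field_simps)
  also have "(\<Sum>k\<in>{- int N..int N}. (Re (c k) + Im (c k)) / 2 * cas (- k) x)
     = (\<Sum>k\<in>{- int N..int N}. (Re (c (- k)) + Im (c (- k))) / 2 * cas k x)"
    by (rule sum.reindex_bij_witness[of _ uminus uminus]) auto
  finally show ?thesis
    unfolding sum_fun_apply fun_app sum.distrib[symmetric] hartley_def
    by (simp only:) (rule sum.cong; simp add: field_simps)
qed

lemma hartley_square: "(hartley c k)\<^sup>2 \<le> (cmod (c k))\<^sup>2 + (cmod (c (- k)))\<^sup>2"
proof -
  define a b p q where "a = Re (c k)" and "b = Im (c k)" and "p = Re (c (- k))" and "q = Im (c (- k))"
  \<comment> \<open>This sum of squares is twice the difference of the two sides below.\<close>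
  have "0 \<le> (a + b)\<^sup>2 + (p - q)\<^sup>2 + ((a - b) - (p + q))\<^sup>2 / 2" by simp
  then have "((a - b + p + q) / 2)\<^sup>2 \<le> a\<^sup>2 + b\<^sup>2 + (p\<^sup>2 + q\<^sup>2)"
    by (simp add: power2_eq_square field_simps)
  then show ?thesis unfolding cmod_power2 hartley_def a_def b_def p_def q_def .
qed

lemma Re_trig_space:
  assumes "f \<in> trig_space N" "real_valued f"
  obtains g where "g \<in> real_trig N" "f = (\<lambda>x. of_real (g x))"
proof -
  obtain c where f: "f = (\<lambda>x. \<Sum>k\<in>{- int N..int N}. c k * fexp k x)"
    using assms(1) by (auto simp: trig_space_iff)
  have "f x = of_real ((\<Sum>k\<in>{- int N..int N}. cst (hartley c k) * cas k) x)" for x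
    unfolding Re_trig_hartley[symmetric] using assms(2) unfolding f real_valued_def
    by (simp add: Re_sum[symmetric] del: Re_sum)
  then show ?thesis using that[of "\<Sum>k\<in>{- int N..int N}. cst (hartley c k) * cas k"] by (auto simp: real_trig_def)
qed

lemma of_real_trig_space:
  assumes "f \<in> real_trig N" shows "(\<lambda>x. of_real (f x)) \<in> trig_space N"
proof -
  obtain a where f: "f = (\<Sum>k\<in>{- int N..int N}. cst (a k) * cas k)"
    using assms by (auto simp: real_trig_def)
  \<comment> \<open>From \<open>cas k = (1 - \<i>) / 2 * fexp k + (1 + \<i>) / 2 * fexp (-
    k)\<close>.\<close>
  let ?c = "\<lambda>k. of_real (a k) * (1 - \<i>) / 2 + of_real (a (- k)) * (1 + \<i>) / 2"
  have "of_real (f x) = (\<Sum>k\<in>{- int N..int N}. ?c k * fexp k x)" for x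
  proof -
    have "complex_of_real (f x) = (\<Sum>k\<in>{- int N..int N}. of_real (a k) * (1 - \<i>) / 2 * fexp k x) + (\<Sum>k\<in>{- int N..int N}. of_real (a k) * (1 + \<i>) / 2 * fexp (- k) x)"
      unfolding f sum_fun_apply fun_app of_real_sum sum.distrib[symmetric] fexp_cis
      by (rule sum.cong) (auto simp: complex_eq_iff cas_def field_simps)
    also have "(\<Sum>k\<in>{- int N..int N}. of_real (a k) * (1 + \<i>) / 2 * fexp (- k) x)
       = (\<Sum>k\<in>{- int N..int N}. of_real (a (- k)) * (1 + \<i>) / 2 * fexp k x)"
      by (rule sum.reindex_bij_witness[of _ uminus uminus]) auto
    finally show ?thesis by (simp only: sum.distrib[symmetric] distrib_right)
  qed
  then show ?thesis by (auto simp: trig_space_iff)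
qed

section \<open>Differential operators and initial datum in the complex setting\<close>

lemma Dx_of_real: "f \<in> trig_poly \<Longrightarrow> Dx (\<lambda>x. of_real (f x)) = (\<lambda>x. of_real (D f x))"
  unfolding Dx_def
  by (intro ext vector_derivative_of_real_left) (metis real_differentiable_def trig_poly_has_deriv)

lemma Dx_pow_of_real: "f \<in> trig_poly \<Longrightarrow> (Dx ^^ s) (\<lambda>x. of_real (f x)) = (\<lambda>x. of_real ((D ^^ s) f x))"
  by (induction s) (auto simp: Dx_of_real)

lemma kawahara_op_of_real: "f \<in> trig_poly \<Longrightarrow> kawahara_op (\<lambda>x. of_real (f x)) = (\<lambda>x. of_real (kawahara f x))"
  unfolding kawahara_op_def kawahara_def
  by (simp add: Dx_pow_of_real Dx_of_real fun_app del: funpow.simps)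

text \<open>On a bounded interval square integrability implies integrability, by
  \<open>|u| \<le> 1 + |u|\<^sup>2\<close>.\<close>

lemma sobolev_set_integrable:
  assumes "u \<in> sobolev_space r"
  shows "set_integrable lebesgue {-pi..pi} (\<lambda>x. u x * cnj (fexp k x))"
proof (rule set_integrable_bound)
  have u: "u \<in> borel_measurable lebesgue" "set_integrable lebesgue {-pi..pi} (\<lambda>x. (cmod (u x))\<^sup>2)"
    using assms by (auto simp: sobolev_space_def)
  show "set_integrable lebesgue {-pi..pi} (\<lambda>x. 1 + (cmod (u x))\<^sup>2)"
    by (intro set_integral_add continuous_imp_set_integrable u continuous_intros)
  have "(\<lambda>x. cnj (fexp k x)) \<in> borel_measurable lebesgue"
    by (rule measurable_completion)
       (simp add: borel_measurable_continuous_onI continuous_on_cnj continuous_on_fexp)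
  then show "set_borel_measurable lebesgue {-pi..pi} (\<lambda>x. u x * cnj (fexp k x))"
    unfolding set_borel_measurable_def using u(1)
    by (intro borel_measurable_scaleR borel_measurable_indicator borel_measurable_times) auto
  have "cmod (u x * cnj (fexp k x)) \<le> 1 + (cmod (u x))\<^sup>2" for x
  proof -
    have "cmod (u x * cnj (fexp k x)) = cmod (u x)" unfolding fexp_cis by (simp add: norm_mult)
    also have "\<dots> \<le> 1 + (cmod (u x))\<^sup>2"
      using sum_squares_bound[of 1 "cmod (u x)"] norm_ge_zero[of "u x"] by (simp del: norm_ge_zero)
    finally show ?thesis .
  qed
  then show "AE x in lebesgue. x \<in> {-pi..pi} \<longrightarrow> norm (u x * cnj (fexp k x)) \<le> norm (1 + (cmod (u x))\<^sup>2)"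
    by (intro always_eventually) (auto intro: order_trans)
qed

lemma l2_inner_fexp_fourier: "l2_inner f (fexp k) = 2 * pi * fourier_coeff f k"
proof -
  have "cnj (fexp k x) = exp (- \<i> * of_int k * of_real x)" for x
    by (simp add: fexp_def exp_cnj)
  then show ?thesis by (simp add: l2_inner_def fourier_coeff_def mult.commute)
qed

text \<open>This evaluates the definite description: testing with each \<open>fexp l\<close> forces
  the coefficients of any candidate.\<close>

lemma trig_proj_fourier:
  assumes u: "u \<in> sobolev_space r"
  shows "trig_proj N u = (\<lambda>x. \<Sum>k\<in>{- int N..int N}. fourier_coeff u k * fexp k x)"
    (is "_ = ?g")
proof -
  have int_diff: "set_integrable lebesgue {-pi..pi} (\<lambda>x. (u x - (\<Sum>k\<in>{- int N..int N}. c k * fexp k x)) * cnj (fexp l x))" for c l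
    unfolding left_diff_distrib
    by (intro set_integral_diff sobolev_set_integrable[OF u] continuous_imp_set_integrable continuous_intros)
  have diff: "l2_inner (\<lambda>x. u x - (\<Sum>k\<in>{- int N..int N}. c k * fexp k x)) (fexp l) = 2 * pi * (fourier_coeff u l - c l)"
    if "\<bar>l\<bar> \<le> int N" for c l
  proof -
    have "l2_inner (\<lambda>x. u x - (\<Sum>k\<in>{- int N..int N}. c k * fexp k x)) (fexp l)
       = l2_inner u (fexp l) - l2_inner (\<lambda>x. \<Sum>k\<in>{- int N..int N}. c k * fexp k x) (fexp l)"
      unfolding l2_inner_def left_diff_distrib
      by (intro set_integral_diff sobolev_set_integrable[OF u] continuous_imp_set_integrable continuous_intros)
    then show ?thesis
      unfolding l2_inner_trig_fexp[OF that] l2_inner_fexp_fourier[of u] by (simp only: right_diff_distrib)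
  qed
  show ?thesis unfolding trig_proj_def
  proof (rule the_equality)
    have "l2_inner (\<lambda>x. u x - ?g x) \<phi> = 0" if "\<phi> \<in> trig_space N" for \<phi>
    proof -
      obtain d where \<phi>: "\<phi> = (\<lambda>x. \<Sum>k\<in>{- int N..int N}. d k * fexp k x)"
        using \<open>\<phi> \<in> trig_space N\<close> by (auto simp: trig_space_iff)
      show ?thesis unfolding \<phi>
        by (subst l2_inner_trig_right[OF int_diff]) (auto intro!: sum.neutral simp: diff)
    qed
    then show "?g \<in> trig_space N \<and> (\<forall>\<phi>\<in>trig_space N. l2_inner (\<lambda>x. u x - ?g x) \<phi> = 0)"
      by (auto simp: trig_space_iff)
  next
    fix g assume g: "g \<in> trig_space N \<and> (\<forall>\<phi>\<in>trig_space N. l2_inner (\<lambda>x. u x - g x) \<phi> = 0)"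
    then obtain c where c: "g = (\<lambda>x. \<Sum>k\<in>{- int N..int N}. c k * fexp k x)"
      by (auto simp: trig_space_iff)
    have "c l = fourier_coeff u l" if l: "l \<in> {- int N..int N}" for l
    proof -
      have "fexp l = (\<lambda>x. \<Sum>k\<in>{- int N..int N}. (if k = l then 1 else 0) * fexp k x)"
        using l by (auto simp: if_distrib[of "\<lambda>c. c * _"] cong: if_cong)
      then have "fexp l \<in> trig_space N" unfolding trig_space_iff by (intro exI[of _ "\<lambda>k. if k = l then 1 else 0"])
      then have "l2_inner (\<lambda>x. u x - g x) (fexp l) = 0" using g by blast
      then show ?thesis unfolding c using l by (subst (asm) diff) auto
    qed
    then show "g = ?g" unfolding c by (intro ext sum.cong) auto
  qed
qed

text \<open>The coefficients are combinations of point values, so they inherit pointwise differentiability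
  in time.\<close>

lemma discrete_fourier:
  fixes c :: "int \<Rightarrow> complex"
  assumes f: "f = (\<lambda>x. \<Sum>k\<in>{- int N..int N}. c k * fexp k x)" and l: "\<bar>l\<bar> \<le> int N"
  defines "n \<equiv> 2 * N + 1"
  shows "c l = (\<Sum>j<n. f (2 * pi * real j / real n) * cnj (fexp l (2 * pi * real j / real n))) / of_nat n"
proof -
  have n: "0 < n" by (simp add: n_def)
  define z where "z m = cis (2 * pi * of_int m / real n)" for m :: int
  have pw: "fexp m (2 * pi * real j / real n) = z m ^ j" for m j
    unfolding z_def fexp_cis Complex.DeMoivre by (simp add: field_simps)
  \<comment> \<open>The number of sample points exceeds every \<open>|k - l|\<close>, so no aliasing
    occurs: for \<open>m \<noteq> 0\<close> the number \<open>z m\<close> is an \<open>n\<close>-th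
    root of unity other than \<open>1\<close>.\<close>
  have geo: "(\<Sum>j<n. z m ^ j) = (if m = 0 then of_nat n else 0)" if m: "\<bar>m\<bar> < int n" for m
  proof (cases "m = 0")
    case False
    have "z m \<noteq> 1"
    proof
      assume "z m = 1"
      then have "exp (\<i> * of_real (2 * pi * of_int m / real n)) = 1" by (simp add: z_def cis_conv_exp)
      then obtain p :: int where "2 * pi * of_int m / real n = of_int (2 * p) * pi"
        unfolding exp_eq_1 by auto
      then have "real_of_int m = of_int (p * int n)" using n by (simp add: field_simps)
      then have "m = p * int n" by linarith
      then show False using m False
        by (metis abs_mult abs_of_nat dvd_triv_right dvd_imp_le_int not_le)
    qed
    moreover have "z m ^ n = 1"
    proof -
      have "z m ^ n = cis (2 * pi * of_int m)" unfolding z_def Complex.DeMoivre using n by simp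
      then show ?thesis by (simp add: cis_multiple_2pi)
    qed
    ultimately show ?thesis using False by (simp add: geometric_sum)
  qed (simp add: z_def)
  have fl: "f x * cnj (fexp l x) = (\<Sum>k\<in>{- int N..int N}. c k * fexp (k - l) x)" for x
    unfolding f sum_distrib_right mult.assoc fexp_mult_cnj ..
  have "(\<Sum>j<n. f (2 * pi * real j / real n) * cnj (fexp l (2 * pi * real j / real n))) = (\<Sum>j<n. \<Sum>k\<in>{- int N..int N}. c k * z (k - l) ^ j)"
    by (simp only: fl) (simp only: pw)
  also have "\<dots> = (\<Sum>k\<in>{- int N..int N}. c k * (\<Sum>j<n. z (k - l) ^ j))"
    by (subst sum.swap) (simp add: sum_distrib_left)
  also have "\<dots> = (\<Sum>k\<in>{- int N..int N}. if k = l then c l * of_nat n else 0)"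
    by (rule sum.cong[OF refl], subst geo) (use l in \<open>auto simp: n_def\<close>)
  also have "\<dots> = c l * of_nat n" using l by (auto simp: abs_le_iff)
  finally show ?thesis using n by simp
qed

text \<open>For \<open>t < 0\<close> nothing relates \<open>v t\<close> to \<open>u t\<close>, while
  \<open>galerkin\<close> fixes one formula at all times. Hence the derivative is found anew, one
  coefficient at a time, from \<open>u t = proj N (u t)\<close>.\<close>

lemma galerkinI:
  assumes u: "\<And>t. u t \<in> real_trig N" and uv: "time_deriv u v"
    and v: "\<And>t \<phi>. 0 \<le> t \<Longrightarrow> \<phi> \<in> real_trig N \<Longrightarrow> Itg ((v t + kawahara (u t)) * \<phi>) = 0"
  shows "galerkin N u"
proof -
  have [simp]: "u t \<in> trig_poly" for t using u real_trig_trig_poly by blast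
  have [simp]: "v t \<in> trig_poly" for t using time_deriv_trig_poly[OF uv] by blast
  have "time_deriv (\<lambda>t. proj N (u t)) (\<lambda>t. proj N (- kawahara (u t)))"
    unfolding proj_def
  proof (intro time_deriv_sum time_deriv.separated)
    fix k t assume k: "k \<in> {- int N..int N}" and t: "(0::real) \<le> t"
    have "((\<lambda>t. Itg (u t * cas k)) has_real_derivative Itg (v t * cas k)) (at t within {0..})"
      using time_deriv_Itg[OF time_deriv_mult[OF uv time_deriv_const[of "cas k"]] t] by simp
    moreover have "Itg (v t * cas k) = Itg (- kawahara (u t) * cas k)"
      using v[OF t, of "cas k"] k by (auto simp: cas_real_trig distrib_right abs_le_iff)
    ultimately show "((\<lambda>t. hcoeff (u t) k) has_real_derivative hcoeff (- kawahara (u t)) k) (at t within {0..})"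
      unfolding hcoeff_def by (intro DERIV_cdivide) simp
  qed auto
  moreover have "proj N (- kawahara (u t)) = - proj N (kawahara (u t))" for t
    unfolding proj_def hcoeff_def by (simp add: cst_ring_hom sum_negf)
  ultimately show ?thesis unfolding galerkin_def using u by (simp add: proj_ident)
qed

lemma hartley_has_deriv:
  assumes "\<And>k. ((\<lambda>t. c t k) has_vector_derivative c' k) F"
  shows "((\<lambda>t. hartley (c t) k) has_vector_derivative hartley c' k) F"
  unfolding hartley_def
  by (intro derivative_intros bounded_linear.has_vector_derivative[OF bounded_linear_Re]
     bounded_linear.has_vector_derivative[OF bounded_linear_Im] assms)

lemma semidiscrete_galerkin:
  assumes "semidiscrete_solution N u0 U"
  obtains u where "galerkin N u" "\<And>t. 0 \<le> t \<Longrightarrow> U t = (\<lambda>x. of_real (u t x))"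
proof -
  have U: "\<And>t. 0 \<le> t \<Longrightarrow> U t \<in> trig_space N" "\<And>t. 0 \<le> t \<Longrightarrow> real_valued (U t)"
    and dU: "\<And>t x. 0 \<le> t \<Longrightarrow> (\<lambda>s. U s x) differentiable (at t within {0..})"
    and weak: "\<And>t \<phi>. 0 \<le> t \<Longrightarrow> \<phi> \<in> trig_space N \<Longrightarrow>
      l2_inner (\<lambda>x. vector_derivative (\<lambda>s. U s x) (at t within {0..}) + kawahara_op (U t) x) \<phi> = 0"
    using assms unfolding semidiscrete_solution_def by blast+
  define n where "n = 2 * N + 1"
  define X where "X j = 2 * pi * real j / real n" for j
  define c where "c t k = (\<Sum>j<n. U t (X j) * cnj (fexp k (X j))) / of_nat n" for t k
  define c' where "c' t k = (\<Sum>j<n. vector_derivative (\<lambda>s. U s (X j)) (at t within {0..}) * cnj (fexp k (X j))) / of_nat n" for t k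
  have dc: "((\<lambda>t. c t k) has_vector_derivative c' t k) (at t within {0..})" if "0 \<le> t" for t k
    unfolding c_def c'_def using dU[OF that]
    by (intro has_vector_derivative_divide has_vector_derivative_sum has_vector_derivative_mult_left)
       (auto simp: vector_derivative_works)
  \<comment> \<open>Built from the sampled coefficients at all times, \<open>u t\<close> is a
    polynomial even for \<open>t < 0\<close>, where \<open>U t\<close> is arbitrary; the two agree
    for \<open>t \<ge> 0\<close>.\<close>
  define u where "u t = (\<Sum>k\<in>{- int N..int N}. cst (hartley (c t) k) * cas k)" for t
  define v where "v t = (\<Sum>k\<in>{- int N..int N}. cst (hartley (c' t) k) * cas k)" for t
  have u: "u t \<in> real_trig N" for t by (auto simp: u_def real_trig_def)
  then have [simp]: "u t \<in> trig_poly" for t using real_trig_trig_poly by blast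
  have uv: "time_deriv u v"
    unfolding u_def v_def
    by (intro time_deriv_sum time_deriv.separated)
       (auto simp: has_real_derivative_iff_has_vector_derivative intro!: hartley_has_deriv dc)
  have [simp]: "v t \<in> trig_poly" for t using time_deriv_trig_poly[OF uv] by blast
  have Uu: "U t = (\<lambda>x. of_real (u t x))" if t: "0 \<le> t" for t
  proof
    fix x
    obtain b where b: "U t = (\<lambda>x. \<Sum>k\<in>{- int N..int N}. b k * fexp k x)"
      using U(1)[OF t] by (auto simp: trig_space_iff)
    have "b k = c t k" if "\<bar>k\<bar> \<le> int N" for k
      unfolding c_def X_def n_def by (rule discrete_fourier[OF b that])
    then have "U t x = (\<Sum>k\<in>{- int N..int N}. c t k * fexp k x)"
      unfolding b by (intro sum.cong) auto
    then have "Re (U t x) = u t x" by (simp add: Re_trig_hartley u_def del: Re_sum)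
    moreover have "U t x \<in> \<real>" using U(2)[OF t] by (simp add: real_valued_def)
    ultimately show "U t x = of_real (u t x)" by (metis of_real_Re)
  qed
  have dUv: "vector_derivative (\<lambda>s. U s x) (at t within {0..}) = of_real (v t x)" if t: "0 \<le> t" for t x
  proof (rule vector_derivative_within)
    have "t islimpt {0..}"
    proof (rule connected_imp_perfect)
      show "{0..} \<noteq> {x}" for x :: real
        by (metis atLeast_iff order_refl singletonD zero_le_one zero_neq_one)
    qed (use t in auto)
    then show "at t within {0..} \<noteq> bot" by (simp add: trivial_limit_within)
    have "((\<lambda>s. u s x) has_vector_derivative v t x) (at t within {0..})"
      using time_deriv_apply[OF uv t] by (simp add: has_real_derivative_iff_has_vector_derivative)
    then have "((\<lambda>s. complex_of_real (u s x)) has_vector_derivative of_real (v t x)) (at t within {0..})"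
      by (rule bounded_linear.has_vector_derivative[OF bounded_linear_of_real])
    then show "((\<lambda>s. U s x) has_vector_derivative of_real (v t x)) (at t within {0..})"
      by (rule has_vector_derivative_transform[rotated 2]) (use t Uu in auto)
  qed
  have "galerkin N u"
  proof (rule galerkinI[OF u uv])
    fix t \<phi> assume t: "(0::real) \<le> t" and \<phi>: "\<phi> \<in> real_trig N"
    have "l2_inner (\<lambda>x. of_real ((v t + kawahara (u t)) x)) (\<lambda>x. of_real (\<phi> x)) = 0"
      using weak[OF t of_real_trig_space[OF \<phi>]] by (simp add: dUv[OF t] Uu[OF t] kawahara_op_of_real fun_app)
    then show "Itg ((v t + kawahara (u t)) * \<phi>) = 0"
      using \<phi> real_trig_trig_poly by (subst (asm) l2_inner_of_real) auto
  qed
  then show ?thesis using that Uu by blast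
qed

lemma initial_bound:
  assumes u0: "u0 \<in> sobolev_space r"
  obtains B where "\<And>N g j. g \<in> real_trig N \<Longrightarrow> trig_proj N u0 = (\<lambda>x. of_real (g x)) \<Longrightarrow> j \<le> r \<Longrightarrow> nrm ((D ^^ j) g) \<le> B"
proof -
  let ?w = "\<lambda>k::int. (1 + (real_of_int k)\<^sup>2) ^ r * (cmod (fourier_coeff u0 k))\<^sup>2"
  have sm: "?w summable_on UNIV" using u0 by (simp add: sobolev_space_def)
  \<comment> \<open>Parseval's identity contributes \<open>2 * pi\<close>, and the pairing of
    \<open>k\<close> with \<open>- k\<close> in \<open>hartley_square\<close> another factor
    \<open>2\<close>. The total over all frequencies makes the bound independent of
    \<open>N\<close>.\<close>
  let ?B = "4 * pi * infsum ?w UNIV"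
  have "nrm ((D ^^ j) g) \<le> sqrt ?B"
    if g: "g \<in> real_trig N" and eq: "trig_proj N u0 = (\<lambda>x. of_real (g x))" and j: "j \<le> r" for N g j
  proof -
    let ?c = "fourier_coeff u0"
    have "g = (\<Sum>k\<in>{- int N..int N}. cst (hartley ?c k) * cas k)"
    proof
      fix x
      have "complex_of_real (g x) = (\<Sum>k\<in>{- int N..int N}. ?c k * fexp k x)"
        using fun_cong[OF eq, of x] by (simp add: trig_proj_fourier[OF u0])
      then have "g x = Re (\<Sum>k\<in>{- int N..int N}. ?c k * fexp k x)" by (metis Re_complex_of_real)
      then show "g x = (\<Sum>k\<in>{- int N..int N}. cst (hartley ?c k) * cas k) x" by (simp add: Re_trig_hartley del: Re_sum)
    qed
    then have h: "hcoeff g k = hartley ?c k" if "\<bar>k\<bar> \<le> int N" for k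
      using Itg_cas_sum[OF that, of "hartley ?c"] by (simp add: hcoeff_def)
    have "(nrm ((D ^^ j) g))\<^sup>2 = 2 * pi * (\<Sum>k\<in>{- int N..int N}. (of_int k) ^ (2 * j) * (hcoeff g k)\<^sup>2)"
      by (rule nrm_Dpow_expand[OF g])
    also have "\<dots> \<le> 2 * pi * (\<Sum>k\<in>{- int N..int N}. ?w k + ?w (- k))"
    proof (intro mult_left_mono sum_mono)
      fix k assume k: "k \<in> {- int N..int N}"
      have "real_of_int k ^ (2 * j) = ((real_of_int k)\<^sup>2) ^ j" by (simp add: power_mult)
      also have "\<dots> \<le> (1 + (real_of_int k)\<^sup>2) ^ j" by (intro power_mono) auto
      also have "\<dots> \<le> (1 + (real_of_int k)\<^sup>2) ^ r" using j by (intro power_increasing) auto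
      finally have "real_of_int k ^ (2 * j) * (hcoeff g k)\<^sup>2 \<le> (1 + (real_of_int k)\<^sup>2) ^ r * ((cmod (?c k))\<^sup>2 + (cmod (?c (- k)))\<^sup>2)"
        using h[of k] k hartley_square[of ?c k] by (intro mult_mono) auto
      then show "real_of_int k ^ (2 * j) * (hcoeff g k)\<^sup>2 \<le> ?w k + ?w (- k)" by (simp add: distrib_left)
    qed auto
    also have "(\<Sum>k\<in>{- int N..int N}. ?w k + ?w (- k)) = 2 * (\<Sum>k\<in>{- int N..int N}. ?w k)"
    proof -
      have "(\<Sum>k\<in>{- int N..int N}. ?w (- k)) = (\<Sum>k\<in>{- int N..int N}. ?w k)"
        by (rule sum.reindex_bij_witness[of _ uminus uminus]) auto
      then show ?thesis by (simp add: sum.distrib)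
    qed
    also have "2 * pi * (2 * (\<Sum>k\<in>{- int N..int N}. ?w k)) \<le> 2 * pi * (2 * infsum ?w UNIV)"
      by (intro mult_left_mono finite_sum_le_infsum sm) auto
    finally have "(nrm ((D ^^ j) g))\<^sup>2 \<le> ?B" by simp
    then show ?thesis by (rule real_le_rsqrt)
  qed
  then show ?thesis using that by blast
qed

theorem theorem4p1:
  fixes T C\<^sub>0 :: real and r :: nat and u\<^sub>0 :: "real \<Rightarrow> complex"
    and U :: "nat \<Rightarrow> real \<Rightarrow> real \<Rightarrow> complex"
  assumes "0 < T" and "r \<ge> 16"
    and "u\<^sub>0 \<in> sobolev_space r" and "real_valued u\<^sub>0"
    and "C\<^sub>0 > 0"
    and "\<And>N. N \<ge> 1 \<Longrightarrow> semidiscrete_solution N u\<^sub>0 (U N)"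
  shows "\<exists>C\<^sub>1>0. \<exists>C>0. \<forall>(N::nat) (M::nat) (dt::real) (V :: nat \<Rightarrow> real \<Rightarrow> complex).
    N \<ge> 1 \<longrightarrow> M \<ge> 1 \<longrightarrow> dt = T / real M \<longrightarrow> real N ^ 5 * dt \<le> C\<^sub>1 \<longrightarrow>
    leapfrog N M dt V \<longrightarrow>
    V 0 = U N 0 \<longrightarrow>
    l2_norm (\<lambda>x. V 1 x - U N dt x) \<le> C\<^sub>0 * dt\<^sup>2 \<longrightarrow>
    (MAX m\<in>{0..M}. l2_norm (\<lambda>x. V m x - U N (real m * dt) x)) \<le> C * dt\<^sup>2"
proof -
  have "\<forall>N. \<exists>u. 1 \<le> N \<longrightarrow> galerkin N u \<and> (\<forall>t\<ge>0. U N t = (\<lambda>x. of_real (u t x)))"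
    using assms(6) by (metis semidiscrete_galerkin)
  then obtain u where g: "\<And>N. 1 \<le> N \<Longrightarrow> galerkin N (u N)"
    and Uu: "\<And>N t. 1 \<le> N \<Longrightarrow> 0 \<le> t \<Longrightarrow> U N t = (\<lambda>x. of_real (u N t x))"
    by metis
  obtain B where B: "\<And>N g j. g \<in> real_trig N \<Longrightarrow> trig_proj N u\<^sub>0 = (\<lambda>x. of_real (g x)) \<Longrightarrow> j \<le> r \<Longrightarrow> nrm ((D ^^ j) g) \<le> B"
    using initial_bound[OF assms(3)] by blast
  have B: "nrm ((D ^^ j) (u N 0)) \<le> B" if "1 \<le> N" "j \<le> 16" for N j
  proof (rule B)
    show "u N 0 \<in> real_trig N" using galerkinD(1)[OF g[OF that(1)]] .
    show "trig_proj N u\<^sub>0 = (\<lambda>x. of_real (u N 0 x))"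
      using assms(6)[OF that(1)] Uu[OF that(1), of 0] by (simp add: semidiscrete_solution_def)
  qed (use that assms(2) in simp)
  obtain G v w z where G0: "0 \<le> G"
    and v: "\<And>N. 1 \<le> N \<Longrightarrow> v N = (\<lambda>t. - proj N (kawahara (u N t)))"
    and td: "\<And>N. 1 \<le> N \<Longrightarrow> time_deriv (u N) (v N)" "\<And>N. 1 \<le> N \<Longrightarrow> time_deriv (v N) (w N)"
      "\<And>N. 1 \<le> N \<Longrightarrow> time_deriv (w N) (z N)"
    and G: "\<And>N t x. 1 \<le> N \<Longrightarrow> t \<in> {0..T} \<Longrightarrow> x \<in> {-pi..pi} \<Longrightarrow>
       \<bar>u N t x\<bar> \<le> G \<and> \<bar>D (u N t) x\<bar> \<le> G \<and> \<bar>v N t x\<bar> \<le> G \<and> \<bar>z N t x\<bar> \<le> G"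
    by (rule galerkin_regularity[OF g less_imp_le[OF assms(1)] B]) (assumption | rule that; assumption)+
  \<comment> \<open>The factor \<open>3\<close> is that of \<open>nrm_bounded_le\<close>, the factor
    \<open>2\<close> that of \<open>central_difference\<close>.\<close>
  define R where "R = 6 * G"
  define A where "A = 3 * G + 3"
  define K where "K = sqrt (exp (8 * A * T) * (4 * C\<^sub>0\<^sup>2 + 4 * T * R\<^sup>2))"
  have "0 < exp (8 * A * T) * (4 * C\<^sub>0\<^sup>2 + 4 * T * R\<^sup>2)"
    using assms(1,5) by (intro mult_pos_pos add_pos_nonneg) auto
  then have K: "0 < K" "K\<^sup>2 = exp (8 * A * T) * (4 * C\<^sub>0\<^sup>2 + 4 * T * R\<^sup>2)"
    by (simp_all add: K_def)
  have A0: "0 \<le> A" using G0 by (simp add: A_def)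
  \<comment> \<open>The sum dominates each quantity that the stability lemma wants small after
    multiplication by \<open>c\<close>, so \<open>c = 1 / s\<close> meets all conditions at
    once.\<close>
  define s where "s = 1 + 2 * (2 + G) + 4 * A + 4 * K"
  have s: "0 < s" "1 \<le> s" "2 * (2 + G) \<le> s" "4 * A \<le> s" "4 * K \<le> s"
    using G0 A0 K(1) by (auto simp: s_def)
  show ?thesis
  proof (rule exI[of _ "1 / s"], rule conjI[OF _ exI[of _ K]], use s in \<open>simp\<close>, intro conjI allI impI)
    fix N M :: nat and dt :: real and V :: "nat \<Rightarrow> real \<Rightarrow> complex"
    assume N: "1 \<le> N" and M: "1 \<le> M" and dt: "dt = T / real M" and cfl: "real N ^ 5 * dt \<le> 1 / s"
      and lf: "leapfrog N M dt V" and V0: "V 0 = U N 0" and V1: "l2_norm (\<lambda>x. V 1 x - U N dt x) \<le> C\<^sub>0 * dt\<^sup>2"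
    have dt0: "0 < dt" and Mdt: "real M * dt = T" using M assms(1) by (auto simp: dt)
    have tm: "real m * dt \<in> {0..T}" if "m \<le> M" for m
    proof -
      have "real m * dt \<le> real M * dt" using that dt0 by (intro mult_right_mono) auto
      then show ?thesis using dt0 Mdt by simp
    qed
    have scheme: "l2_inner (\<lambda>x. V (m + 1) x - V (m - 1) x) \<phi> + 2 * of_real dt * l2_inner (kawahara_op (V m)) \<phi> = 0"
      if "1 \<le> m" "m \<le> M - 1" "\<phi> \<in> trig_space N" for m \<phi>
      using lf that unfolding leapfrog_def by blast
    have "\<forall>m. \<exists>f. m \<le> M \<longrightarrow> f \<in> real_trig N \<and> V m = (\<lambda>x. of_real (f x))"
      using lf unfolding leapfrog_def by (metis Re_trig_space)
    then obtain f where f: "\<And>m. m \<le> M \<Longrightarrow> f m \<in> real_trig N" "\<And>m. m \<le> M \<Longrightarrow> V m = (\<lambda>x. of_real (f m x))"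
      by metis
    have ftp: "f m \<in> trig_poly" if "m \<le> M" for m using f(1)[OF that] real_trig_trig_poly by blast
    define y where "y m = u N (real m * dt)" for m
    define e where "e m = f m - y m" for m
    \<comment> \<open>The truncation error: tested in \<open>real_trig N\<close>, the velocity
      \<open>v\<close> is minus \<open>kawahara (y m)\<close>, so this is the residual of the exact
      solution in the scheme.\<close>
    define \<tau> where "\<tau> m = y (m + 1) - y (m - 1) - cst (2 * dt) * v N (real m * dt)" for m
    have y: "y m \<in> real_trig N" "y m \<in> trig_poly" for m
      using galerkinD(1,2)[OF g[OF N]] by (auto simp: y_def)
    have [simp]: "y m \<in> trig_poly" "v N t \<in> trig_poly" for m t
      using y time_deriv_trig_poly[OF td(1)[OF N]] by auto
    have err: "l2_norm (\<lambda>x. V m x - U N (real m * dt) x) = nrm (e m)" if m: "m \<le> M" for m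
    proof -
      have "(\<lambda>x. V m x - U N (real m * dt) x) = (\<lambda>x. of_real (e m x))"
        using m dt0 N by (simp add: f Uu e_def y_def fun_app)
      then show ?thesis using ftp[OF m] by (simp add: l2_norm_of_real e_def)
    qed
    have u_apply: "((\<lambda>t. u N t x) has_real_derivative v N t x) (at t within {0..})"
      "((\<lambda>t. v N t x) has_real_derivative w N t x) (at t within {0..})"
      "((\<lambda>t. w N t x) has_real_derivative z N t x) (at t within {0..})" if "0 \<le> t" for t x
      using time_deriv_apply td[OF N] that by blast+
    have "nrm (e m) \<le> K * dt\<^sup>2" if m: "m \<le> M" for m
    proof (rule leapfrog_stability[OF N dt0 _ M, where u = y and e = e and \<tau> = \<tau> and G = G and R = R and T = T and ?c0.0 = "C\<^sub>0" and c = "1 / s"])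
      show "real M * dt \<le> T" using Mdt by simp
      show "e m \<in> real_trig N" if "m \<le> M" for m
        using f(1)[OF that] y by (simp add: e_def real_trig_diff)
      show "\<tau> m \<in> trig_poly" for m by (simp add: \<tau>_def)
      show "\<bar>y m x\<bar> \<le> G" "\<bar>D (y m) x\<bar> \<le> G" if "m \<le> M" "x \<in> {-pi..pi}" for m x
        using G[OF N tm[OF that(1)] that(2)] by (auto simp: y_def)
      show "\<bar>(y (Suc m) - y m) x\<bar> \<le> G * dt" if m: "Suc m \<le> M" and x: "x \<in> {-pi..pi}" for m x
      proof -
        have "\<bar>u N (real (Suc m) * dt) x - u N (real m * dt) x\<bar> \<le> G * \<bar>real (Suc m) * dt - real m * dt\<bar>"
          by (rule half_line_mean_value[where T = T and g' = "\<lambda>t. v N t x"]) (use u_apply G[OF N _ x] tm[OF m] tm[of m] m in auto)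
        then show ?thesis using dt0 by (simp add: y_def fun_app algebra_simps)
      qed
      show "Itg ((e (Suc (Suc m)) - e m) * \<phi>) + 2 * dt * Itg ((kawahara (y (Suc m) + e (Suc m)) - kawahara (y (Suc m))) * \<phi>)
          + Itg (\<tau> (Suc m) * \<phi>) = 0" if m: "Suc (Suc m) \<le> M" and \<phi>: "\<phi> \<in> real_trig N" for m \<phi>
      proof -
        have [simp]: "\<phi> \<in> trig_poly" using \<phi> real_trig_trig_poly by blast
        have [simp]: "f m \<in> trig_poly" "f (Suc m) \<in> trig_poly" "f (Suc (Suc m)) \<in> trig_poly" using ftp m by auto
        have "l2_inner (\<lambda>x. V (Suc m + 1) x - V (Suc m - 1) x) (\<lambda>x. of_real (\<phi> x))
          + 2 * of_real dt * l2_inner (kawahara_op (V (Suc m))) (\<lambda>x. of_real (\<phi> x)) = 0"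
          by (rule scheme) (use m of_real_trig_space[OF \<phi>] in auto)
        moreover have "(\<lambda>x. V (Suc m + 1) x - V (Suc m - 1) x) = (\<lambda>x. of_real ((f (Suc (Suc m)) - f m) x))"
          using m by (simp add: f fun_app)
        moreover have "kawahara_op (V (Suc m)) = (\<lambda>x. of_real (kawahara (f (Suc m)) x))"
          using m by (simp add: f kawahara_op_of_real)
        ultimately have "complex_of_real (Itg ((f (Suc (Suc m)) - f m) * \<phi>) + 2 * dt * Itg (kawahara (f (Suc m)) * \<phi>)) = 0"
          by (simp add: l2_inner_of_real)
        then have 1: "Itg ((f (Suc (Suc m)) - f m) * \<phi>) + 2 * dt * Itg (kawahara (f (Suc m)) * \<phi>) = 0"
          by (simp only: of_real_eq_0_iff)
        have 2: "Itg (v N (real (Suc m) * dt) * \<phi>) = - Itg (kawahara (y (Suc m)) * \<phi>)"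
          unfolding v[OF N] y_def by (rule galerkin_test[OF g[OF N] \<phi>])
        have "Itg (\<tau> (Suc m) * \<phi>) = Itg (y (Suc (Suc m)) * \<phi>) - Itg (y m * \<phi>) - 2 * dt * Itg (v N (real (Suc m) * dt) * \<phi>)"
          unfolding \<tau>_def by (simp add: left_diff_distrib mult.assoc)
        moreover have "y (Suc m) + e (Suc m) = f (Suc m)" by (simp add: e_def)
        ultimately show ?thesis
          using 1 unfolding 2 e_def by (simp add: left_diff_distrib right_diff_distrib)
      qed
      show "nrm (\<tau> (Suc m)) \<le> R * dt ^ 3" if m: "Suc (Suc m) \<le> M" for m
      proof -
        have "nrm (\<tau> (Suc m)) \<le> 3 * (2 * dt ^ 3 * G)"
        proof (rule nrm_bounded_le)
          fix x assume x: "x \<in> {-pi..pi}"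
          let ?t = "real (Suc m) * dt"
          have "\<bar>u N (?t + dt) x - u N (?t - dt) x - 2 * dt * v N ?t x\<bar> \<le> 2 * dt ^ 3 * G"
            by (rule central_difference[where T = T and ?g2.0 = "\<lambda>t. w N t x" and ?g3.0 = "\<lambda>t. z N t x"])
               (use u_apply G[OF N _ x] tm[OF m] dt0 in \<open>auto simp: algebra_simps\<close>)
          moreover have "?t + dt = real (Suc (Suc m)) * dt" "?t - dt = real m * dt" by (simp_all add: algebra_simps)
          ultimately show "\<bar>\<tau> (Suc m) x\<bar> \<le> 2 * dt ^ 3 * G" by (simp add: \<tau>_def y_def fun_app)
        qed (simp add: \<tau>_def)
        then show ?thesis by (simp add: R_def mult_ac)
      qed
      show "e 0 = 0"
      proof
        fix x
        have "complex_of_real (f 0 x) = of_real (u N 0 x)"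
          using fun_cong[OF V0, of x] f(2)[of 0] Uu[OF N, of 0] by simp
        then show "e 0 x = 0 x" by (simp add: e_def y_def fun_app)
      qed
      show "nrm (e 1) \<le> C\<^sub>0 * dt\<^sup>2" using V1 err[of 1] M by simp
      show "K\<^sup>2 = exp (8 * (3 * G + 3) * T) * (4 * C\<^sub>0\<^sup>2 + 4 * T * R\<^sup>2)" using K by (simp add: A_def)
      show "4 * (3 * G + 3) * (1 / s) \<le> 1" using s by (simp add: A_def)
    qed (use G0 y K(1) cfl s m in auto)
    then show "(MAX m\<in>{0..M}. l2_norm (\<lambda>x. V m x - U N (real m * dt) x)) \<le> K * dt\<^sup>2"
      using err by simp
  qed (use s K in auto)
qed

end
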